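(* Let $p$ be a fixed prime. Suppose $s\in(0,1)$ and $s<t<2-s$. Then for every $\epsilon>0$ and $\eta=\frac{\epsilon^2}{1225}$, the following holds for any $\delta\in p^{-\mathbb{N}}$ sufficiently small. Let $(\mathcal{P},\mathcal{T})$ be a $(\delta,s,\delta^{-\eta},M)$-nice configuration, with $M\ge\delta^{-s+\eta}$. Suppose $|\mathcal{P}|_\delta\sim\delta^{-t}$, and that $\mathcal{P}\subset\mathcal{P}_\delta$ satisfies the spacing condition $$|\mathcal{P}\cap Q|_\delta\lesssim\delta^{-\eta}\cdot\max\left(\rho^{2-s}|\mathcal{P}|_\delta,\ (\rho/\delta)^s\right)\qquad\text{for all }\rho\in p^{-\mathbb{Z}_{\ge0}}\text{ with }\delta\le\rho\le1\text{ and all }Q\in\mathcal{D}_\rho(\mathcal{P}).$$ Then $$|\mathcal{T}|_\delta\gtrsim_\epsilon\delta^{-\frac{s+t}{2}+\epsilon}M .$$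
   Context: Notation. $p$ is a fixed prime, $\|\cdot\|$ is the $p$-adic norm on $\mathbb{Z}_p$, and $p^{-\mathbb{N}}=\{p^{-n}:n\in\mathbb{N}\}$, $p^{-\mathbb{Z}_{\ge0}}=\{p^{-n}:n\in\mathbb{Z}_{\ge0}\}$. $A\lesssim B$ means $A\le CB$ for some constant $C>0$; $A\gtrsim B$ means $B\lesssim A$; $A\sim B$ means both. A subscript, as in $\gtrsim_\epsilon$, means that the implicit constant may depend on the subscript. Implicit constants never depend on $\delta$ or on the configuration (they may depend on the fixed prime $p$). Cubes. For $\delta=p^{-n}$ and $x=(a,b)\in\mathbb{Z}_p^2$, the $\delta$-cube is $B(x,\delta)=\{(a_0,b_0):\|a-a_0\|\le\delta,\ \|b-b_0\|\le\delta\}$. $\mathcal{P}_\delta$ is the set of all $\delta$-cubes in $\mathbb{Z}_p^2$. For $P\subset\mathbb{Z}_p^2$, $\mathcal{D}_\delta(P)$ is the set of $\delta$-cubes meeting $P$, and $|P|_\delta:=|\mathcal{D}_\delta(P)|$. A set of cubes is identified with the union of its cubes for this notation; for $\mathcal{P}\subset\mathcal{P}_\delta$, $|\mathcal{P}|_\delta$ is the number of cubes in $\mathcal{P}$, and $|\mathcal{P}\cap Q|_\delta$ is the number of cubes of $\mathcal{P}$ contained in $Q$. $(\delta,s,C)$-sets. A nonempty bounded $A\subset\mathbb{Z}_p^2$ is a $(\delta,s,C)$-set if $|A\cap B(x,r)|_\delta\le Cr^s|A|_\delta$ for all $r=p^{-m}\in[\delta,1]$ and $x\in\mathbb{Z}_p^2$.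 A set of $\delta$-cubes is a $(\delta,s,C)$-set if the union of its cubes is. Tubes. For $(a,b)\in\mathbb{Z}_p^2$ let $\mathbf{D}(a,b)=\{(x,y)\in\mathbb{Z}_p^2:y=ax+b\}$. A $\delta$-tube is a set $\mathbf{D}(\mathscr{p}):=\bigcup_{x\in\mathscr{p}}\mathbf{D}(x)$ with $\mathscr{p}\in\mathcal{P}_\delta$; $\mathcal{T}_\delta$ is the set of all $\delta$-tubes. A collection $\{\mathbf{D}(\mathscr{p})\}_{\mathscr{p}\in\mathcal{P}}$ is a $(\delta,s,C)$-set if $\mathcal{P}$ is. For a set $\mathcal{T}$ of $\delta$-tubes, $|\mathcal{T}|_\delta=|\mathcal{T}|$ is the number of tubes. Configurations. A pair $(\mathcal{P},\mathcal{T})$ with $\mathcal{P}\subset\mathcal{P}_\delta$, $\mathcal{T}\subset\mathcal{T}_\delta$ is a $\delta$-configuration if every $\mathscr{p}\in\mathcal{P}$ is associated with a subset $\mathcal{T}(\mathscr{p})\subset\mathcal{T}$ such that $\mathscr{p}\subset T$ for all $T\in\mathcal{T}(\mathscr{p})$ ($\mathcal{T}(\mathscr{p})$ need not consist of all tubes in $\mathcal{T}$ containing $\mathscr{p}$). For $M\in\mathbb{N}$ it is a $(\delta,s,C,M)$-nice configuration if, for every $\mathscr{p}\in\mathcal{P}$, $\mathcal{T}(\mathscr{p})$ is a $(\delta,s,C)$-set with $|\mathcal{T}(\mathscr{p})|\sim M$. *)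

theory Defs
  imports Complex_Main "HOL-Algebra.Ring" "HOL-Computational_Algebra.Primes"
begin

text \<open>
  The ring of \<open>p\<close>-adic integers as the inverse limit of the rings \<open>Z / p^n Z\<close>: an element is the
  sequence of its residues, \<open>x n\<close> being the residue modulo \<open>p^n\<close> (so \<open>x 0 = 0\<close>).
\<close>

type_synonym padic = "nat \<Rightarrow> int"
type_synonym padic_plane_set = "(padic \<times> padic) set"

definition Zp :: "nat \<Rightarrow> padic ring" where
  "Zp p = \<lparr>carrier = {x. \<forall>n. x n \<in> {0..<int p ^ n} \<and> x (Suc n) mod int p ^ n = x n},
           monoid.mult = (\<lambda>x y n. (x n * y n) mod int p ^ n),
           one = (\<lambda>n. 1 mod int p ^ n),
           zero = (\<lambda>n. 0),
           add = (\<lambda>x y n. (x n + y n) mod int p ^ n)\<rparr>"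

text \<open>
  The valuation of \<open>x \<noteq> 0\<close> is the largest \<open>n\<close> for which the residue modulo \<open>p^n\<close> vanishes.
\<close>

definition Zp_norm :: "nat \<Rightarrow> padic \<Rightarrow> real" where
  "Zp_norm p x = (if x = \<zero>\<^bsub>Zp p\<^esub> then 0 else real p powi (- int (GREATEST n. x n = 0)))"

definition Zp_plane :: "nat \<Rightarrow> padic_plane_set" where
  "Zp_plane p = carrier (Zp p) \<times> carrier (Zp p)"

text \<open>The scales \<open>p^(-n)\<close> with \<open>n \<ge> 0\<close>; the scales \<open>p^(-n)\<close> with \<open>n \<ge> 1\<close> are those below \<open>1\<close>.\<close>

definition scales :: "nat \<Rightarrow> real set" where
  "scales p = {real p powi (- int n) | n. True}"

definition cube :: "nat \<Rightarrow> padic \<times> padic \<Rightarrow> real \<Rightarrow> padic_plane_set" where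
  "cube p x \<delta> = {y \<in> Zp_plane p. Zp_norm p (fst x \<ominus>\<^bsub>Zp p\<^esub> fst y) \<le> \<delta> \<and>
                                 Zp_norm p (snd x \<ominus>\<^bsub>Zp p\<^esub> snd y) \<le> \<delta>}"

definition cubes :: "nat \<Rightarrow> real \<Rightarrow> padic_plane_set set" where
  "cubes p \<delta> = {cube p x \<delta> | x. x \<in> Zp_plane p}"

definition cubes_meeting :: "nat \<Rightarrow> real \<Rightarrow> padic_plane_set \<Rightarrow> padic_plane_set set" where
  "cubes_meeting p \<delta> A = {q \<in> cubes p \<delta>. q \<inter> A \<noteq> {}}"

definition covering_number :: "nat \<Rightarrow> real \<Rightarrow> padic_plane_set \<Rightarrow> nat" where
  "covering_number p \<delta> A = card (cubes_meeting p \<delta> A)"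

text \<open>Boundedness is automatic for subsets of the plane over the \<open>p\<close>-adic integers.\<close>

definition delta_set :: "nat \<Rightarrow> real \<Rightarrow> real \<Rightarrow> real \<Rightarrow> padic_plane_set \<Rightarrow> bool" where
  "delta_set p \<delta> s C A \<longleftrightarrow> A \<noteq> {} \<and> A \<subseteq> Zp_plane p \<and>
     (\<forall>r \<in> scales p. \<forall>x \<in> Zp_plane p. \<delta> \<le> r \<and> r \<le> 1 \<longrightarrow>
        real (covering_number p \<delta> (A \<inter> cube p x r))
          \<le> C * r powr s * real (covering_number p \<delta> A))"

definition line :: "nat \<Rightarrow> padic \<times> padic \<Rightarrow> padic_plane_set" where
  "line p ab = {(x, y) \<in> Zp_plane p. y = fst ab \<otimes>\<^bsub>Zp p\<^esub> x \<oplus>\<^bsub>Zp p\<^esub> snd ab}"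

definition tube :: "nat \<Rightarrow> padic_plane_set \<Rightarrow> padic_plane_set" where
  "tube p q = (\<Union>ab \<in> q. line p ab)"

definition tubes :: "nat \<Rightarrow> real \<Rightarrow> padic_plane_set set" where
  "tubes p \<delta> = tube p ` cubes p \<delta>"

text \<open>
  The family of parameter cubes below is unique: see \<open>inj_on_tube\<close>.
\<close>

definition delta_set_tubes ::
    "nat \<Rightarrow> real \<Rightarrow> real \<Rightarrow> real \<Rightarrow> padic_plane_set set \<Rightarrow> bool" where
  "delta_set_tubes p \<delta> s C \<T> \<longleftrightarrow>
     (\<exists>\<Q> \<subseteq> cubes p \<delta>. \<T> = tube p ` \<Q> \<and> delta_set p \<delta> s C (\<Union>\<Q>))"

text \<open>\<open>A \<sim> B\<close> with implicit constant \<open>K\<close>.\<close>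

definition comparable :: "real \<Rightarrow> real \<Rightarrow> real \<Rightarrow> bool" where
  "comparable K A B \<longleftrightarrow> A \<le> K * B \<and> B \<le> K * A"

text \<open>The argument \<open>\<T>of\<close> is the association of a family of tubes to each cube.\<close>

definition configuration ::
    "nat \<Rightarrow> real \<Rightarrow> padic_plane_set set \<Rightarrow> padic_plane_set set \<Rightarrow>
     (padic_plane_set \<Rightarrow> padic_plane_set set) \<Rightarrow> bool" where
  "configuration p \<delta> \<P> \<T> \<T>of \<longleftrightarrow> \<P> \<subseteq> cubes p \<delta> \<and> \<T> \<subseteq> tubes p \<delta> \<and>
     (\<forall>q \<in> \<P>. \<T>of q \<subseteq> \<T> \<and> (\<forall>T \<in> \<T>of q. q \<subseteq> T))"

text \<open>\<open>K\<close> is the implicit constant in the requirement that each cube has about \<open>M\<close> tubes.\<close>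

definition nice_configuration ::
    "real \<Rightarrow> nat \<Rightarrow> real \<Rightarrow> real \<Rightarrow> real \<Rightarrow> nat \<Rightarrow> padic_plane_set set \<Rightarrow> padic_plane_set set \<Rightarrow>
     (padic_plane_set \<Rightarrow> padic_plane_set set) \<Rightarrow> bool" where
  "nice_configuration K p \<delta> s C M \<P> \<T> \<T>of \<longleftrightarrow> configuration p \<delta> \<P> \<T> \<T>of \<and>
     (\<forall>q \<in> \<P>. delta_set_tubes p \<delta> s C (\<T>of q) \<and> comparable K (real (card (\<T>of q))) (real M))"

lemma Zp_carrierD:
  assumes "x \<in> carrier (Zp p)"
  shows "0 \<le> x n" "x n < int p ^ n" "x (Suc n) mod int p ^ n = x n"
  using assms by (auto simp: Zp_def)

lemma Zp_add_nth: "(x \<oplus>\<^bsub>Zp p\<^esub> y) n = (x n + y n) mod int p ^ n"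
  by (simp add: Zp_def)

lemma Zp_mod_le:
  assumes "x \<in> carrier (Zp p)" "m \<le> n"
  shows "x n mod int p ^ m = x m"
  using assms(2)
proof (induction n rule: dec_induct)
  case base
  then show ?case using Zp_carrierD[OF assms(1)] by simp
next
  case (step n)
  have "int p ^ m dvd int p ^ n" using step by (simp add: le_imp_power_dvd)
  then have "x (Suc n) mod int p ^ m = x (Suc n) mod int p ^ n mod int p ^ m"
    by (simp add: mod_mod_cancel)
  then show ?case using step Zp_carrierD(3)[OF assms(1)] by simp
qed

lemma cring_Zp:
  assumes "p > 0"
  shows "cring (Zp p)"
proof -
  have pos: "int p ^ n > 0" for n using assms by simp
  have dv: "(a mod (int p * int p ^ n)) mod int p ^ n = a mod int p ^ n" for a n
    by (rule mod_mod_cancel) simp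
  have M: "x mod int p ^ n = x" if "0 \<le> x" "x < int p ^ n" for x n
    using that by simp
  show ?thesis
  proof (rule cringI)
    show "abelian_group (Zp p)"
    proof (rule abelian_groupI)
      fix x y z assume xyz: "x \<in> carrier (Zp p)" "y \<in> carrier (Zp p)"
      have "((x (Suc n) + y (Suc n)) mod int p ^ n) = (x n + y n) mod int p ^ n" for n
        using Zp_carrierD(3)[OF xyz(1), of n] Zp_carrierD(3)[OF xyz(2), of n]
        by (metis mod_add_eq)
      then show "x \<oplus>\<^bsub>Zp p\<^esub> y \<in> carrier (Zp p)"
        using pos by (simp add: Zp_def dv)
    next
      show "\<zero>\<^bsub>Zp p\<^esub> \<in> carrier (Zp p)" using pos assms by (simp add: Zp_def)
    next
      fix x y z
      show "x \<oplus>\<^bsub>Zp p\<^esub> y \<oplus>\<^bsub>Zp p\<^esub> z = x \<oplus>\<^bsub>Zp p\<^esub> (y \<oplus>\<^bsub>Zp p\<^esub> z)"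
        by (simp add: Zp_def fun_eq_iff mod_simps add.assoc)
    next
      fix x y
      show "x \<oplus>\<^bsub>Zp p\<^esub> y = y \<oplus>\<^bsub>Zp p\<^esub> x" by (simp add: Zp_def add.commute)
    next
      fix x assume x: "x \<in> carrier (Zp p)"
      show "\<zero>\<^bsub>Zp p\<^esub> \<oplus>\<^bsub>Zp p\<^esub> x = x"
        using Zp_carrierD[OF x] by (simp add: Zp_def fun_eq_iff)
      have e: "(- x (Suc n)) mod int p ^ n = (- x n) mod int p ^ n" for n
        using Zp_carrierD(3)[OF x, of n] by (metis mod_minus_eq)
      show "\<exists>y\<in>carrier (Zp p). y \<oplus>\<^bsub>Zp p\<^esub> x = \<zero>\<^bsub>Zp p\<^esub>"
      proof (rule bexI[of _ "\<lambda>n. (- x n) mod int p ^ n"])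
        show "(\<lambda>n. (- x n) mod int p ^ n) \<oplus>\<^bsub>Zp p\<^esub> x = \<zero>\<^bsub>Zp p\<^esub>"
          by (simp add: Zp_def fun_eq_iff mod_simps)
        show "(\<lambda>n. (- x n) mod int p ^ n) \<in> carrier (Zp p)"
          using pos e by (simp add: Zp_def dv)
      qed
    qed
    show "comm_monoid (Zp p)"
    proof (rule comm_monoidI)
      fix x y assume xy: "x \<in> carrier (Zp p)" "y \<in> carrier (Zp p)"
      have "((x (Suc n) * y (Suc n)) mod int p ^ n) = (x n * y n) mod int p ^ n" for n
        using Zp_carrierD(3)[OF xy(1), of n] Zp_carrierD(3)[OF xy(2), of n]
        by (metis mod_mult_eq)
      then show "x \<otimes>\<^bsub>Zp p\<^esub> y \<in> carrier (Zp p)"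
        using pos by (simp add: Zp_def dv)
    next
      show "\<one>\<^bsub>Zp p\<^esub> \<in> carrier (Zp p)" using pos by (simp add: Zp_def dv)
    next
      fix x y z
      show "x \<otimes>\<^bsub>Zp p\<^esub> y \<otimes>\<^bsub>Zp p\<^esub> z = x \<otimes>\<^bsub>Zp p\<^esub> (y \<otimes>\<^bsub>Zp p\<^esub> z)"
        by (simp add: Zp_def fun_eq_iff mod_simps mult.assoc)
    next
      fix x assume x: "x \<in> carrier (Zp p)"
      show "\<one>\<^bsub>Zp p\<^esub> \<otimes>\<^bsub>Zp p\<^esub> x = x"
        using Zp_carrierD[OF x] by (simp add: Zp_def fun_eq_iff mod_simps)
    next
      fix x y
      show "x \<otimes>\<^bsub>Zp p\<^esub> y = y \<otimes>\<^bsub>Zp p\<^esub> x" by (simp add: Zp_def mult.commute)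
    qed
    fix x y z
    show "(x \<oplus>\<^bsub>Zp p\<^esub> y) \<otimes>\<^bsub>Zp p\<^esub> z = x \<otimes>\<^bsub>Zp p\<^esub> z \<oplus>\<^bsub>Zp p\<^esub> y \<otimes>\<^bsub>Zp p\<^esub> z"
      by (simp add: Zp_def fun_eq_iff mod_simps distrib_right)
  qed
qed

lemma Zp_minus_eq_0_iff:
  assumes "p > 0" "x \<in> carrier (Zp p)" "y \<in> carrier (Zp p)"
  shows "(x \<ominus>\<^bsub>Zp p\<^esub> y) n = 0 \<longleftrightarrow> x n = y n"
proof -
  interpret cring "Zp p" using cring_Zp[OF assms(1)] .
  let ?d = "x \<ominus>\<^bsub>Zp p\<^esub> y"
  have d: "?d \<in> carrier (Zp p)" using assms by simp
  have "x = ?d \<oplus>\<^bsub>Zp p\<^esub> y"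
    using assms by (simp add: a_minus_def a_assoc l_neg)
  from fun_cong[OF this, of n] have e: "x n = (?d n + y n) mod int p ^ n"
    by (simp only: Zp_add_nth)
  show ?thesis
  proof
    assume "?d n = 0"
    then show "x n = y n" using e Zp_carrierD[OF assms(3), of n] by simp
  next
    assume "x n = y n"
    then have "(?d n + y n) mod int p ^ n = (0 + y n) mod int p ^ n"
      using e Zp_carrierD[OF assms(3), of n] by simp
    then have "int p ^ n dvd ?d n" by (simp only: mod_eq_dvd_iff) simp
    then have "?d n mod int p ^ n = 0" by (rule dvd_imp_mod_0)
    then show "?d n = 0"
      using mod_pos_pos_trivial[OF Zp_carrierD(1,2)[OF d]] by (simp only:)
  qed
qed

lemma Zp_norm_le_iff:
  assumes "p > 1" "x \<in> carrier (Zp p)"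
  shows "Zp_norm p x \<le> real p powi (- int n) \<longleftrightarrow> x n = 0"
proof (cases "x = \<zero>\<^bsub>Zp p\<^esub>")
  case True
  then show ?thesis by (simp add: Zp_norm_def) (simp add: Zp_def)
next
  case False
  then obtain N where N: "x N \<noteq> 0" by (auto simp: Zp_def fun_eq_iff)
  have down: "x m = 0" if "x k = 0" "m \<le> k" for m k
    using Zp_mod_le[OF assms(2) that(2)] that(1) by simp
  have b: "\<forall>m. x m = 0 \<longrightarrow> m \<le> N" using down N by (meson nat_le_linear)
  have x0: "x 0 = 0" using Zp_carrierD[OF assms(2), of 0] by simp
  let ?v = "GREATEST n. x n = 0"
  have v: "x ?v = 0" using GreatestI_nat[of "\<lambda>n. x n = 0", OF x0] b by blast
  have "x n = 0 \<longleftrightarrow> n \<le> ?v"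
    using v down Greatest_le_nat[of "\<lambda>n. x n = 0" n N] b by blast
  moreover have "real p powi (- int ?v) \<le> real p powi (- int n) \<longleftrightarrow> n \<le> ?v"
    using assms(1) by (simp add: power_int_minus power_int_of_nat field_simps)
  ultimately show ?thesis using False by (simp add: Zp_norm_def)
qed

lemma cube_eq:
  assumes "p > 1" "x \<in> Zp_plane p"
  shows "cube p x (real p powi (- int n)) =
           {y \<in> Zp_plane p. fst y n = fst x n \<and> snd y n = snd x n}"
proof -
  interpret cring "Zp p" using cring_Zp assms by simp
  show ?thesis
    using assms unfolding cube_def Zp_plane_def
    by (auto simp: Zp_norm_le_iff Zp_minus_eq_0_iff)
qed

lemma inj_on_tube:
  assumes "p > 1" "\<delta> \<in> scales p"
  shows "inj_on (tube p) (cubes p \<delta>)"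
proof (rule inj_onI)
  interpret cring "Zp p" using cring_Zp assms by simp
  obtain n where \<delta>: "\<delta> = real p powi (- int n)" using assms by (auto simp: scales_def)
  have key: "x n = x' n \<and> y n = y' n"
    if c: "x \<in> carrier (Zp p)" "y \<in> carrier (Zp p)" "x' \<in> carrier (Zp p)" "y' \<in> carrier (Zp p)"
      and t: "tube p (cube p (x, y) \<delta>) \<subseteq> tube p (cube p (x', y') \<delta>)" for x y x' y'
  proof -
    have mem: "(x, y) \<in> cube p (x, y) \<delta>"
      using c assms by (simp add: cube_eq \<delta> Zp_plane_def)
    have sub: "\<exists>a b. a n = x' n \<and> b n = y' n \<and>
        x \<otimes>\<^bsub>Zp p\<^esub> z \<oplus>\<^bsub>Zp p\<^esub> y = a \<otimes>\<^bsub>Zp p\<^esub> z \<oplus>\<^bsub>Zp p\<^esub> b \<and> a \<in> carrier (Zp p) \<and> b \<in> carrier (Zp p)"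
      if "z \<in> carrier (Zp p)" for z
    proof -
      have "(z, x \<otimes>\<^bsub>Zp p\<^esub> z \<oplus>\<^bsub>Zp p\<^esub> y) \<in> tube p (cube p (x, y) \<delta>)"
        using mem c that by (auto simp: tube_def line_def Zp_plane_def intro!: bexI[of _ "(x, y)"])
      then have "(z, x \<otimes>\<^bsub>Zp p\<^esub> z \<oplus>\<^bsub>Zp p\<^esub> y) \<in> tube p (cube p (x', y') \<delta>)" using t by blast
      then show ?thesis
        using c assms by (auto simp: tube_def line_def cube_eq \<delta> Zp_plane_def)
    qed
    obtain b where b: "b n = y' n" "y = b"
      using sub[OF zero_closed] c by auto
    obtain a b' where a: "a n = x' n" "b' n = y' n" "x \<oplus>\<^bsub>Zp p\<^esub> y = a \<oplus>\<^bsub>Zp p\<^esub> b'"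
        "a \<in> carrier (Zp p)" "b' \<in> carrier (Zp p)"
      using sub[OF one_closed] c by auto
    have "(x n + y n) mod int p ^ n = (a n + b' n) mod int p ^ n"
      using a(3) by (simp add: Zp_def fun_eq_iff)
    then have "(x n + y n) mod int p ^ n = (x' n + y n) mod int p ^ n"
      using a b by simp
    then have "x n mod int p ^ n = x' n mod int p ^ n"
      by (simp add: mod_eq_dvd_iff)
    then show ?thesis using b Zp_carrierD[OF c(1), of n] Zp_carrierD[OF c(3), of n] by simp
  qed
  fix q q' assume q: "q \<in> cubes p \<delta>" "q' \<in> cubes p \<delta>" and e: "tube p q = tube p q'"
  obtain x y where x: "q = cube p (x, y) \<delta>" "x \<in> carrier (Zp p)" "y \<in> carrier (Zp p)"
    using q(1) by (auto simp: cubes_def Zp_plane_def)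
  obtain x' y' where x': "q' = cube p (x', y') \<delta>" "x' \<in> carrier (Zp p)" "y' \<in> carrier (Zp p)"
    using q(2) by (auto simp: cubes_def Zp_plane_def)
  have "x n = x' n \<and> y n = y' n" using key[of x y x' y'] x x' e by simp
  then show "q = q'" using x x' assms by (simp add: cube_eq \<delta> Zp_plane_def)
qed

end

theory Submission
  imports Defs "HOL-Analysis.Convex"
begin

text \<open>
  A \<open>\<delta>\<close>-cube with \<open>\<delta> = p ^ (- n)\<close> is a pair of residues \<open>(x, y)\<close> modulo \<open>p ^ n\<close>, a \<open>\<delta>\<close>-tube is a pair
  \<open>(a, b)\<close>, and the cube lies in the tube iff \<open>p ^ n\<close> divides \<open>a x + b - y\<close>.  So the theorem is about
  points and lines modulo \<open>p ^ n\<close>.  Put \<open>u = p ^ (- s)\<close>, let \<open>I_m\<close> be the number of incidences modulo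
  \<open>p ^ m\<close>, \<open>w_m\<close> the number of points of \<open>P\<close> in a residue class modulo \<open>p ^ m\<close>, and \<open>r\<close> the number of
  points on a typical tube, so that \<open>r |T|\<close> is about \<open>|P| M\<close>.  With \<open>R = sqrt (|P| / u ^ n)\<close> the claim
  reads \<open>r \<le> u ^ n R\<close>, up to a power of a loss factor \<open>B = \<delta> ^ (- \<epsilon> / 87)\<close>.  Every logarithm, every
  constant and \<open>\<delta> ^ (- \<eta>)\<close> is at most \<open>B\<close> for small \<open>\<delta>\<close>.

  There are two sources of information.  The high-low inequality (\<open>high_low\<close>) bounds
  \<open>I_m - p ^ (k - m) I_k\<close>, the part of the incidence count that oscillates inside cubes of level \<open>k\<close>, in
  \<open>L\<^sup>2\<close>.  Over the residues modulo \<open>p ^ m\<close> the incidence operator commutes with averaging over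
  cubes, so no Fourier analysis is needed: its kernel counts the solutions of one linear congruence.
  The bush argument uses the \<open>(\<delta>, s)\<close>-condition: two points at distance \<open>p ^ (- j)\<close> have at most
  about \<open>M u ^ (n - j)\<close> tubes in common.

  They are combined as follows.  Let \<open>\<mu>\<close> be the coarsest level at which the class of a point is
  overcrowded: \<open>w_\<mu>\<close> exceeds both \<open>R / p ^ \<mu>\<close> and the bound \<open>|P| / (p ^ (2 \<mu>) u ^ \<mu>)\<close> of the spacing
  condition.  At finer levels the other bound of the spacing condition is then in force, and the bush
  argument inside the cubes of level \<open>\<mu>\<close> shows that \<open>p ^ \<mu> I_\<mu>\<close> is at least about \<open>|P| M R\<close>
  (\<open>cube_bush\<close>).  Now coarsen until \<open>p ^ m I_m\<close> is about to drop by a factor \<open>2\<close>.  At that level the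
  oscillating part dominates, so \<open>high_low\<close> bounds \<open>I_m\<close> from above.  If \<open>w_m \<le> R / p ^ m\<close>, a bush
  argument along tubes (\<open>tube_bush\<close>) gives a lower bound for \<open>I_m\<close> that contradicts large \<open>r\<close>.  If
  \<open>w_m \<le> |P| / (p ^ (2 m) u ^ m)\<close>, the bound inherited from level \<open>\<mu>\<close> is multiplied with
  \<open>incidences_ge_fans\<close>, which says that each point meets at least about \<open>u ^ (- m)\<close> coarse tubes.  Both
  cases end in \<open>r \<le> u ^ n R\<close> up to a loss (\<open>richness_le\<close>).

  This needs two preparations.  Tubes must be equally distributed over coarse tubes at the boundedly
  many levels in use (\<open>uniform_subset\<close>).  And the bush along tubes needs a definite proportion of the
  pairs of points on a tube to be at distance \<open>1\<close>.  If the prevailing distance is \<open>p ^ (- j)\<close> instead, each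
  tube is cut down to one cell of level \<open>j\<close> and the cells are rescaled to unit size (\<open>localised_config\<close>); this is why
  configurations live in several disjoint copies of the plane.
\<close>

section \<open>Collisions and residue classes\<close>

lemma card_collisions_eq_sum:
  assumes "finite A"
  shows "card {(u, v) \<in> A \<times> A. g u = g v} = (\<Sum>y\<in>g ` A. (card {u \<in> A. g u = y})\<^sup>2)"
proof -
  have "{(u, v) \<in> A \<times> A. g u = g v} = (\<Union>y\<in>g ` A. {u \<in> A. g u = y} \<times> {u \<in> A. g u = y})"
    by auto
  then have "card {(u, v) \<in> A \<times> A. g u = g v}
      = (\<Sum>y\<in>g ` A. card ({u \<in> A. g u = y} \<times> {u \<in> A. g u = y}))"
    using assms by (simp only:) (rule card_UN_disjoint, auto)
  then show ?thesis by (simp add: card_cartesian_product power2_eq_square)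
qed

lemma card_eq_sum_fibres:
  assumes "finite A"
  shows "card A = (\<Sum>y\<in>g ` A. card {u \<in> A. g u = y})"
  using sum.image_gen[of A "\<lambda>_. 1::nat" g] assms by simp

text \<open>
  Cauchy-Schwarz on the fibres of \<open>g\<close>.
\<close>

lemma card_squared_le_collisions:
  assumes "finite A" "card (g ` A) \<le> N"
  shows "(card A)\<^sup>2 \<le> N * card {(u, v) \<in> A \<times> A. g u = g v}"
proof -
  have "(real (card A))\<^sup>2 = (\<Sum>y\<in>g ` A. 1 * real (card {u \<in> A. g u = y}))\<^sup>2"
    using card_eq_sum_fibres[OF assms(1), of g] by simp
  also have "\<dots> \<le> (\<Sum>y\<in>g ` A. 1\<^sup>2) * (\<Sum>y\<in>g ` A. (real (card {u \<in> A. g u = y}))\<^sup>2)"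
    by (rule Cauchy_Schwarz_ineq_sum)
  also have "\<dots> = real (card (g ` A)) * real (card {(u, v) \<in> A \<times> A. g u = g v})"
    using card_collisions_eq_sum[OF assms(1), of g] by simp
  also have "\<dots> \<le> real N * real (card {(u, v) \<in> A \<times> A. g u = g v})"
    using assms(2) by (intro mult_right_mono) auto
  finally have "real ((card A)\<^sup>2) \<le> real (N * card {(u, v) \<in> A \<times> A. g u = g v})" by simp
  then show ?thesis by (simp only: of_nat_le_iff)
qed

text \<open>
  Cauchy-Schwarz inside each fibre of \<open>f\<close>, which \<open>g\<close> cuts into at most \<open>N\<close> pieces.
\<close>

lemma collisions_le_refined_collisions:
  assumes "finite A" and "\<And>u. u \<in> A \<Longrightarrow> card (g ` {v \<in> A. f v = f u}) \<le> N"
  shows "card {(u, v) \<in> A \<times> A. f u = f v} \<le> N * card {(u, v) \<in> A \<times> A. f u = f v \<and> g u = g v}"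
proof -
  let ?F = "\<lambda>y. {u \<in> A. f u = y}"
  have "card {(u, v) \<in> A \<times> A. f u = f v} = (\<Sum>y\<in>f ` A. (card (?F y))\<^sup>2)"
    by (rule card_collisions_eq_sum[OF assms(1)])
  also have "\<dots> \<le> (\<Sum>y\<in>f ` A. N * card {(u, v) \<in> ?F y \<times> ?F y. g u = g v})"
    using assms by (intro sum_mono card_squared_le_collisions) auto
  also have "\<dots> = N * (\<Sum>y\<in>f ` A. card {(u, v) \<in> ?F y \<times> ?F y. g u = g v})"
    by (simp add: sum_distrib_left)
  also have "(\<Sum>y\<in>f ` A. card {(u, v) \<in> ?F y \<times> ?F y. g u = g v})
      = card (\<Union>y\<in>f ` A. {(u, v) \<in> ?F y \<times> ?F y. g u = g v})"
    using assms(1) by (subst card_UN_disjoint) (auto intro: finite_subset[of _ "A \<times> A"])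
  also have "(\<Union>y\<in>f ` A. {(u, v) \<in> ?F y \<times> ?F y. g u = g v})
      = {(u, v) \<in> A \<times> A. f u = f v \<and> g u = g v}" by auto
  finally show ?thesis .
qed

lemma card_matches_squared_le:
  assumes "finite A" "finite B"
  shows "(card {(u, v) \<in> A \<times> B. f u = g v})\<^sup>2
    \<le> card {(u, v) \<in> A \<times> A. f u = f v} * card {(u, v) \<in> B \<times> B. g u = g v}"
proof -
  let ?F = "\<lambda>y. {u \<in> A. f u = y}" and ?G = "\<lambda>y. {u \<in> B. g u = y}"
  let ?Y = "f ` A \<union> g ` B"
  have Y: "finite ?Y" using assms by simp
  have "{(u, v) \<in> A \<times> B. f u = g v} = (\<Union>y\<in>?Y. ?F y \<times> ?G y)" by auto
  then have "card {(u, v) \<in> A \<times> B. f u = g v} = (\<Sum>y\<in>?Y. card (?F y \<times> ?G y))"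
    using assms by (simp only:) (rule card_UN_disjoint, auto)
  then have e: "card {(u, v) \<in> A \<times> B. f u = g v} = (\<Sum>y\<in>?Y. card (?F y) * card (?G y))"
    by (simp add: card_cartesian_product)
  have F0: "?F y = {}" if "y \<notin> f ` A" for y using that by blast
  have G0: "?G y = {}" if "y \<notin> g ` B" for y using that by blast
  have a: "card {(u, v) \<in> A \<times> A. f u = f v} = (\<Sum>y\<in>?Y. (card (?F y))\<^sup>2)"
    unfolding card_collisions_eq_sum[OF assms(1)]
    by (rule sum.mono_neutral_left[OF Y]) (simp_all add: F0)
  have b: "card {(u, v) \<in> B \<times> B. g u = g v} = (\<Sum>y\<in>?Y. (card (?G y))\<^sup>2)"
    unfolding card_collisions_eq_sum[OF assms(2)]
    by (rule sum.mono_neutral_left[OF Y]) (simp_all add: G0)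
  have "(\<Sum>y\<in>?Y. real (card (?F y)) * real (card (?G y)))\<^sup>2
      \<le> (\<Sum>y\<in>?Y. (real (card (?F y)))\<^sup>2) * (\<Sum>y\<in>?Y. (real (card (?G y)))\<^sup>2)"
    by (rule Cauchy_Schwarz_ineq_sum)
  then have "real ((\<Sum>y\<in>?Y. card (?F y) * card (?G y))\<^sup>2)
      \<le> real ((\<Sum>y\<in>?Y. (card (?F y))\<^sup>2) * (\<Sum>y\<in>?Y. (card (?G y))\<^sup>2))" by simp
  then show ?thesis unfolding e a b by (simp only: of_nat_le_iff)
qed

text \<open>
  The first component of a triple names a copy of the plane.  The other two are the coordinates
  \<open>(x, y)\<close> of a point or the parameters \<open>(a, b)\<close> of the tube \<open>y = a x + b\<close>.
\<close>

definition cls :: "nat \<Rightarrow> nat \<Rightarrow> 'c \<times> int \<times> int \<Rightarrow> 'c \<times> int \<times> int" where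
  "cls p m z = (fst z, fst (snd z) mod int p ^ m, snd (snd z) mod int p ^ m)"

definition inc :: "nat \<Rightarrow> nat \<Rightarrow> 'c \<times> int \<times> int \<Rightarrow> 'c \<times> int \<times> int \<Rightarrow> bool" where
  "inc p m q T \<longleftrightarrow> fst q = fst T \<and>
     int p ^ m dvd fst (snd T) * fst (snd q) + snd (snd T) - snd (snd q)"

text \<open>
  The number of points in a cube of side \<open>p ^ (- m)\<close>.
\<close>

definition crowd :: "nat \<Rightarrow> nat \<Rightarrow> ('c \<times> int \<times> int) set \<Rightarrow> 'c \<times> int \<times> int \<Rightarrow> nat" where
  "crowd p m A u = card {v \<in> A. cls p m v = cls p m u}"

text \<open>
  The squared \<open>L\<^sup>2\<close>-norm of the counting function of \<open>A\<close> at level \<open>m\<close>.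
\<close>

definition energy :: "nat \<Rightarrow> nat \<Rightarrow> ('c \<times> int \<times> int) set \<Rightarrow> nat" where
  "energy p m A = card {(u, v) \<in> A \<times> A. cls p m u = cls p m v}"

definition incidences ::
    "nat \<Rightarrow> nat \<Rightarrow> ('c \<times> int \<times> int) set \<Rightarrow> ('c \<times> int \<times> int) set \<Rightarrow> nat" where
  "incidences p m P T = card {(q, t) \<in> P \<times> T. inc p m q t}"

lemma cls_eq_iff:
  "cls p m u = cls p m v \<longleftrightarrow> fst u = fst v \<and> int p ^ m dvd fst (snd u) - fst (snd v)
     \<and> int p ^ m dvd snd (snd u) - snd (snd v)"
  by (simp add: cls_def mod_eq_dvd_iff)

lemma cls_mono:
  assumes "cls p m u = cls p m v" "k \<le> m"
  shows "cls p k u = cls p k v"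
  using assms le_imp_power_dvd[OF assms(2), of "int p"] unfolding cls_eq_iff
  by (meson dvd_trans)

lemma inc_mono:
  assumes "inc p m q t" "k \<le> m"
  shows "inc p k q t"
  using assms le_imp_power_dvd[OF assms(2), of "int p"] unfolding inc_def
  by (meson dvd_trans)

lemma inc_cls_cong:
  assumes "cls p m q = cls p m q'" "cls p m t = cls p m t'"
  shows "inc p m q t \<longleftrightarrow> inc p m q' t'"
proof -
  obtain c x y where q: "q = (c, x, y)" by (cases q)
  obtain c' x' y' where q': "q' = (c', x', y')" by (cases q')
  obtain d a b where t: "t = (d, a, b)" by (cases t)
  obtain d' a' b' where t': "t' = (d', a', b')" by (cases t')
  have "x mod int p ^ m = x' mod int p ^ m" "y mod int p ^ m = y' mod int p ^ m"
    "a mod int p ^ m = a' mod int p ^ m" "b mod int p ^ m = b' mod int p ^ m" "c = c'" "d = d'"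
    using assms by (auto simp: cls_def q q' t t')
  then have "(a * x + b - y) mod int p ^ m = (a' * x' + b' - y') mod int p ^ m"
    by (intro mod_diff_cong mod_add_cong mod_mult_cong)
  then show ?thesis using \<open>c = c'\<close> \<open>d = d'\<close>
    by (simp add: inc_def q q' t t' dvd_eq_mod_eq_0)
qed

lemma energy_eq_sum_crowd: "finite A \<Longrightarrow> energy p m A = (\<Sum>u\<in>A. crowd p m A u)"
proof -
  assume A: "finite A"
  have "{(u, v) \<in> A \<times> A. cls p m u = cls p m v} = Sigma A (\<lambda>u. {v \<in> A. cls p m v = cls p m u})"
    by auto
  then show ?thesis using A by (simp add: energy_def crowd_def)
qed

lemma finite_bounded_int_Collect [simp]: "finite {x::int. 0 \<le> x \<and> x < N \<and> R x}"
  by (rule finite_subset[of _ "{0..<N}"]) auto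

lemma card_residues_over:
  assumes "p > 0" "k \<le> m" "0 \<le> z" "z < int p ^ k"
  shows "card {x \<in> {0..<int p ^ m}. x mod int p ^ k = z} = p ^ (m - k)"
proof -
  have pk: "int p ^ k > 0" using assms by simp
  have m: "int p ^ m = int p ^ k * int p ^ (m - k)"
    using assms(2) by (simp add: power_add[symmetric])
  have "{x \<in> {0..<int p ^ m}. x mod int p ^ k = z}
      = (\<lambda>t. z + int p ^ k * t) ` {0..<int p ^ (m - k)}" (is "?L = ?R")
  proof
    show "?L \<subseteq> ?R"
    proof
      fix x assume x: "x \<in> ?L"
      then have xz: "x mod int p ^ k = z" and xm: "0 \<le> x" "x < int p ^ m" by simp_all
      have e: "x = z + int p ^ k * (x div int p ^ k)"
        using mod_mult_div_eq[of x "int p ^ k"] unfolding xz by (rule sym)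
      have "x div int p ^ k < int p ^ (m - k)"
      proof (rule ccontr)
        assume "\<not> ?thesis"
        then have "int p ^ k * int p ^ (m - k) \<le> int p ^ k * (x div int p ^ k)"
          using pk by (intro mult_left_mono) auto
        also have "\<dots> \<le> x" using mult_div_mod_eq[of "int p ^ k" x] pos_mod_sign[OF pk, of x] by linarith
        finally show False using xm(2) unfolding m by linarith
      qed
      moreover have "0 \<le> x div int p ^ k" using xm(1) pk by (simp add: pos_imp_zdiv_nonneg_iff)
      ultimately have "x div int p ^ k \<in> {0..<int p ^ (m - k)}" by simp
      with e show "x \<in> ?R" by (rule image_eqI)
    qed
    show "?R \<subseteq> ?L"
    proof
      fix x assume "x \<in> ?R"
      then obtain t where t0: "t \<in> {0..<int p ^ (m - k)}" and tx: "x = z + int p ^ k * t" by (rule imageE)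
      from t0 have t: "0 \<le> t" "t < int p ^ (m - k)" by simp_all
      have "int p ^ k * (t + 1) \<le> int p ^ k * int p ^ (m - k)"
        using t(2) pk by (intro mult_left_mono) simp_all
      then have "int p ^ k * t + int p ^ k \<le> int p ^ m" unfolding m by (simp only: distrib_left mult_1_right)
      then have "x < int p ^ m" using tx assms(4) by linarith
      moreover have "0 \<le> x" unfolding tx using t(1) assms(3) by simp
      moreover have "x mod int p ^ k = z" unfolding tx using assms(3,4) by simp
      ultimately show "x \<in> ?L" by simp
    qed
  qed
  moreover have "inj_on (\<lambda>t. z + int p ^ k * t) {0..<int p ^ (m - k)}"
    using pk by (intro inj_onI) auto
  ultimately show ?thesis by (simp add: card_image nat_power_eq)
qed

lemma card_filter_mod:
  assumes "p > 0" "k \<le> m"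
  shows "card {x \<in> {0..<int p ^ m}. Q (x mod int p ^ k)}
    = p ^ (m - k) * card {x \<in> {0..<int p ^ k}. Q x}"
proof -
  have pk: "int p ^ k > 0" using assms by simp
  let ?Z = "{x \<in> {0..<int p ^ k}. Q x}" and ?R = "\<lambda>z. {x \<in> {0..<int p ^ m}. x mod int p ^ k = z}"
  have "{x \<in> {0..<int p ^ m}. Q (x mod int p ^ k)} = (\<Union>z\<in>?Z. ?R z)"
    using pk by auto
  then have "card {x \<in> {0..<int p ^ m}. Q (x mod int p ^ k)} = (\<Sum>z\<in>?Z. card (?R z))"
    by (simp only:) (rule card_UN_disjoint, auto)
  also have "(\<Sum>z\<in>?Z. card (?R z)) = (\<Sum>z\<in>?Z. p ^ (m - k))"
    by (rule sum.cong[OF refl], rule card_residues_over[OF assms]) simp_all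
  finally show ?thesis by (simp add: mult.commute)
qed

text \<open>
  A class of level \<open>k\<close> splits into \<open>p ^ (m - k)\<close> residues in each of its two coordinates.
\<close>

lemma card_cls_over:
  assumes "p > 0" "k \<le> m" "finite A"
  shows "card (cls p m ` {v \<in> A. cls p k v = cls p k u}) \<le> p ^ (2 * (m - k))"
proof -
  have pm: "int p ^ m > 0" and pk: "int p ^ k > 0" using assms by simp_all
  let ?R = "\<lambda>w. {x \<in> {0..<int p ^ m}. x mod int p ^ k = w mod int p ^ k}"
  have "cls p m ` {v \<in> A. cls p k v = cls p k u}
      \<subseteq> {fst u} \<times> ?R (fst (snd u)) \<times> ?R (snd (snd u))"
    using pm le_imp_power_dvd[OF assms(2), of "int p"]
    by (auto simp: cls_def mod_mod_cancel)
  then have "card (cls p m ` {v \<in> A. cls p k v = cls p k u})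
      \<le> card ({fst u} \<times> ?R (fst (snd u)) \<times> ?R (snd (snd u)))"
    by (intro card_mono) auto
  also have "\<dots> = p ^ (m - k) * p ^ (m - k)"
    using pk by (simp only: card_cartesian_product card_residues_over[OF assms(1,2)]
        pos_mod_sign pos_mod_bound) simp
  finally show ?thesis by (simp add: power_add[symmetric] mult_2)
qed

lemma energy_coarsen:
  assumes "p > 0" "k \<le> m" "finite A"
  shows "energy p k A \<le> p ^ (2 * (m - k)) * energy p m A"
proof -
  have "energy p k A \<le> p ^ (2 * (m - k)) *
      card {(u, v) \<in> A \<times> A. cls p k u = cls p k v \<and> cls p m u = cls p m v}"
    unfolding energy_def
    by (rule collisions_le_refined_collisions[OF assms(3) card_cls_over[OF assms]])
  also have "{(u, v) \<in> A \<times> A. cls p k u = cls p k v \<and> cls p m u = cls p m v}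
      = {(u, v) \<in> A \<times> A. cls p m u = cls p m v}" using cls_mono[OF _ assms(2)] by auto
  finally show ?thesis by (simp add: energy_def)
qed

section \<open>The high-low inequality\<close>

definition num_solutions :: "nat \<Rightarrow> nat \<Rightarrow> int \<Rightarrow> int \<Rightarrow> nat" where
  "num_solutions p m \<alpha> \<beta> = card {x \<in> {0..<int p ^ m}. int p ^ m dvd \<alpha> * x + \<beta>}"

lemma dvd_linear_mod_iff:
  fixes k :: nat
  shows "int p ^ k dvd \<alpha> * (x mod int p ^ k) + \<beta> \<longleftrightarrow> int p ^ k dvd \<alpha> * x + \<beta>"
proof -
  have "(\<alpha> * (x mod int p ^ k) + \<beta>) mod int p ^ k = (\<alpha> * x + \<beta>) mod int p ^ k"
    by (intro mod_add_cong mod_mult_cong) simp_all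
  then show ?thesis by (simp add: dvd_eq_mod_eq_0)
qed

lemma card_coarse_solutions:
  assumes "p > 0" "k \<le> m"
  shows "card {x \<in> {0..<int p ^ m}. int p ^ k dvd \<alpha> * x + \<beta>} = p ^ (m - k) * num_solutions p k \<alpha> \<beta>"
  using card_filter_mod[OF assms, of "\<lambda>x. int p ^ k dvd \<alpha> * x + \<beta>"]
  unfolding dvd_linear_mod_iff num_solutions_def .

lemma num_solutions_Suc_scaled:
  assumes "p > 0"
  shows "num_solutions p (Suc m) (int p * \<alpha>) (int p * \<beta>) = p * num_solutions p m \<alpha> \<beta>"
proof -
  have "int p ^ Suc m dvd int p * \<alpha> * x + int p * \<beta> \<longleftrightarrow> int p ^ m dvd \<alpha> * x + \<beta>" for x
  proof -
    have "int p * \<alpha> * x + int p * \<beta> = int p * (\<alpha> * x + \<beta>)" by (simp add: algebra_simps)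
    then show ?thesis using assms by simp
  qed
  then show ?thesis using card_coarse_solutions[OF assms, of m "Suc m" \<alpha> \<beta>]
    by (simp add: num_solutions_def)
qed

text \<open>
  The number of solutions of \<open>\<alpha> x + \<beta> = 0\<close> modulo \<open>p ^ m\<close> stays constant as \<open>m\<close> grows once \<open>p ^ m\<close>
  does not divide \<open>\<alpha>\<close>: if \<open>p\<close> is prime to \<open>\<alpha>\<close>, solutions lift uniquely, and a common factor \<open>p\<close> of \<open>\<alpha>\<close> and
  \<open>\<beta>\<close> can be cancelled.  If \<open>p\<close> divides \<open>\<alpha>\<close> alone, there are no solutions.
\<close>

lemma num_solutions_Suc_le:
  assumes "prime p"
  shows "num_solutions p (Suc m) \<alpha> \<beta>
    \<le> num_solutions p m \<alpha> \<beta> + (if int p ^ Suc m dvd \<alpha> \<and> int p ^ Suc m dvd \<beta> then p ^ Suc m else 0)"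
proof (induction m arbitrary: \<alpha> \<beta>)
  have p0: "p > 0" using assms prime_gt_0_nat by blast
  fix m :: nat and \<alpha> \<beta> :: int
  have unit: "num_solutions p (Suc m) \<alpha> \<beta> \<le> num_solutions p m \<alpha> \<beta>" if na: "\<not> int p dvd \<alpha>" for m \<alpha> \<beta>
  proof -
    let ?S = "\<lambda>m. {x \<in> {0..<int p ^ m}. int p ^ m dvd \<alpha> * x + \<beta>}"
    have "coprime (int p) \<alpha>" using assms na by (simp add: prime_imp_coprime)
    then have co: "coprime (int p ^ Suc m) \<alpha>" by simp
    have "(\<lambda>x. x mod int p ^ m) ` ?S (Suc m) \<subseteq> ?S m"
    proof
      fix z assume "z \<in> (\<lambda>x. x mod int p ^ m) ` ?S (Suc m)"
      then obtain x where x: "z = x mod int p ^ m" "int p ^ Suc m dvd \<alpha> * x + \<beta>" by auto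
      have "int p ^ m dvd \<alpha> * x + \<beta>" using x(2) by (meson dvd_trans le_imp_power_dvd le_Suc_eq order_refl)
      then show "z \<in> ?S m" using p0 by (simp add: x(1) dvd_linear_mod_iff)
    qed
    moreover have "inj_on (\<lambda>x. x mod int p ^ m) (?S (Suc m))"
    proof (rule inj_onI)
      fix x x' assume x: "x \<in> ?S (Suc m)" and x': "x' \<in> ?S (Suc m)"
      have "int p ^ Suc m dvd (\<alpha> * x + \<beta>) - (\<alpha> * x' + \<beta>)" using x x' by (intro dvd_diff) auto
      then have "int p ^ Suc m dvd \<alpha> * (x - x')" by (simp add: algebra_simps)
      then have "int p ^ Suc m dvd x - x'" using co by (simp add: coprime_dvd_mult_right_iff)
      then have "x mod int p ^ Suc m = x' mod int p ^ Suc m" by (simp add: mod_eq_dvd_iff)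
      moreover have "x mod int p ^ Suc m = x" "x' mod int p ^ Suc m = x'"
        using x x' by (auto intro!: mod_pos_pos_trivial)
      ultimately show "x = x'" by simp
    qed
    ultimately show ?thesis unfolding num_solutions_def by (intro card_inj_on_le) auto
  qed
  have zero: "num_solutions p (Suc m) \<alpha> \<beta> = 0" if "int p dvd \<alpha>" "\<not> int p dvd \<beta>" for m \<alpha> \<beta>
  proof -
    have "\<not> int p ^ Suc m dvd \<alpha> * x + \<beta>" for x
    proof
      assume "int p ^ Suc m dvd \<alpha> * x + \<beta>"
      moreover have "int p dvd int p ^ Suc m" by simp
      ultimately have "int p dvd \<alpha> * x + \<beta>" by (rule dvd_trans[rotated])
      moreover have "int p dvd \<alpha> * x" using that(1) by (rule dvd_mult2)
      ultimately show False using that(2) dvd_add_right_iff[of "int p" "\<alpha> * x" \<beta>] by blast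
    qed
    then show ?thesis by (simp add: num_solutions_def)
  qed
  have triv: "num_solutions p m \<alpha> \<beta> \<le> p ^ m" for m \<alpha> \<beta>
  proof -
    have "num_solutions p m \<alpha> \<beta> \<le> card {0..<int p ^ m}" unfolding num_solutions_def by (intro card_mono) auto
    then show ?thesis by (simp add: nat_power_eq)
  qed
  {
    case 0
    show ?case using unit[of \<alpha> 0 \<beta>] zero[of \<alpha> \<beta> 0] triv[of 1 \<alpha> \<beta>]
      by (cases "int p dvd \<alpha>"; cases "int p dvd \<beta>") auto
  next
    case (Suc m)
    show ?case
    proof (cases "int p dvd \<alpha> \<and> int p dvd \<beta>")
      case True
      then obtain \<alpha>' \<beta>' where ab: "\<alpha> = int p * \<alpha>'" "\<beta> = int p * \<beta>'" by (auto elim!: dvdE)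
      have d: "int p ^ Suc (Suc m) dvd int p * z \<longleftrightarrow> int p ^ Suc m dvd z" for z using p0 by simp
      have "p * num_solutions p (Suc m) \<alpha>' \<beta>' \<le> p * (num_solutions p m \<alpha>' \<beta>'
          + (if int p ^ Suc m dvd \<alpha>' \<and> int p ^ Suc m dvd \<beta>' then p ^ Suc m else 0))"
        using Suc.IH by (rule mult_le_mono2)
      also have "\<dots> = p * num_solutions p m \<alpha>' \<beta>'
          + (if int p ^ Suc m dvd \<alpha>' \<and> int p ^ Suc m dvd \<beta>' then p ^ Suc (Suc m) else 0)"
        by (simp add: distrib_left)
      finally show ?thesis unfolding ab num_solutions_Suc_scaled[OF p0] d .
    next
      case False
      then show ?thesis using unit[of \<alpha> "Suc m" \<beta>] zero[of \<alpha> \<beta> "Suc m"]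
        by (cases "int p dvd \<alpha>") (simp_all add: trans_le_add1)
    qed
  }
qed

lemma num_solutions_diff_le:
  assumes "prime p" "k \<le> m"
  shows "real (num_solutions p m \<alpha> \<beta>) - real (num_solutions p k \<alpha> \<beta>)
    \<le> (\<Sum>l\<in>{k<..m}. real p ^ l * of_bool (int p ^ l dvd \<alpha> \<and> int p ^ l dvd \<beta>))"
  using assms(2)
proof (induction m rule: dec_induct)
  case base
  then show ?case by simp
next
  case (step m)
  have "real (num_solutions p (Suc m) \<alpha> \<beta>) \<le> real (num_solutions p m \<alpha> \<beta>
      + (if int p ^ Suc m dvd \<alpha> \<and> int p ^ Suc m dvd \<beta> then p ^ Suc m else 0))"
    using num_solutions_Suc_le[OF assms(1)] by (simp only: of_nat_le_iff)
  also have "\<dots> = real (num_solutions p m \<alpha> \<beta>)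
      + real p ^ Suc m * of_bool (int p ^ Suc m dvd \<alpha> \<and> int p ^ Suc m dvd \<beta>)" by simp
  finally have a: "real (num_solutions p (Suc m) \<alpha> \<beta>) \<le> \<dots>" .
  have "{k<..Suc m} = insert (Suc m) {k<..m}" using step by auto
  then have "(\<Sum>l\<in>{k<..Suc m}. real p ^ l * of_bool (int p ^ l dvd \<alpha> \<and> int p ^ l dvd \<beta>))
      = real p ^ Suc m * of_bool (int p ^ Suc m dvd \<alpha> \<and> int p ^ Suc m dvd \<beta>)
        + (\<Sum>l\<in>{k<..m}. real p ^ l * of_bool (int p ^ l dvd \<alpha> \<and> int p ^ l dvd \<beta>))" by simp
  then show ?case using a step.IH by linarith
qed

lemma sum_residue_at:
  assumes "p > 0"
  shows "(\<Sum>y\<in>{0..<int p ^ m}. of_bool (int p ^ m dvd t - y) * g y) = (g (t mod int p ^ m) :: real)"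
proof -
  have pm: "int p ^ m > 0" using assms by simp
  have "int p ^ m dvd t - y \<longleftrightarrow> y = t mod int p ^ m" if "y \<in> {0..<int p ^ m}" for y
    using that mod_pos_pos_trivial[of y "int p ^ m"] by (auto simp: mod_eq_dvd_iff[symmetric])
  then have "(\<Sum>y\<in>{0..<int p ^ m}. of_bool (int p ^ m dvd t - y) * g y)
      = (\<Sum>y\<in>{0..<int p ^ m}. if y = t mod int p ^ m then g y else 0)"
    by (intro sum.cong) auto
  also have "\<dots> = g (t mod int p ^ m)" using pm by (simp add: sum.delta)
  finally show ?thesis .
qed

lemma dvd_diff_mod_iff:
  fixes a t :: int
  assumes "k \<le> m"
  shows "int p ^ k dvd a - t mod int p ^ m \<longleftrightarrow> int p ^ k dvd a - t"
  using le_imp_power_dvd[OF assms, of "int p"]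
  by (simp add: mod_eq_dvd_iff[symmetric] mod_mod_cancel)

text \<open>
  For a fixed \<open>x\<close>, a tube meets the column over \<open>x\<close> in the single residue \<open>t\<close>.  Subtracting the average
  over the residues congruent to \<open>t\<close> modulo \<open>p ^ k\<close> projects onto mean-free functions, so the scalar
  product of two such differences is again a difference of the same form.
\<close>

lemma column_kernel:
  assumes "p > 0" "k \<le> m"
  shows "(\<Sum>y\<in>{0..<int p ^ m}.
      (of_bool (int p ^ m dvd t - y) - of_bool (int p ^ k dvd t - y) / real p ^ (m - k)) *
      (of_bool (int p ^ m dvd t' - y) - of_bool (int p ^ k dvd t' - y) / real p ^ (m - k)))
    = of_bool (int p ^ m dvd t - t') - of_bool (int p ^ k dvd t - t') / real p ^ (m - k)"
    (is "?L = ?R")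
proof -
  let ?I = "{0..<int p ^ m}" and ?c = "1 / real p ^ (m - k)"
  let ?A = "\<lambda>t y. of_bool (int p ^ m dvd t - y) :: real" and ?B = "\<lambda>t y. of_bool (int p ^ k dvd t - y) :: real"
  have sym: "int p ^ j dvd t' - t \<longleftrightarrow> int p ^ j dvd t - t'" for j by (rule dvd_diff_commute)
  have AA: "(\<Sum>y\<in>?I. ?A t y * ?A t' y) = ?A t t'"
    using sum_residue_at[OF assms(1), of m t "?A t'"] sym[of m] by (simp add: dvd_diff_mod_iff)
  have AB: "(\<Sum>y\<in>?I. ?A t y * ?B t' y) = ?B t t'"
    using sum_residue_at[OF assms(1), of m t "?B t'"] sym[of k] by (simp add: dvd_diff_mod_iff[OF assms(2)])
  have BA: "(\<Sum>y\<in>?I. ?B t y * ?A t' y) = ?B t t'"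
    using sum_residue_at[OF assms(1), of m t' "?B t"]
    by (simp add: dvd_diff_mod_iff[OF assms(2)] mult.commute)
  have "(\<Sum>y\<in>?I. ?B t y * ?B t' y) = (\<Sum>y\<in>?I. of_bool (int p ^ k dvd t - y \<and> int p ^ k dvd t' - y))"
    by (intro sum.cong) auto
  also have "\<dots> = real (card {y \<in> ?I. int p ^ k dvd t - y \<and> int p ^ k dvd t' - y})"
    by (simp add: sum_of_bool_eq Int_def)
  also have "\<dots> = ?B t t' * real p ^ (m - k)"
  proof (cases "int p ^ k dvd t - t'")
    case True
    have pk: "int p ^ k > 0" using assms by simp
    have "int p ^ k dvd t - y \<and> int p ^ k dvd t' - y \<longleftrightarrow> y mod int p ^ k = t mod int p ^ k" for y
      using True unfolding mod_eq_dvd_iff[symmetric] by metis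
    then show ?thesis
      using card_residues_over[OF assms, of "t mod int p ^ k"] pk True by simp
  next
    case False
    have "\<not> (int p ^ k dvd t - y \<and> int p ^ k dvd t' - y)" for y
      using False unfolding mod_eq_dvd_iff[symmetric] by metis
    then show ?thesis using False by simp
  qed
  finally have BB: "(\<Sum>y\<in>?I. ?B t y * ?B t' y) = ?B t t' * real p ^ (m - k)" .
  have "?L = (\<Sum>y\<in>?I. ?A t y * ?A t' y - ?c * (?A t y * ?B t' y) - ?c * (?B t y * ?A t' y)
      + ?c\<^sup>2 * (?B t y * ?B t' y))"
    by (intro sum.cong refl) (simp add: algebra_simps power2_eq_square)
  also have "\<dots> = ?A t t' - ?c * ?B t t' - ?c * ?B t t' + ?c\<^sup>2 * (?B t t' * real p ^ (m - k))"
    unfolding sum.distrib sum_subtractf sum_distrib_left[symmetric] AA AB BA BB ..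
  also have "\<dots> = ?R" using assms(1) by (simp add: power2_eq_square)
  finally show ?thesis .
qed

text \<open>
  The indicator of the tube \<open>t\<close> minus its average over the cubes of level \<open>k\<close>.
\<close>

definition fluctuation :: "nat \<Rightarrow> nat \<Rightarrow> nat \<Rightarrow> 'c \<times> int \<times> int \<Rightarrow> 'c \<times> int \<times> int \<Rightarrow> real" where
  "fluctuation p k m z t = of_bool (inc p m z t) - of_bool (inc p k z t) / real p ^ (m - k)"

text \<open>
  Summing \<open>column_kernel\<close> over \<open>x\<close> leaves the solutions \<open>x\<close> of the congruence at which the two
  tubes intersect.
\<close>

lemma plane_kernel:
  assumes "p > 0" "k \<le> m"
  shows "(\<Sum>x\<in>{0..<int p ^ m}. \<Sum>y\<in>{0..<int p ^ m}.
      fluctuation p k m (c, x, y) (c, a, b) * fluctuation p k m (c, x, y) (c, a', b'))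
    = real (num_solutions p m (a - a') (b - b')) - real (num_solutions p k (a - a') (b - b'))"
proof -
  let ?I = "{0..<int p ^ m}"
  have d: "a * x + b - (a' * x + b') = (a - a') * x + (b - b')" for x by (simp add: algebra_simps)
  have s: "(\<Sum>x\<in>?I. of_bool (int p ^ j dvd (a - a') * x + (b - b')))
      = real p ^ (m - j) * real (num_solutions p j (a - a') (b - b'))" if "j \<le> m" for j
  proof -
    have "(\<Sum>x\<in>?I. of_bool (int p ^ j dvd (a - a') * x + (b - b')) :: real)
        = real (card {x \<in> ?I. int p ^ j dvd (a - a') * x + (b - b')})"
      by (simp add: sum_of_bool_eq Int_def)
    then show ?thesis by (simp only: card_coarse_solutions[OF assms(1) that]) simp
  qed
  have "(\<Sum>x\<in>?I. \<Sum>y\<in>?I. fluctuation p k m (c, x, y) (c, a, b) * fluctuation p k m (c, x, y) (c, a', b'))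
      = (\<Sum>x\<in>?I. of_bool (int p ^ m dvd (a - a') * x + (b - b'))
          - of_bool (int p ^ k dvd (a - a') * x + (b - b')) / real p ^ (m - k))"
    unfolding fluctuation_def inc_def
    by (intro sum.cong refl) (simp add: column_kernel[OF assms] d)
  also have "\<dots> = real (num_solutions p m (a - a') (b - b')) - real (num_solutions p k (a - a') (b - b'))"
    using s[of m] s[OF assms(2)] assms(1)
    by (simp add: sum_subtractf sum_divide_distrib[symmetric])
  finally show ?thesis .
qed


lemma geometric_tail_le:
  assumes "p \<ge> 2" "k \<le> m"
  shows "(\<Sum>l\<in>{k<..m}. real p ^ (2 * m - l)) \<le> real p ^ (2 * m - k)"
  using assms(2)
proof (induction k rule: inc_induct)
  case base
  then show ?case by (simp add: mult_2)
next
  case (step k)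
  have "{k<..m} = insert (Suc k) {Suc k<..m}" using step by auto
  then have "(\<Sum>l\<in>{k<..m}. real p ^ (2 * m - l))
      = real p ^ (2 * m - Suc k) + (\<Sum>l\<in>{Suc k<..m}. real p ^ (2 * m - l))" by simp
  also have "\<dots> \<le> 2 * real p ^ (2 * m - Suc k)" using step.IH by simp
  also have "\<dots> \<le> real p * real p ^ (2 * m - Suc k)"
    using assms(1) by (intro mult_right_mono) auto
  also have "\<dots> = real p ^ (2 * m - k)"
    using step by (simp add: power_Suc[symmetric] Suc_diff_Suc del: power_Suc)
  finally show ?case .
qed

lemma card_filter_eq_sum:
  assumes "finite A"
  shows "real (card {u \<in> A. Q u}) = (\<Sum>u\<in>A. of_bool (Q u))"
  using assms by (simp add: sum_of_bool_eq Int_def)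

lemma card_filter_pairs_eq_sum:
  assumes "finite A" "finite B"
  shows "real (card {(u, v) \<in> A \<times> B. Q u v}) = (\<Sum>u\<in>A. \<Sum>v\<in>B. of_bool (Q u v))"
proof -
  have "{(u, v) \<in> A \<times> B. Q u v} = {z \<in> A \<times> B. Q (fst z) (snd z)}" by auto
  then have "real (card {(u, v) \<in> A \<times> B. Q u v}) = (\<Sum>z\<in>A \<times> B. of_bool (Q (fst z) (snd z)))"
    using card_filter_eq_sum[of "A \<times> B" "\<lambda>z. Q (fst z) (snd z)"] assms by simp
  then show ?thesis by (simp add: sum.cartesian_product case_prod_unfold)
qed

lemma sum_rotate:
  "(\<Sum>z\<in>Z. \<Sum>t\<in>A. \<Sum>t'\<in>B. f z t t') = (\<Sum>t\<in>A. \<Sum>t'\<in>B. \<Sum>z\<in>Z. f z t t')"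
proof -
  have "(\<Sum>z\<in>Z. \<Sum>t\<in>A. \<Sum>t'\<in>B. f z t t') = (\<Sum>t\<in>A. \<Sum>z\<in>Z. \<Sum>t'\<in>B. f z t t')"
    by (rule sum.swap)
  also have "\<dots> = (\<Sum>t\<in>A. \<Sum>t'\<in>B. \<Sum>z\<in>Z. f z t t')"
    by (rule sum.cong[OF refl], rule sum.swap)
  finally show ?thesis .
qed

text \<open>
  After expanding the square, \<open>plane_kernel\<close> and \<open>num_solutions_diff_le\<close> leave only pairs of tubes that agree at
  some level \<open>l > k\<close>, with weight \<open>p ^ l\<close>.  By \<open>energy_coarsen\<close> these contributions are bounded by a
  geometric series, in which the coarsest level dominates.
\<close>

lemma fluctuation_energy_le:
  assumes "prime p" "k \<le> m" "finite S" "finite C"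
  shows "(\<Sum>z\<in>C \<times> {0..<int p ^ m} \<times> {0..<int p ^ m}. (\<Sum>t\<in>S. fluctuation p k m z t)\<^sup>2)
    \<le> real p ^ (2 * m - k) * real (energy p m S)"
proof -
  let ?I = "{0..<int p ^ m}"
  let ?G = "\<lambda>t t'. \<Sum>x\<in>?I. \<Sum>y\<in>?I. fluctuation p k m (fst t, x, y) t * fluctuation p k m (fst t, x, y) t'"
  let ?near = "\<lambda>l t t'. cls p l t = cls p l t'"
  have p2: "p \<ge> 2" and p0: "p > 0" using assms(1) by (simp_all add: prime_ge_2_nat prime_gt_0_nat)
  have off: "fluctuation p k m z t = 0" if "fst z \<noteq> fst t" for z t :: "'a \<times> int \<times> int"
    using that by (simp add: fluctuation_def inc_def)
  have "(\<Sum>z\<in>C \<times> ?I \<times> ?I. (\<Sum>t\<in>S. fluctuation p k m z t)\<^sup>2)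
      = (\<Sum>z\<in>C \<times> ?I \<times> ?I. \<Sum>t\<in>S. \<Sum>t'\<in>S. fluctuation p k m z t * fluctuation p k m z t')"
    by (simp add: power2_eq_square sum_product)
  also have "\<dots> = (\<Sum>t\<in>S. \<Sum>t'\<in>S. \<Sum>z\<in>C \<times> ?I \<times> ?I. fluctuation p k m z t * fluctuation p k m z t')"
    by (rule sum_rotate)
  also have "\<dots> = (\<Sum>t\<in>S. \<Sum>t'\<in>S. \<Sum>c\<in>C. \<Sum>x\<in>?I. \<Sum>y\<in>?I. fluctuation p k m (c, x, y) t * fluctuation p k m (c, x, y) t')"
    by (simp add: sum.cartesian_product')
  also have "\<dots> \<le> (\<Sum>t\<in>S. \<Sum>t'\<in>S. \<Sum>l\<in>{k<..m}. real p ^ l * of_bool (?near l t t'))"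
  proof (intro sum_mono)
    fix t t' assume "t \<in> S" "t' \<in> S"
    obtain c a b where t: "t = (c, a, b)" by (cases t)
    obtain c' a' b' where t': "t' = (c', a', b')" by (cases t')
    let ?R = "\<Sum>l\<in>{k<..m}. real p ^ l * of_bool (?near l t t')"
    have R0: "?R \<ge> 0" by (intro sum_nonneg) auto
    let ?g = "\<lambda>d. \<Sum>x\<in>?I. \<Sum>y\<in>?I. fluctuation p k m (d, x, y) t * fluctuation p k m (d, x, y) t'"
    have z: "?g d = 0" if "d \<noteq> c \<or> c \<noteq> c'" for d
    proof -
      have "fluctuation p k m (d, x, y) t * fluctuation p k m (d, x, y) t' = 0" for x y
        using that off[of "(d, x, y)" t] off[of "(d, x, y)" t'] by (auto simp: t t')
      then show ?thesis by (simp only: sum.neutral_const)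
    qed
    have g: "?g c \<le> ?R"
    proof (cases "c = c'")
      case True
      have "?g c = real (num_solutions p m (a - a') (b - b')) - real (num_solutions p k (a - a') (b - b'))"
        using plane_kernel[OF p0 assms(2), of c a b a' b'] True by (simp add: t t')
      also have "\<dots> \<le> (\<Sum>l\<in>{k<..m}. real p ^ l * of_bool (int p ^ l dvd a - a' \<and> int p ^ l dvd b - b'))"
        by (rule num_solutions_diff_le[OF assms(1,2)])
      finally show ?thesis using True by (simp add: cls_eq_iff t t')
    next
      case False
      then show ?thesis using z R0 by simp
    qed
    have "(\<Sum>d\<in>C. ?g d) = (\<Sum>d\<in>C. if d = c then ?g c else 0)"
      using z by (intro sum.cong refl) auto
    also have "\<dots> \<le> ?R" using assms(4) g R0 by (simp add: sum.delta)
    finally show "(\<Sum>d\<in>C. ?g d) \<le> ?R" .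
  qed
  also have "\<dots> = (\<Sum>l\<in>{k<..m}. real p ^ l * (\<Sum>t\<in>S. \<Sum>t'\<in>S. of_bool (?near l t t')))"
    unfolding sum_distrib_left by (rule sum_rotate[symmetric])
  also have "\<dots> = (\<Sum>l\<in>{k<..m}. real p ^ l * real (energy p l S))"
    unfolding energy_def card_filter_pairs_eq_sum[OF assms(3,3)] ..
  also have "\<dots> \<le> (\<Sum>l\<in>{k<..m}. real p ^ (2 * m - l) * real (energy p m S))"
  proof (intro sum_mono)
    fix l assume l: "l \<in> {k<..m}"
    have "real (energy p l S) \<le> real (p ^ (2 * (m - l)) * energy p m S)"
      using energy_coarsen[OF p0 _ assms(3), of l m] l by (simp only: of_nat_le_iff) simp
    then have "real p ^ l * real (energy p l S) \<le> real p ^ l * (real p ^ (2 * (m - l)) * real (energy p m S))"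
      by (intro mult_left_mono) simp_all
    also have "\<dots> = real p ^ (2 * m - l) * real (energy p m S)"
    proof -
      have "l + 2 * (m - l) = 2 * m - l" using l by auto
      then show ?thesis by (simp add: mult.assoc[symmetric] power_add[symmetric])
    qed
    finally show "real p ^ l * real (energy p l S) \<le> real p ^ (2 * m - l) * real (energy p m S)" .
  qed
  also have "\<dots> = (\<Sum>l\<in>{k<..m}. real p ^ (2 * m - l)) * real (energy p m S)"
    by (simp add: sum_distrib_right)
  also have "\<dots> \<le> real p ^ (2 * m - k) * real (energy p m S)"
    by (intro mult_right_mono geometric_tail_le[OF p2 assms(2)]) simp
  finally show ?thesis .
qed

lemma cls_idem: "k \<le> m \<Longrightarrow> cls p k (cls p m z) = cls p k z"
  using le_imp_power_dvd[of k m "int p"] by (simp add: cls_def mod_mod_cancel)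

text \<open>
  The left side is the square of the scalar product of the counting function of \<open>P\<close> at level \<open>m\<close> with the
  sum of the fluctuations of the tubes.
\<close>

theorem high_low:
  assumes "prime p" "k \<le> m" "finite P" "finite S"
  shows "(real (incidences p m P S) - real (incidences p k P S) / real p ^ (m - k))\<^sup>2
    \<le> real (energy p m P) * (real p ^ (2 * m - k) * real (energy p m S))"
proof -
  let ?h = "\<lambda>z. \<Sum>t\<in>S. fluctuation p k m z t"
  let ?Z = "cls p m ` P"
  let ?w = "\<lambda>z. real (card {q \<in> P. cls p m q = z})"
  have p0: "p > 0" using assms(1) by (rule prime_gt_0_nat)
  have hc: "?h (cls p m q) = ?h q" for q
    using inc_cls_cong[of p m "cls p m q" q] inc_cls_cong[of p k "cls p m q" q] assms(2)
    by (simp add: fluctuation_def cls_idem)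
  have "real (incidences p m P S) - real (incidences p k P S) / real p ^ (m - k) = (\<Sum>q\<in>P. ?h q)"
    unfolding incidences_def card_filter_pairs_eq_sum[OF assms(3,4)] fluctuation_def
    by (simp add: sum_subtractf sum_divide_distrib)
  also have "\<dots> = (\<Sum>q\<in>P. ?h (cls p m q))" by (simp add: hc)
  also have "\<dots> = (\<Sum>z\<in>?Z. \<Sum>q\<in>{q \<in> P. cls p m q = z}. ?h (cls p m q))"
    by (rule sum.image_gen[OF assms(3)])
  also have "\<dots> = (\<Sum>z\<in>?Z. ?w z * ?h z)"
    by (intro sum.cong refl) simp
  finally have "(real (incidences p m P S) - real (incidences p k P S) / real p ^ (m - k))\<^sup>2
      = (\<Sum>z\<in>?Z. ?w z * ?h z)\<^sup>2" by simp
  also have "\<dots> \<le> (\<Sum>z\<in>?Z. (?w z)\<^sup>2) * (\<Sum>z\<in>?Z. (?h z)\<^sup>2)"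
    by (rule Cauchy_Schwarz_ineq_sum)
  also have "(\<Sum>z\<in>?Z. (?w z)\<^sup>2) = real (energy p m P)"
    unfolding energy_def card_collisions_eq_sum[OF assms(3)] by simp
  also have "real (energy p m P) * (\<Sum>z\<in>?Z. (?h z)\<^sup>2)
      \<le> real (energy p m P) * (real p ^ (2 * m - k) * real (energy p m S))"
  proof (intro mult_left_mono)
    have "?Z \<subseteq> (fst ` P) \<times> {0..<int p ^ m} \<times> {0..<int p ^ m}"
      using p0 by (auto simp: cls_def image_iff)
    then have "(\<Sum>z\<in>?Z. (?h z)\<^sup>2)
        \<le> (\<Sum>z\<in>(fst ` P) \<times> {0..<int p ^ m} \<times> {0..<int p ^ m}. (?h z)\<^sup>2)"
      using assms(3) by (intro sum_mono2) auto
    also have "\<dots> \<le> real p ^ (2 * m - k) * real (energy p m S)"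
      using assms by (intro fluctuation_energy_le) auto
    finally show "(\<Sum>z\<in>?Z. (?h z)\<^sup>2) \<le> real p ^ (2 * m - k) * real (energy p m S)" .
  qed simp
  finally show ?thesis .
qed

section \<open>Uniform subsets and bushes\<close>

text \<open>
  In the degenerate case \<open>L = 0\<close> the set \<open>U\<close> is empty and any \<open>e\<close> will do.
\<close>

lemma weighted_pigeonhole:
  fixes f :: "'a \<Rightarrow> nat"
  assumes "finite U" and "\<And>u. u \<in> U \<Longrightarrow> \<exists>e<L. Q e u"
  shows "\<exists>e. (0 < L \<longrightarrow> e < L) \<and> sum f U \<le> L * sum f {u \<in> U. Q (e :: nat) u}"
proof (rule ccontr)
  assume "\<not> ?thesis"
  then have lt: "L * sum f {u \<in> U. Q e u} < sum f U" if "0 < L \<longrightarrow> e < L" for e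
    using that by (meson not_le)
  have pos: "0 < sum f U" using le_less_trans[OF le0 lt[of 0]] by blast
  have "sum f U \<le> (\<Sum>u\<in>U. \<Sum>e<L. if Q e u then f u else 0)"
  proof (rule sum_mono)
    fix u assume "u \<in> U"
    then obtain e where "e < L" "Q e u" using assms(2) by blast
    then show "f u \<le> (\<Sum>e<L. if Q e u then f u else 0)"
      using member_le_sum[of e "{..<L}" "\<lambda>e. if Q e u then f u else 0"] by simp
  qed
  also have "\<dots> = (\<Sum>e<L. \<Sum>u\<in>U. if Q e u then f u else 0)" by (rule sum.swap)
  also have "\<dots> = (\<Sum>e<L. sum f {u \<in> U. Q e u})"
    using assms(1) by (simp add: sum.inter_filter)
  finally have a: "sum f U \<le> (\<Sum>e<L. sum f {u \<in> U. Q e u})" .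
  then have L: "L > 0" using pos by (cases L) auto
  have "L * sum f U \<le> (\<Sum>e<L. L * sum f {u \<in> U. Q e u})"
    using mult_le_mono2[OF a, of L] by (simp add: sum_distrib_left)
  also have "\<dots> < (\<Sum>e<L. sum f U)" using lt L by (intro sum_strict_mono) auto
  finally show False by simp
qed

lemma dyadic_exponent:
  fixes N :: nat
  assumes "0 < N" "N < 2 ^ L"
  shows "\<exists>e<L. 2 ^ e \<le> N \<and> N < 2 * 2 ^ (e :: nat)"
proof -
  define l where "l = (LEAST l. N < 2 ^ l)"
  have l: "N < 2 ^ l" unfolding l_def using assms(2) by (rule LeastI)
  have "l \<le> L" unfolding l_def using assms(2) by (rule Least_le)
  have "l \<noteq> 0" using l assms(1) by (cases l) auto
  then obtain e where e: "l = Suc e" by (cases l) auto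
  then have "\<not> N < 2 ^ e" using not_less_Least[of e "\<lambda>l. N < 2 ^ l"] by (simp add: l_def)
  then show ?thesis using l e \<open>l \<le> L\<close> by (intro exI[of _ e]) auto
qed

text \<open>
  Pigeonhole on the dyadic size of the class of \<open>u\<close>, from the finest partition to the coarsest.  Each
  step keeps or discards whole classes of the current partition, so the class sizes of the finer
  partitions, already uniform, do not change.
\<close>

lemma uniform_subset:
  assumes "finite S" "card S < 2 ^ L"
    and nested: "\<And>i u v. F (Suc i) u = F (Suc i) v \<Longrightarrow> F i u = F i v"
  shows "\<exists>U\<subseteq>S. card S \<le> L ^ J * card U \<and> (\<exists>e :: nat \<Rightarrow> nat. \<forall>i<J. \<forall>u\<in>U.
      2 ^ e i \<le> card {v \<in> U. F i v = F i u} \<and> card {v \<in> U. F i v = F i u} < 2 * 2 ^ e i)"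
proof -
  have nest: "F i u = F i v" if "F j u = F j v" "i \<le> j" for i j u v
    using that(2,1) by (induction rule: dec_induct) (auto dest: nested)
  have "\<exists>U\<subseteq>S. card S \<le> L ^ j * card U \<and> (\<exists>e :: nat \<Rightarrow> nat. \<forall>i. J - j \<le> i \<and> i < J \<longrightarrow> (\<forall>u\<in>U.
      2 ^ e i \<le> card {v \<in> U. F i v = F i u} \<and> card {v \<in> U. F i v = F i u} < 2 * 2 ^ e i))"
    if "j \<le> J" for j
    using that
  proof (induction j)
    case 0
    then show ?case by (intro exI[of _ S]) auto
  next
    case (Suc j)
    then obtain U e where U: "U \<subseteq> S" "card S \<le> L ^ j * card U"
      and e: "\<forall>i. J - j \<le> i \<and> i < J \<longrightarrow> (\<forall>u\<in>U.
        2 ^ e i \<le> card {v \<in> U. F i v = F i u} \<and> card {v \<in> U. F i v = F i u} < 2 * 2 ^ (e i :: nat))"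
      by auto
    have fU: "finite U" using U(1) assms(1) finite_subset by blast
    define k where "k = J - Suc j"
    define N where "N u = card {v \<in> U. F k v = F k u}" for u
    have N: "0 < N u" "N u < 2 ^ L" if "u \<in> U" for u
    proof -
      show "0 < N u" using fU that by (auto simp: card_gt_0_iff N_def)
      have "N u \<le> card S" unfolding N_def using U(1) assms(1) by (intro card_mono) auto
      then show "N u < 2 ^ L" using assms(2) by simp
    qed
    obtain d where d: "card U \<le> L * card {u \<in> U. 2 ^ d \<le> N u \<and> N u < 2 * 2 ^ d}"
      using weighted_pigeonhole[OF fU, of L "\<lambda>d u. 2 ^ d \<le> N u \<and> N u < 2 * 2 ^ d" "\<lambda>_. 1"]
        dyadic_exponent[OF N] by auto
    let ?U = "{u \<in> U. 2 ^ d \<le> N u \<and> N u < 2 * 2 ^ d}"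
    have same: "{v \<in> ?U. F i v = F i u} = {v \<in> U. F i v = F i u}" if "u \<in> ?U" "k \<le> i" for u i
    proof -
      have "v \<in> ?U \<longleftrightarrow> v \<in> U" if h: "F i v = F i u" for v
      proof -
        have "N v = N u" using nest[OF h \<open>k \<le> i\<close>] by (simp add: N_def)
        then show ?thesis using \<open>u \<in> ?U\<close> by simp
      qed
      then show ?thesis by blast
    qed
    have "card S \<le> L ^ j * (L * card ?U)" using U(2) mult_le_mono2[OF d, of "L ^ j"] by linarith
    moreover have "\<forall>i. J - Suc j \<le> i \<and> i < J \<longrightarrow> (\<forall>u\<in>?U.
        2 ^ (e(k := d)) i \<le> card {v \<in> ?U. F i v = F i u} \<and>
        card {v \<in> ?U. F i v = F i u} < 2 * 2 ^ (e(k := d)) i)"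
    proof (intro allI impI ballI)
      fix i u assume i: "J - Suc j \<le> i \<and> i < J" and u: "u \<in> ?U"
      have ki: "k \<le> i" using i by (simp add: k_def)
      show "2 ^ (e(k := d)) i \<le> card {v \<in> ?U. F i v = F i u} \<and>
        card {v \<in> ?U. F i v = F i u} < 2 * 2 ^ (e(k := d)) i"
      proof (cases "i = k")
        case True
        then show ?thesis unfolding same[OF u ki] using u by (simp add: N_def)
      next
        case False
        then have "J - j \<le> i" using i Suc.prems unfolding k_def by linarith
        then have "2 ^ e i \<le> card {v \<in> U. F i v = F i u} \<and> card {v \<in> U. F i v = F i u} < 2 * 2 ^ e i"
          using e i u by blast
        then show ?thesis unfolding same[OF u ki] using False by simp
      qed
    qed
    moreover have "?U \<subseteq> S" using U(1) by blast
    moreover have "L ^ j * (L * card ?U) = L ^ Suc j * card ?U" by simp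
    ultimately show ?case by (intro exI[of _ ?U] conjI exI[of _ "e(k := d)"]) (simp_all only:)
  qed
  from this[of J] show ?thesis by simp
qed

lemma prime_power_dvd_cofactor:
  fixes d z :: int
  assumes "prime p" "int p ^ n dvd d * z" "\<not> int p ^ Suc j dvd z" "j \<le> n"
  shows "int p ^ (n - j) dvd d"
  using assms(2-4)
proof (induction j arbitrary: n z)
  case 0
  then have "coprime (int p) z" using assms(1) by (simp add: prime_imp_coprime)
  then have "coprime (int p ^ n) z" by simp
  then show ?case using 0 by (simp add: coprime_dvd_mult_left_iff)
next
  case (Suc j)
  obtain n' where n: "n = Suc n'" using Suc.prems(3) by (cases n) auto
  have p0: "p > 0" using assms(1) by (rule prime_gt_0_nat)
  show ?case
  proof (cases "int p dvd z")
    case True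
    then obtain w where w: "z = int p * w" by (elim dvdE)
    have e: "d * z = int p * (d * w)" by (simp add: w)
    have "int p * int p ^ n' dvd int p * (d * w)" using Suc.prems(1) by (simp only: n power_Suc e)
    then have a: "int p ^ n' dvd d * w" using p0 by simp
    have b: "\<not> int p ^ Suc j dvd w" using Suc.prems(2) p0 by (simp add: w)
    show ?thesis using Suc.IH[OF a b] Suc.prems(3) by (simp add: n)
  next
    case False
    then have "coprime (int p) z" using assms(1) by (simp add: prime_imp_coprime)
    then have "coprime (int p ^ n) z" by simp
    then have "int p ^ n dvd d" using Suc.prems(1) by (simp add: coprime_dvd_mult_left_iff)
    then show ?thesis by (meson diff_le_self dvd_trans le_imp_power_dvd)
  qed
qed

text \<open>
  Subtracting the incidence equations gives \<open>(a - a') (x - x') = 0\<close> modulo \<open>p ^ n\<close>.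
\<close>

lemma common_tubes_slopes:
  assumes "prime p" "j \<le> n" "\<not> int p ^ Suc j dvd fst (snd q) - fst (snd q')"
    and "inc p n q t" "inc p n q' t" "inc p n q t'" "inc p n q' t'"
  shows "int p ^ (n - j) dvd fst (snd t) - fst (snd t')"
proof -
  obtain x y x' y' a b a' b' where e: "snd q = (x, y)" "snd q' = (x', y')" "snd t = (a, b)" "snd t' = (a', b')"
    by (metis surj_pair)
  have d: "int p ^ n dvd a * x + b - y" "int p ^ n dvd a * x' + b - y'"
    "int p ^ n dvd a' * x + b' - y" "int p ^ n dvd a' * x' + b' - y'"
    using assms(4-7) by (simp_all add: inc_def e)
  have "int p ^ n dvd ((a * x + b - y) - (a * x' + b - y')) - ((a' * x + b' - y) - (a' * x' + b' - y'))"
    using d by (rule dvd_diff[OF dvd_diff dvd_diff])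
  also have "\<dots> = (a - a') * (x - x')" by (simp add: algebra_simps)
  finally show ?thesis
    using prime_power_dvd_cofactor[OF assms(1) _ _ assms(2)] assms(3) by (simp add: e)
qed

text \<open>
  On a tube the abscissa determines the ordinate, so distances can be read off the abscissae.
\<close>

lemma cls_eq_on_tube:
  assumes "inc p n q t" "inc p n q' t" "j \<le> n" "int p ^ j dvd fst (snd q) - fst (snd q')"
  shows "cls p j q = cls p j q'"
proof -
  obtain x y x' y' a b where e: "snd q = (x, y)" "snd q' = (x', y')" "snd t = (a, b)"
    by (metis surj_pair)
  have d: "int p ^ j dvd a * x + b - y" "int p ^ j dvd a * x' + b - y'"
    using inc_mono[OF assms(1,3)] inc_mono[OF assms(2,3)] by (simp_all add: inc_def e)
  have dx: "int p ^ j dvd x - x'" using assms(4) by (simp add: e)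
  have "int p ^ j dvd a * (x - x') - ((a * x + b - y) - (a * x' + b - y'))"
    by (rule dvd_diff[OF dvd_mult[OF dx] dvd_diff[OF d]])
  also have "\<dots> = y - y'" by (simp add: algebra_simps)
  finally show ?thesis using assms(1,2,4) by (simp add: cls_eq_iff e inc_def)
qed

lemma crowd_pos:
  assumes "finite A" "v \<in> A"
  shows "0 < crowd p m A v"
proof -
  have "v \<in> {w \<in> A. cls p m w = cls p m v}" using assms(2) by simp
  then show ?thesis unfolding crowd_def using assms(1) card_gt_0_iff by fastforce
qed

lemma distance_on_tube:
  assumes "inc p n q t" "inc p n q' t" "\<mu> \<le> n" "cls p \<mu> q' = cls p \<mu> q"
  shows "\<exists>j. \<mu> \<le> j \<and> j \<le> n \<and> cls p j q' = cls p j q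
    \<and> (j = n \<or> \<not> int p ^ Suc j dvd fst (snd q) - fst (snd q'))"
proof -
  let ?D = "\<lambda>j. j \<le> n \<and> int p ^ j dvd fst (snd q) - fst (snd q')"
  define j where "j = (GREATEST j. ?D j)"
  have D\<mu>: "?D \<mu>" using assms(3) assms(4)[symmetric] unfolding cls_eq_iff by blast
  have bound: "\<And>y. ?D y \<Longrightarrow> y \<le> n" by blast
  have j: "?D j" unfolding j_def by (rule GreatestI_nat[of ?D, OF D\<mu> bound])
  have "\<mu> \<le> j" unfolding j_def by (rule Greatest_le_nat[of ?D, OF D\<mu> bound])
  moreover have "j = n \<or> \<not> int p ^ Suc j dvd fst (snd q) - fst (snd q')"
  proof (rule ccontr)
    assume "\<not> ?thesis"
    then have "?D (Suc j)" using j by auto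
    then have "Suc j \<le> j" unfolding j_def by (rule Greatest_le_nat[of ?D, OF _ bound])
    then show False by simp
  qed
  moreover have "cls p j q = cls p j q'" using cls_eq_on_tube[OF assms(1,2)] j by blast
  ultimately show ?thesis using j by (intro exI[of _ j]) simp
qed

text \<open>
  The relation \<open>G\<close> records which tubes are associated with a point; it may be smaller than the geometric
  incidence relation.  The assumption \<open>fan\<close> is the \<open>(\<delta>, s)\<close>-condition on the tubes at \<open>q\<close>, with
  \<open>u = p ^ (- s)\<close>.  Only slopes occur in it because the slope of a tube through \<open>q\<close> determines its
  intercept.
\<close>

locale incidence_config =
  fixes p n :: nat and P S :: "('c \<times> int \<times> int) set"
    and G :: "(('c \<times> int \<times> int) \<times> ('c \<times> int \<times> int)) set" and u A :: real
  assumes prime_p: "prime p"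
    and finite_P: "finite P" and finite_S: "finite S"
    and G_sub: "G \<subseteq> P \<times> S"
    and G_inc: "(q, t) \<in> G \<Longrightarrow> inc p n q t"
    and u_pos: "0 < u" and u_le: "u \<le> 1"
    and fan: "q \<in> P \<Longrightarrow> m \<le> n \<Longrightarrow>
      real (card {t. (q, t) \<in> G \<and> int p ^ m dvd fst (snd t) - \<alpha>}) \<le> A * u ^ m"
begin

lemma p_pos: "p > 0" using prime_p by (rule prime_gt_0_nat)

lemma finite_G: "finite G" using finite_subset[OF G_sub] finite_P finite_S by simp

lemma finite_fan [simp]: "finite {t. (q, t) \<in> G \<and> Q t}"
  by (rule finite_subset[of _ S]) (use G_sub finite_S in auto)

lemma finite_row [simp]: "finite {q. (q, t) \<in> G \<and> Q q}"
  by (rule finite_subset[of _ P]) (use G_sub finite_P in auto)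

lemma finite_row' [simp]: "finite {q. (q, t) \<in> G}" "finite {t. (q, t) \<in> G}"
  using finite_row[of t "\<lambda>_. True"] finite_fan[of q "\<lambda>_. True"] by simp_all

lemma card_common_tubes:
  assumes "q \<in> P" "j \<le> n" "\<not> int p ^ Suc j dvd fst (snd q) - fst (snd q')"
  shows "real (card {t. (q, t) \<in> G \<and> (q', t) \<in> G}) \<le> A * u ^ (n - j)"
proof (cases "{t. (q, t) \<in> G \<and> (q', t) \<in> G} = {}")
  case True
  have "0 \<le> A * u ^ (n - j)" by (rule order_trans[OF of_nat_0_le_iff fan[OF assms(1) diff_le_self]])
  then show ?thesis unfolding True by simp
next
  case False
  then obtain t' where t': "(q, t') \<in> G" "(q', t') \<in> G" by blast
  have "{t. (q, t) \<in> G \<and> (q', t) \<in> G}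
      \<subseteq> {t. (q, t) \<in> G \<and> int p ^ (n - j) dvd fst (snd t) - fst (snd t')}"
    using common_tubes_slopes[OF prime_p assms(2,3)] t' G_inc by blast
  then have "card {t. (q, t) \<in> G \<and> (q', t) \<in> G}
      \<le> card {t. (q, t) \<in> G \<and> int p ^ (n - j) dvd fst (snd t) - fst (snd t')}"
    by (intro card_mono) auto
  then show ?thesis using fan[OF assms(1), of "n - j" "fst (snd t')"] by simp
qed

lemma A_nonneg:
  assumes "q \<in> P"
  shows "0 \<le> A"
  using order_trans[OF of_nat_0_le_iff fan[OF assms le0]] by simp

text \<open>
  If \<open>j = n\<close> the abscissae agree modulo \<open>p ^ n\<close>; otherwise \<open>j\<close> is the exact valuation of their difference,
  and \<open>card_common_tubes\<close> applies.
\<close>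

lemma card_bush_at:
  assumes "q \<in> P" "j \<le> n" "real (crowd p j P q) \<le> W"
  shows "real (card {(q', t). cls p j q' = cls p j q \<and> (q, t) \<in> G \<and> (q', t) \<in> G
      \<and> (j = n \<or> \<not> int p ^ Suc j dvd fst (snd q) - fst (snd q'))}) \<le> W * (A * u ^ (n - j))"
proof -
  let ?far = "\<lambda>q'. j = n \<or> \<not> int p ^ Suc j dvd fst (snd q) - fst (snd q')"
  let ?Q = "{q' \<in> P. cls p j q' = cls p j q \<and> ?far q'}"
  have A0: "0 \<le> A * u ^ (n - j)" using A_nonneg[OF assms(1)] u_pos by simp
  have "{(q', t). cls p j q' = cls p j q \<and> (q, t) \<in> G \<and> (q', t) \<in> G \<and> ?far q'}
      = Sigma ?Q (\<lambda>q'. {t. (q, t) \<in> G \<and> (q', t) \<in> G})" using G_sub by auto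
  then have "real (card {(q', t). cls p j q' = cls p j q \<and> (q, t) \<in> G \<and> (q', t) \<in> G \<and> ?far q'})
      = (\<Sum>q'\<in>?Q. real (card {t. (q, t) \<in> G \<and> (q', t) \<in> G}))"
    using finite_P by simp
  also have "\<dots> \<le> (\<Sum>q'\<in>?Q. A * u ^ (n - j))"
  proof (rule sum_mono)
    fix q' assume q': "q' \<in> ?Q"
    show "real (card {t. (q, t) \<in> G \<and> (q', t) \<in> G}) \<le> A * u ^ (n - j)"
    proof (cases "j = n")
      case True
      have "card {t. (q, t) \<in> G \<and> (q', t) \<in> G} \<le> card {t. (q, t) \<in> G \<and> int p ^ 0 dvd fst (snd t) - 0}"
        by (intro card_mono) auto
      also have "real \<dots> \<le> A * u ^ 0" by (rule fan[OF assms(1)]) simp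
      finally show ?thesis using True by simp
    next
      case False
      then show ?thesis using q' card_common_tubes[OF assms(1,2)] by simp
    qed
  qed
  also have "\<dots> = real (card ?Q) * (A * u ^ (n - j))" by simp
  also have "\<dots> \<le> W * (A * u ^ (n - j))"
  proof (rule mult_right_mono[OF _ A0])
    have "card ?Q \<le> crowd p j P q" unfolding crowd_def using finite_P by (intro card_mono) auto
    then show "real (card ?Q) \<le> W" using assms(3) by linarith
  qed
  finally show ?thesis .
qed

text \<open>
  Under the \<open>s\<close>-dimensional bound on the crowds each distance contributes at most \<open>B A\<close>, because the
  crowd at distance \<open>p ^ (- j)\<close> and the number of common tubes have reciprocal growth.
\<close>

lemma card_bush:
  assumes "q \<in> P" "\<mu> \<le> n" and fine: "\<And>m. \<mu> \<le> m \<Longrightarrow> m \<le> n \<Longrightarrow> real (crowd p m P q) \<le> B / u ^ (n - m)"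
  shows "real (card {(q', t). cls p \<mu> q' = cls p \<mu> q \<and> (q, t) \<in> G \<and> (q', t) \<in> G})
    \<le> real (n + 1) * (B * A)"
proof -
  let ?X = "\<lambda>j. {(q', t). cls p j q' = cls p j q \<and> (q, t) \<in> G \<and> (q', t) \<in> G
      \<and> (j = n \<or> \<not> int p ^ Suc j dvd fst (snd q) - fst (snd q'))}"
  have fX: "finite (?X j)" for j
    by (rule finite_subset[of _ "P \<times> S"]) (use G_sub finite_P finite_S in auto)
  have "{(q', t). cls p \<mu> q' = cls p \<mu> q \<and> (q, t) \<in> G \<and> (q', t) \<in> G} \<subseteq> (\<Union>j\<in>{\<mu>..n}. ?X j)"
  proof
    fix z assume "z \<in> {(q', t). cls p \<mu> q' = cls p \<mu> q \<and> (q, t) \<in> G \<and> (q', t) \<in> G}"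
    then obtain q' t where z: "z = (q', t)" and h: "cls p \<mu> q' = cls p \<mu> q" "(q, t) \<in> G" "(q', t) \<in> G"
      by blast
    show "z \<in> (\<Union>j\<in>{\<mu>..n}. ?X j)"
      using distance_on_tube[OF G_inc[OF h(2)] G_inc[OF h(3)] assms(2) h(1)] h unfolding z by auto
  qed
  then have "card {(q', t). cls p \<mu> q' = cls p \<mu> q \<and> (q, t) \<in> G \<and> (q', t) \<in> G}
      \<le> card (\<Union>j\<in>{\<mu>..n}. ?X j)" using fX by (intro card_mono) auto
  also have "\<dots> \<le> (\<Sum>j\<in>{\<mu>..n}. card (?X j))" by (rule card_UN_le) simp
  finally have "real (card {(q', t). cls p \<mu> q' = cls p \<mu> q \<and> (q, t) \<in> G \<and> (q', t) \<in> G})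
      \<le> (\<Sum>j\<in>{\<mu>..n}. real (card (?X j)))" by (simp only: of_nat_sum[symmetric] of_nat_le_iff)
  also have "\<dots> \<le> (\<Sum>j\<in>{\<mu>..n}. B * A)"
  proof (rule sum_mono)
    fix j assume j: "j \<in> {\<mu>..n}"
    have "real (card (?X j)) \<le> B / u ^ (n - j) * (A * u ^ (n - j))"
      using j by (intro card_bush_at assms(1) fine) auto
    then show "real (card (?X j)) \<le> B * A" using u_pos by simp
  qed
  also have "\<dots> = real (card {\<mu>..n}) * (B * A)" by simp
  also have "\<dots> \<le> real (n + 1) * (B * A)"
  proof (rule mult_right_mono)
    have "0 < crowd p n P q" using crowd_pos[OF finite_P assms(1)] .
    moreover have "real (crowd p n P q) \<le> B" using fine[OF assms(2) order_refl] by simp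
    ultimately have "0 \<le> B" by linarith
    then show "0 \<le> B * A" using A_nonneg[OF assms(1)] by simp
  qed simp
  finally show ?thesis .
qed

end

section \<open>Configurations with far apart points on tubes\<close>

lemma incidences_mono:
  assumes "k \<le> m" "finite P" "finite S"
  shows "incidences p m P S \<le> incidences p k P S"
  unfolding incidences_def
  by (rule card_mono) (use assms inc_mono[OF _ assms(1)] in \<open>auto intro: finite_subset[of _ "P \<times> S"]\<close>)

lemma incidences_0_squared_le:
  assumes "finite P" "finite S"
  shows "(incidences p 0 P S)\<^sup>2 \<le> energy p 0 P * energy p 0 S"
proof -
  have "incidences p 0 P S = card {(q, t) \<in> P \<times> S. cls p 0 q = cls p 0 t}"
    by (simp add: incidences_def inc_def cls_eq_iff)
  then show ?thesis unfolding energy_def using card_matches_squared_le[OF assms, of "cls p 0" "cls p 0"] by simp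
qed

text \<open>
  Walk down from \<open>D\<close> as long as a step loses at most a factor \<open>2\<close>.
\<close>

lemma level_of_drop:
  fixes f :: "nat \<Rightarrow> real"
  shows "\<exists>i\<le>D. f D \<le> 2 ^ (D - i) * f i \<and> (i = 0 \<or> f (i - 1) < f i / 2)"
proof (induction D)
  case 0
  then show ?case by simp
next
  case (Suc D)
  show ?case
  proof (cases "f D < f (Suc D) / 2")
    case True
    then show ?thesis by (intro exI[of _ "Suc D"]) simp
  next
    case False
    obtain i where i: "i \<le> D" "f D \<le> 2 ^ (D - i) * f i" "i = 0 \<or> f (i - 1) < f i / 2"
      using Suc.IH by blast
    have "f (Suc D) \<le> 2 * (2 ^ (D - i) * f i)" using False i(2) by simp
    also have "\<dots> = 2 ^ (Suc D - i) * f i" using i(1) by (simp add: Suc_diff_le)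
    finally show ?thesis using i by (intro exI[of _ i]) auto
  qed
qed

text \<open>
  \<open>S\<close> contains tubes of comparable richness \<open>r\<close>, and \<open>far\<close> says that a definite part of the pairs of points
  on a tube are at distance \<open>1\<close>.  Levels up to \<open>\<mu>\<close> obey one of the two bounds in \<open>coarse\<close>, level \<open>\<mu>\<close> is
  crowded, and finer levels are \<open>s\<close>-dimensional.  The levels used in the proof are the multiples of \<open>k\<close>
  up to \<open>\<mu>\<close>; there are so few of them that \<open>dyadic_le\<close> and \<open>halving_le\<close> can hold.
\<close>

locale spread_config = incidence_config p n P S G u "B * M"
  for p n :: nat and P S :: "('c \<times> int \<times> int) set"
    and G :: "(('c \<times> int \<times> int) \<times> ('c \<times> int \<times> int)) set" and u B M :: real +
  fixes \<mu> k L :: nat and R r :: real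
  assumes mu_le: "\<mu> \<le> n"
    and B_ge: "8 \<le> B" and step_le: "real p ^ k \<le> B" and step_pos: "0 < k" and depth_le: "real (n + 1) \<le> B"
    and dyadic_le: "real L ^ (\<mu> div k + 1) \<le> B" and halving_le: "2 ^ (\<mu> div k) \<le> B"
    and card_S: "card S < 2 ^ L"
    and pos: "0 < M" "0 < R" "0 < r" "P \<noteq> {}"
    and coarse: "q \<in> P \<Longrightarrow> m \<le> \<mu> \<Longrightarrow>
      real (crowd p m P q) \<le> B * max (R / real p ^ m) (u ^ n * R\<^sup>2 / (real p ^ (2 * m) * u ^ m))"
    and at_mu: "q \<in> P \<Longrightarrow> R / real p ^ \<mu> \<le> B * real (crowd p \<mu> P q)"
    and fine: "q \<in> P \<Longrightarrow> \<mu> \<le> m \<Longrightarrow> m \<le> n \<Longrightarrow> real (crowd p m P q) \<le> B / u ^ (n - m)"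
    and rich: "t \<in> S \<Longrightarrow> r \<le> real (card {q. (q, t) \<in> G})"
      "t \<in> S \<Longrightarrow> real (card {q. (q, t) \<in> G}) \<le> B * r"
    and far: "t \<in> S \<Longrightarrow> r\<^sup>2 / B \<le> real (card {(q, q'). (q, t) \<in> G \<and> (q', t) \<in> G
      \<and> \<not> int p dvd fst (snd q) - fst (snd q')})"
    and many: "real (card P) * M \<le> B * real (card G)"
begin

lemma card_G_eq:
  assumes "U \<subseteq> S"
  shows "card {(q, t) \<in> G. t \<in> U} = (\<Sum>t\<in>U. card {q. (q, t) \<in> G})"
proof -
  have "{(q, t) \<in> G. t \<in> U} = prod.swap ` Sigma U (\<lambda>t. {q. (q, t) \<in> G})" by force
  moreover have "inj_on prod.swap (Sigma U (\<lambda>t. {q. (q, t) \<in> G}))" by (rule inj_onI) auto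
  moreover have "finite U" using assms finite_S finite_subset by blast
  ultimately show ?thesis by (simp add: card_image)
qed

lemma card_G_le: "real (card G) \<le> real (card P) * (B * M)"
proof -
  have "G = Sigma P (\<lambda>q. {t. (q, t) \<in> G})" using G_sub by auto
  then have "card G = (\<Sum>q\<in>P. card {t. (q, t) \<in> G})"
    using finite_P card_SigmaI[of P "\<lambda>q. {t. (q, t) \<in> G}"] by simp
  then have "real (card G) = (\<Sum>q\<in>P. real (card {t. (q, t) \<in> G}))" by simp
  also have "\<dots> \<le> (\<Sum>q\<in>P. B * M)"
  proof (rule sum_mono)
    fix q assume "q \<in> P"
    from fan[OF this, of 0 0] show "real (card {t. (q, t) \<in> G}) \<le> B * M" by simp
  qed
  finally show ?thesis by simp
qed

text \<open>
  A pair of points at distance \<open>1\<close> has at most \<open>B M u ^ n\<close> common tubes, and every tube of \<open>S\<close> near \<open>t\<^sub>0\<close>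
  carries many such pairs.  So many tubes near \<open>t\<^sub>0\<close> force many points near \<open>t\<^sub>0\<close>.
\<close>

lemma tube_bush:
  assumes "U \<subseteq> S" "m \<le> n"
  shows "real (card {t \<in> U. cls p m t = cls p m t\<^sub>0}) * (r\<^sup>2 / B)
    \<le> (real (card {q \<in> P. inc p m q t\<^sub>0}))\<^sup>2 * (B * M * u ^ n)"
    (is "real (card ?T) * _ \<le> (real (card ?Q))\<^sup>2 * _")
proof -
  have fT: "finite ?T" using finite_subset[OF assms(1) finite_S] by simp
  have fQ: "finite ?Q" using finite_P by simp
  let ?F = "\<lambda>t. {(q, q'). (q, t) \<in> G \<and> (q', t) \<in> G \<and> \<not> int p dvd fst (snd q) - fst (snd q')}"
  let ?far = "\<lambda>z. \<not> int p dvd fst (snd (fst z)) - fst (snd (snd z))"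
  let ?X = "{z \<in> ?Q \<times> ?Q. ?far z}"
  have fF: "finite (?F t)" for t
    by (rule finite_subset[of _ "P \<times> P"]) (use G_sub finite_P in auto)
  have "real (card ?T) * (r\<^sup>2 / B) = (\<Sum>t\<in>?T. r\<^sup>2 / B)" by simp
  also have "\<dots> \<le> (\<Sum>t\<in>?T. real (card (?F t)))"
    using assms(1) by (intro sum_mono far) auto
  also have "\<dots> = real (card (Sigma ?T ?F))" using fT fF by simp
  also have "\<dots> \<le> real (card (Sigma ?X (\<lambda>z. {t. (fst z, t) \<in> G \<and> (snd z, t) \<in> G})))"
  proof -
    have "prod.swap ` Sigma ?T ?F \<subseteq> Sigma ?X (\<lambda>z. {t. (fst z, t) \<in> G \<and> (snd z, t) \<in> G})"
    proof
      fix w assume "w \<in> prod.swap ` Sigma ?T ?F"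
      then obtain t q q' where w: "w = ((q, q'), t)" "t \<in> ?T" "(q, q') \<in> ?F t" by auto
      have "inc p m q t\<^sub>0" "inc p m q' t\<^sub>0"
        using inc_mono[OF G_inc assms(2)] inc_cls_cong[of p m q q t t\<^sub>0] inc_cls_cong[of p m q' q' t t\<^sub>0] w by auto
      then show "w \<in> Sigma ?X (\<lambda>z. {t. (fst z, t) \<in> G \<and> (snd z, t) \<in> G})"
        using w G_sub by auto
    qed
    moreover have "finite (Sigma ?X (\<lambda>z. {t. (fst z, t) \<in> G \<and> (snd z, t) \<in> G}))"
      using fQ by (intro finite_SigmaI) auto
    ultimately have "card (prod.swap ` Sigma ?T ?F) \<le> card (Sigma ?X (\<lambda>z. {t. (fst z, t) \<in> G \<and> (snd z, t) \<in> G}))"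
      by (rule card_mono[rotated])
    then show ?thesis by (simp only: card_image[OF inj_swap] of_nat_le_iff)
  qed
  also have "\<dots> = (\<Sum>z\<in>?X. real (card {t. (fst z, t) \<in> G \<and> (snd z, t) \<in> G}))"
    using fQ by simp
  also have "\<dots> \<le> (\<Sum>z\<in>?X. B * M * u ^ n)"
  proof (rule sum_mono)
    fix z assume "z \<in> ?X"
    then show "real (card {t. (fst z, t) \<in> G \<and> (snd z, t) \<in> G}) \<le> B * M * u ^ n"
      using card_common_tubes[of "fst z" 0 "snd z"] by auto
  qed
  also have "\<dots> = real (card ?X) * (B * M * u ^ n)" by simp
  also have "\<dots> \<le> (real (card ?Q))\<^sup>2 * (B * M * u ^ n)"
  proof (rule mult_right_mono)
    have "card ?X \<le> card (?Q \<times> ?Q)" using fQ by (intro card_mono) auto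
    then have "real (card ?X) \<le> real (card ?Q * card ?Q)"
      by (simp only: card_cartesian_product of_nat_le_iff)
    then show "real (card ?X) \<le> (real (card ?Q))\<^sup>2" by (simp only: power2_eq_square of_nat_mult)
    show "0 \<le> B * M * u ^ n" using B_ge pos u_pos by simp
  qed
  finally show ?thesis .
qed

text \<open>
  Count pairs (cube of level \<open>\<mu>\<close>, tube): by Cauchy-Schwarz and \<open>card_bush\<close> the tubes through the points
  of one cube overlap little.  By \<open>at_mu\<close> each such pair accounts for at least \<open>R / (B p ^ \<mu>)\<close>
  incidences modulo \<open>p ^ \<mu>\<close>.
\<close>

lemma cube_bush:
  assumes "U \<subseteq> S"
  shows "(real (card {(q, t) \<in> G. t \<in> U}))\<^sup>2 * R
    \<le> real (incidences p \<mu> P U) * real p ^ \<mu> * B * (real (card P) * (B ^ 3 * M))"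
proof -
  let ?G = "{(q, t) \<in> G. t \<in> U}"
  \<comment> \<open>The points of \<open>?X\<close> are the pairs (cube of level \<open>\<mu>\<close>, tube of one of its points).\<close>
  let ?g = "\<lambda>z. (cls p \<mu> (fst z), snd z)"
  let ?X = "?g ` ?G"
  have fG: "finite ?G" using finite_G by (rule finite_subset[rotated]) auto
  have fU: "finite U" using assms finite_S finite_subset by blast
  have "(card ?G)\<^sup>2 \<le> card ?X * card {(v, w) \<in> ?G \<times> ?G. ?g v = ?g w}"
    by (rule card_squared_le_collisions[OF fG]) simp
  then have a: "(real (card ?G))\<^sup>2 \<le> real (card ?X) * real (card {(v, w) \<in> ?G \<times> ?G. ?g v = ?g w})"
    by (simp only: of_nat_power[symmetric] of_nat_mult[symmetric] of_nat_le_iff)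
  let ?N = "\<lambda>q. {(q', t). cls p \<mu> q' = cls p \<mu> q \<and> (q, t) \<in> G \<and> (q', t) \<in> G}"
  have fN: "finite (?N q)" for q
    by (rule finite_subset[of _ "P \<times> S"]) (use G_sub finite_P finite_S in auto)
  have b: "real (card {(v, w) \<in> ?G \<times> ?G. ?g v = ?g w}) \<le> real (card P) * (B ^ 3 * M)"
  proof -
    have "(\<lambda>(v, w). (fst v, fst w, snd w)) ` {(v, w) \<in> ?G \<times> ?G. ?g v = ?g w} \<subseteq> Sigma P ?N"
      using G_sub by auto
    then have "card ((\<lambda>(v, w). (fst v, fst w, snd w)) ` {(v, w) \<in> ?G \<times> ?G. ?g v = ?g w}) \<le> card (Sigma P ?N)"
      using finite_P fN by (intro card_mono) auto
    moreover have "inj_on (\<lambda>(v, w). (fst v, fst w, snd w)) {(v, w) \<in> ?G \<times> ?G. ?g v = ?g w}"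
      by (rule inj_onI) auto
    ultimately have "card {(v, w) \<in> ?G \<times> ?G. ?g v = ?g w} \<le> card (Sigma P ?N)"
      by (simp add: card_image)
    also have "\<dots> = (\<Sum>q\<in>P. card (?N q))" using finite_P fN by simp
    finally have "real (card {(v, w) \<in> ?G \<times> ?G. ?g v = ?g w}) \<le> (\<Sum>q\<in>P. real (card (?N q)))"
      by (simp only: of_nat_sum[symmetric] of_nat_le_iff)
    also have "\<dots> \<le> (\<Sum>q\<in>P. B ^ 3 * M)"
    proof (rule sum_mono)
      fix q assume q: "q \<in> P"
      have "real (card (?N q)) \<le> real (n + 1) * (B * (B * M))"
        by (rule card_bush[OF q mu_le fine[OF q]])
      also have "\<dots> \<le> B * (B * (B * M))"
        using depth_le B_ge pos by (intro mult_right_mono) auto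
      finally show "real (card (?N q)) \<le> B ^ 3 * M" by (simp add: power3_eq_cube mult.assoc)
    qed
    finally show ?thesis by simp
  qed
  have c: "real (card ?X) * R \<le> real (incidences p \<mu> P U) * real p ^ \<mu> * B"
  proof -
    let ?Q = "\<lambda>z. {q \<in> P. cls p \<mu> q = fst z}"
    have fX: "finite ?X" using fG by simp
    have fQ: "finite (?Q z)" for z using finite_P by simp
    have sub: "(\<lambda>w. (snd w, snd (fst w))) ` Sigma ?X ?Q \<subseteq> {(q, t) \<in> P \<times> U. inc p \<mu> q t}"
    proof
      fix w assume "w \<in> (\<lambda>w. (snd w, snd (fst w))) ` Sigma ?X ?Q"
      then obtain q q' t where w: "w = (q', t)" "q' \<in> P" "(q, t) \<in> G" "t \<in> U" "cls p \<mu> q' = cls p \<mu> q"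
        by auto
      have "inc p \<mu> q' t"
        using inc_mono[OF G_inc[OF w(3)] mu_le] inc_cls_cong[OF w(5) refl[of "cls p \<mu> t"]] by simp
      then show "w \<in> {(q, t) \<in> P \<times> U. inc p \<mu> q t}" using w by simp
    qed
    have inj: "inj_on (\<lambda>w. (snd w, snd (fst w))) (Sigma ?X ?Q)"
    proof (rule inj_onI)
      fix v w assume vw: "v \<in> Sigma ?X ?Q" "w \<in> Sigma ?X ?Q"
      assume "(snd v, snd (fst v)) = (snd w, snd (fst w))"
      then have e: "snd v = snd w" "snd (fst v) = snd (fst w)" by (simp_all only: prod.inject)
      have "fst (fst v) = cls p \<mu> (snd v)" "fst (fst w) = cls p \<mu> (snd w)" using vw by auto
      then have "fst (fst v) = fst (fst w)" by (simp only: e)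
      from prod_eqI[OF prod_eqI[OF this e(2)] e(1)] show "v = w" .
    qed
    have "card (Sigma ?X ?Q) \<le> incidences p \<mu> P U"
      unfolding incidences_def card_image[OF inj, symmetric]
      by (rule card_mono[OF _ sub]) (rule finite_subset[of _ "P \<times> U"], use finite_P fU in auto)
    moreover have "card (Sigma ?X ?Q) = (\<Sum>z\<in>?X. card (?Q z))"
      by (rule card_SigmaI[OF fX]) (rule ballI, rule fQ)
    ultimately have "(\<Sum>z\<in>?X. real (card (?Q z))) \<le> real (incidences p \<mu> P U)"
      by (simp only: of_nat_sum[symmetric] of_nat_le_iff)
    moreover have "(\<Sum>z\<in>?X. R / real p ^ \<mu> / B) \<le> (\<Sum>z\<in>?X. real (card (?Q z)))"
    proof (rule sum_mono)
      fix z assume "z \<in> ?X"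
      then obtain q t where z: "(q, t) \<in> G" "z = (cls p \<mu> q, t)" by auto
      have "q \<in> P" using z(1) G_sub by auto
      from at_mu[OF this] have "R / real p ^ \<mu> \<le> real (card (?Q z)) * B"
        by (simp add: z(2) crowd_def mult.commute)
      moreover have "0 < B" using B_ge by simp
      ultimately show "R / real p ^ \<mu> / B \<le> real (card (?Q z))" by (simp only: pos_divide_le_eq)
    qed
    ultimately have "real (card ?X) * (R / real p ^ \<mu> / B) \<le> real (incidences p \<mu> P U)" by simp
    moreover have "0 < real p ^ \<mu>" using p_pos by simp
    ultimately show ?thesis using B_ge by (simp add: field_simps)
  qed
  have "(real (card ?G))\<^sup>2 * R \<le> real (card ?X) * (real (card P) * (B ^ 3 * M)) * R"
    using a b pos(2) by (intro mult_right_mono order_trans[OF a] mult_left_mono) auto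
  also have "\<dots> = real (card ?X) * R * (real (card P) * (B ^ 3 * M))" by simp
  also have "\<dots> \<le> real (incidences p \<mu> P U) * real p ^ \<mu> * B * (real (card P) * (B ^ 3 * M))"
    using c B_ge pos by (intro mult_right_mono) auto
  finally show ?thesis .
qed

text \<open>
  The tubes at a point are spread over at least \<open>1 / (B M u ^ m)\<close> times as many coarse tubes, each of which
  contains \<open>V\<close> tubes of \<open>U\<close>.
\<close>

lemma incidences_ge_fans:
  assumes "U \<subseteq> S" "m \<le> n" and V: "\<And>t. t \<in> U \<Longrightarrow> V \<le> card {t' \<in> U. cls p m t' = cls p m t}"
  shows "real V * real (card {(q, t) \<in> G. t \<in> U}) \<le> real (incidences p m P U) * (B * M * u ^ m)"
proof -
  have fU: "finite U" using assms finite_S finite_subset by blast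
  let ?H = "\<lambda>q. {t \<in> U. (q, t) \<in> G}" and ?N = "\<lambda>q. {t \<in> U. inc p m q t}"
  have row: "real V * real (card (?H q)) \<le> real (card (?N q)) * (B * M * u ^ m)" if q: "q \<in> P" for q
  proof -
    let ?Y = "cls p m ` ?H q"
    have fH: "finite (?H q)" "finite ?Y" using fU by simp_all
    have "card (?H q) = (\<Sum>y\<in>?Y. card {t \<in> ?H q. cls p m t = y})"
      by (rule card_eq_sum_fibres[OF fH(1)])
    then have "real (card (?H q)) = (\<Sum>y\<in>?Y. real (card {t \<in> ?H q. cls p m t = y}))" by simp
    also have "\<dots> \<le> (\<Sum>y\<in>?Y. B * M * u ^ m)"
    proof (rule sum_mono)
      fix y assume "y \<in> ?Y"
      then obtain t\<^sub>1 where t\<^sub>1: "y = cls p m t\<^sub>1" by blast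
      have "card {t \<in> ?H q. cls p m t = y}
          \<le> card {t. (q, t) \<in> G \<and> int p ^ m dvd fst (snd t) - fst (snd t\<^sub>1)}"
        by (intro card_mono) (auto simp: t\<^sub>1 cls_eq_iff)
      also have "real \<dots> \<le> B * M * u ^ m" by (rule fan[OF q assms(2)])
      finally show "real (card {t \<in> ?H q. cls p m t = y}) \<le> B * M * u ^ m" by simp
    qed
    finally have a: "real (card (?H q)) \<le> real (card ?Y) * (B * M * u ^ m)" by simp
    have "(\<Sum>y\<in>?Y. V) \<le> (\<Sum>y\<in>?Y. card {t \<in> U. cls p m t = y})"
      by (intro sum_mono) (use V in auto)
    also have "\<dots> = card (\<Union>y\<in>?Y. {t \<in> U. cls p m t = y})"
      using fH(2) fU by (intro card_UN_disjoint[symmetric]) auto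
    also have "\<dots> \<le> card (?N q)"
    proof (rule card_mono)
      show "finite (?N q)" using fU by simp
      show "(\<Union>y\<in>?Y. {t \<in> U. cls p m t = y}) \<subseteq> ?N q"
        using inc_mono[OF G_inc assms(2)] inc_cls_cong[OF refl[of "cls p m q"]] by blast
    qed
    finally have b: "card ?Y * V \<le> card (?N q)" by simp
    have "real V * real (card (?H q)) \<le> real V * (real (card ?Y) * (B * M * u ^ m))"
      using a by (rule mult_left_mono) simp
    also have "\<dots> = real (card ?Y * V) * (B * M * u ^ m)" by simp
    also have "\<dots> \<le> real (card (?N q)) * (B * M * u ^ m)"
      using b B_ge pos u_pos by (intro mult_right_mono) (simp_all only: of_nat_le_iff, simp)
    finally show ?thesis .
  qed
  have "{(q, t) \<in> G. t \<in> U} = Sigma P ?H" using G_sub by auto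
  then have "real V * real (card {(q, t) \<in> G. t \<in> U}) = (\<Sum>q\<in>P. real V * real (card (?H q)))"
    using finite_P fU by (simp add: sum_distrib_left)
  also have "\<dots> \<le> (\<Sum>q\<in>P. real (card (?N q)) * (B * M * u ^ m))"
    by (rule sum_mono[OF row])
  also have "\<dots> = real (\<Sum>q\<in>P. card (?N q)) * (B * M * u ^ m)" by (simp add: sum_distrib_right)
  also have "(\<Sum>q\<in>P. card (?N q)) = card (Sigma P ?N)" using finite_P fU by simp
  also have "Sigma P ?N = {(q, t) \<in> P \<times> U. inc p m q t}" by auto
  finally show ?thesis by (simp add: incidences_def)
qed


text \<open>
  If the normalised count \<open>p ^ m I_m\<close> at least halves at the next coarser level, at least half of \<open>I_m\<close> is
  oscillating and \<open>high_low\<close> bounds it.  At level \<open>0\<close> nothing oscillates, but Cauchy-Schwarz gives the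
  same bound.
\<close>

lemma incidences_at_top_level:
  assumes "finite U" "k * i \<le> n"
    and "i = 0 \<or> real p ^ (k * (i - 1)) * real (incidences p (k * (i - 1)) P U)
      < real p ^ (k * i) * real (incidences p (k * i) P U) / 2"
  shows "(real (incidences p (k * i) P U))\<^sup>2
    \<le> 4 * real p ^ (k * i + k) * real (energy p (k * i) P) * real (energy p (k * i) U)"
proof (cases i)
  case 0
  have "real ((incidences p 0 P U)\<^sup>2) \<le> real (energy p 0 P * energy p 0 U)"
    using incidences_0_squared_le[OF finite_P assms(1)] by (simp only: of_nat_le_iff)
  also have "\<dots> = 1 * (real (energy p 0 P) * real (energy p 0 U))" by simp
  also have "\<dots> \<le> 4 * real p ^ k * (real (energy p 0 P) * real (energy p 0 U))"
  proof (rule mult_right_mono)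
    have "1 \<le> real p ^ k" by (rule one_le_power) (use p_pos in simp)
    then show "1 \<le> 4 * real p ^ k" by linarith
  qed simp
  finally show ?thesis using 0 by (simp add: mult.assoc)
next
  case (Suc j)
  let ?I = "real (incidences p (k * i) P U)" and ?I' = "real (incidences p (k * j) P U)"
  have e: "k * i - k * j = k" "2 * (k * i) - k * j = k * i + k" "k * i = k * j + k" using Suc by simp_all
  have "real p ^ (k * j) * ?I' < real p ^ (k * j) * (real p ^ k * ?I / 2)"
    using assms(3) Suc by (simp add: power_add mult.assoc mult.left_commute)
  then have "?I' < real p ^ k * ?I / 2" using p_pos by (simp add: mult_less_cancel_left_pos)
  then have "?I' / real p ^ k \<le> ?I / 2" using p_pos by (simp add: field_simps)
  then have "(?I / 2)\<^sup>2 \<le> (?I - ?I' / real p ^ k)\<^sup>2"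
    by (intro power_mono) auto
  also have "\<dots> \<le> real (energy p (k * i) P) * (real p ^ (k * i + k) * real (energy p (k * i) U))"
    using high_low[OF prime_p _ finite_P assms(1), of "k * j" "k * i"] unfolding e(1,2)
    using e(3) by simp
  finally show ?thesis by (simp add: power_divide mult_ac)
qed

text \<open>
  The two cases are the two bounds on the crowds at the level \<open>m\<close> at which the normalised incidence count
  drops.  In the first the lower bound for \<open>I_m\<close> comes from \<open>tube_bush\<close>.  In the second it is the
  geometric mean of \<open>incidences_ge_fans\<close> and of \<open>cube_bush\<close> transported from level \<open>\<mu>\<close>.  The number \<open>V\<close> of
  tubes in a coarse tube cancels each time.
\<close>

theorem richness_le: "r \<le> B ^ 20 * u ^ n * R"
proof -
  define J where "J = \<mu> div k + 1"
  \<comment> \<open>Pass to tubes that are uniformly distributed at the levels \<open>0, k, 2 k, \<dots>\<close> up to \<open>\<mu>\<close>.\<close>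
  have nested: "cls p (k * i) v = cls p (k * i) w" if "cls p (k * Suc i) v = cls p (k * Suc i) w"
    for i and v w :: "'c \<times> int \<times> int"
    using cls_mono[OF that, of "k * i"] by simp
  have "\<exists>U\<subseteq>S. card S \<le> L ^ J * card U \<and> (\<exists>e :: nat \<Rightarrow> nat. \<forall>i<J. \<forall>t\<in>U.
      2 ^ e i \<le> card {t' \<in> U. cls p (k * i) t' = cls p (k * i) t} \<and>
      card {t' \<in> U. cls p (k * i) t' = cls p (k * i) t} < 2 * 2 ^ e i)"
    by (rule uniform_subset[OF finite_S card_S nested])
  then obtain U and e :: "nat \<Rightarrow> nat" where U: "U \<subseteq> S" "card S \<le> L ^ J * card U"
    and ue: "\<forall>i<J. \<forall>t\<in>U. 2 ^ e i \<le> card {t' \<in> U. cls p (k * i) t' = cls p (k * i) t} \<and>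
      card {t' \<in> U. cls p (k * i) t' = cls p (k * i) t} < 2 * 2 ^ e i"
    by (elim exE conjE) (rule that)
  have e: "2 ^ e i \<le> card {t' \<in> U. cls p (k * i) t' = cls p (k * i) t}"
    "card {t' \<in> U. cls p (k * i) t' = cls p (k * i) t} < 2 * 2 ^ e i" if "i < J" "t \<in> U" for i t
    using ue that by simp_all
  have fU: "finite U" using finite_subset[OF U(1) finite_S] .
  have B0: "0 < B" and B1: "1 \<le> B" using B_ge by simp_all
  have P0: "0 < real (card P)" using pos(4) finite_P by (simp add: card_gt_0_iff)
  define g where "g = real (card {(q, t) \<in> G. t \<in> U})"
  define c where "c = real (card U)"
  have g_eq: "g = (\<Sum>t\<in>U. real (card {q. (q, t) \<in> G}))"
    unfolding g_def card_G_eq[OF U(1)] by simp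
  have rg: "r * c \<le> g"
  proof -
    have "(\<Sum>t\<in>U. r) \<le> g" unfolding g_eq by (rule sum_mono) (use rich(1) U(1) in auto)
    then show ?thesis by (simp add: c_def mult.commute)
  qed
  have gP: "g \<le> real (card P) * (B * M)"
  proof -
    have "card {(q, t) \<in> G. t \<in> U} \<le> card G" using finite_G by (intro card_mono) auto
    then show ?thesis unfolding g_def using card_G_le by linarith
  qed
  have PM: "real (card P) * M \<le> B ^ 3 * r * c"
  proof -
    have "real (card G) = (\<Sum>t\<in>S. real (card {q. (q, t) \<in> G}))"
    proof -
      have "{(q, t) \<in> G. t \<in> S} = G" using G_sub by auto
      then show ?thesis using card_G_eq[OF order_refl] by simp
    qed
    also have "\<dots> \<le> (\<Sum>t\<in>S. B * r)" by (rule sum_mono[OF rich(2)])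
    also have "\<dots> = real (card S) * (B * r)" by simp
    also have "\<dots> \<le> B * c * (B * r)"
    proof (rule mult_right_mono)
      have "real (card S) \<le> real L ^ J * c" using U(2) unfolding c_def
        by (simp only: of_nat_power[symmetric] of_nat_mult[symmetric] of_nat_le_iff)
      also have "\<dots> \<le> B * c" using dyadic_le unfolding J_def c_def by (intro mult_right_mono) auto
      finally show "real (card S) \<le> B * c" .
      show "0 \<le> B * r" using B0 pos by simp
    qed
    finally have "B * real (card G) \<le> B * (B * c * (B * r))" using B0 by simp
    then show ?thesis using many by (simp add: power3_eq_cube mult_ac)
  qed
  have c0: "0 < c"
  proof (rule ccontr)
    assume "\<not> 0 < c"
    then have "c = 0" by (simp add: c_def)
    then show False using PM mult_pos_pos[OF P0 pos(1)] by simp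
  qed
  have PMg: "real (card P) * M \<le> B ^ 3 * g"
  proof -
    have "B ^ 3 * r * c = B ^ 3 * (r * c)" by simp
    also have "\<dots> \<le> B ^ 3 * g" using rg B0 by (intro mult_left_mono) auto
    finally show ?thesis using PM by linarith
  qed
  \<comment> \<open>Start at the grid level nearest to \<open>\<mu>\<close> and coarsen to the level where the normalised count drops.\<close>
  let ?f = "\<lambda>i. real p ^ (k * i) * real (incidences p (k * i) P U)"
  define D where "D = \<mu> div k"
  obtain i where i: "i \<le> D" "?f D \<le> 2 ^ (D - i) * ?f i" "i = 0 \<or> ?f (i - 1) < ?f i / 2"
    using level_of_drop[of D ?f] by blast
  define m where "m = k * i"
  define I where "I = real (incidences p m P U)"
  define V :: real where "V = 2 ^ e i"
  have V0: "0 < V" by (simp add: V_def)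
  have kD: "k * D \<le> \<mu>" by (simp add: D_def)
  have m\<mu>: "m \<le> \<mu>" unfolding m_def by (rule le_trans[OF mult_le_mono2[OF i(1)] kD])
  have mn: "m \<le> n" using m\<mu> mu_le by simp
  have iJ: "i < J" using i(1) by (simp add: J_def D_def)
  have un: "0 < u ^ n" "0 < u ^ m" using u_pos by simp_all
  have pm0: "0 < real p ^ m" using p_pos by simp
  have I0: "0 \<le> I" by (simp add: I_def)
  define W where "W = max (R / real p ^ m) (u ^ n * R\<^sup>2 / (real p ^ (2 * m) * u ^ m))"
  have W0: "0 < W" unfolding W_def using pos(2) pm0 by (simp add: less_max_iff_disj)
  have high: "I\<^sup>2 \<le> 8 * B ^ 2 * real p ^ m * real (card P) * W * c * V"
  proof -
    have "I\<^sup>2 \<le> 4 * real p ^ (m + k) * real (energy p m P) * real (energy p m U)"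
      unfolding I_def m_def using incidences_at_top_level[OF fU _ i(3)] mn by (simp add: m_def)
    also have "\<dots> \<le> 4 * (real p ^ m * B) * (real (card P) * (B * W)) * (c * (2 * V))"
    proof (intro mult_mono)
      show "real p ^ (m + k) \<le> real p ^ m * B"
        using step_le by (simp add: power_add mult_left_mono)
      have "real (energy p m P) = (\<Sum>q\<in>P. real (crowd p m P q))"
        by (simp add: energy_eq_sum_crowd[OF finite_P])
      also have "\<dots> \<le> (\<Sum>q\<in>P. B * W)"
        unfolding W_def by (rule sum_mono) (rule coarse[OF _ m\<mu>])
      finally show "real (energy p m P) \<le> real (card P) * (B * W)" by simp
      have "real (energy p m U) = (\<Sum>t\<in>U. real (crowd p m U t))"
        by (simp add: energy_eq_sum_crowd[OF fU])
      also have "\<dots> \<le> (\<Sum>t\<in>U. 2 * V)"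
      proof (rule sum_mono)
        fix t assume "t \<in> U"
        from e(2)[OF iJ this] have "real (crowd p m U t) < real (2 * 2 ^ e i)"
          unfolding crowd_def m_def by (simp only: of_nat_less_iff)
        then show "real (crowd p m U t) \<le> 2 * V" by (simp add: V_def)
      qed
      finally show "real (energy p m U) \<le> c * (2 * V)" by (simp add: c_def)
    qed (use B0 W0 V0 in \<open>simp_all add: c_def\<close>)
    finally show ?thesis by (simp add: power2_eq_square mult_ac)
  qed
  have rB: "r \<le> B ^ 20 * u ^ n * R" if "r \<le> 8 * B ^ j * u ^ n * R" "j \<le> 19" for j
  proof -
    have "8 * B ^ j \<le> B * B ^ j" using B_ge B0 by simp
    also have "\<dots> = B ^ Suc j" by simp
    also have "\<dots> \<le> B ^ 20" using that(2) B1 by (intro power_increasing) auto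
    finally have "8 * B ^ j * (u ^ n * R) \<le> B ^ 20 * (u ^ n * R)"
      using un pos by (intro mult_right_mono) auto
    then show ?thesis using that(1) by (simp add: mult.assoc)
  qed
  consider "W = R / real p ^ m" | "W = u ^ n * R\<^sup>2 / (real p ^ (2 * m) * u ^ m)"
    using W_def by (metis max_def)
  then show ?thesis
  proof cases
    case 1
    \<comment> \<open>Every tube of \<open>U\<close> has at least \<open>sqrt \<sigma>\<close> points of \<open>P\<close> in its neighbourhood of width \<open>p ^ (- m)\<close>.\<close>
    define \<sigma> where "\<sigma> = V * r\<^sup>2 / (B ^ 2 * M * u ^ n)"
    have \<sigma>0: "0 \<le> \<sigma>" using V0 pos un by (simp add: \<sigma>_def)
    have row: "sqrt \<sigma> \<le> real (card {q \<in> P. inc p m q t})" if t: "t \<in> U" for t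
    proof -
      have "V \<le> real (card {t' \<in> U. cls p m t' = cls p m t})"
        using e(1)[OF iJ t] unfolding V_def m_def by (simp only: of_nat_numeral[symmetric, where 'a = real] of_nat_power[symmetric] of_nat_le_iff)
      then have "V * (r\<^sup>2 / B) \<le> real (card {t' \<in> U. cls p m t' = cls p m t}) * (r\<^sup>2 / B)"
        using B0 by (intro mult_right_mono) auto
      also have "\<dots> \<le> (real (card {q \<in> P. inc p m q t}))\<^sup>2 * (B * M * u ^ n)"
        by (rule tube_bush[OF U(1) mn])
      finally have "\<sigma> \<le> (real (card {q \<in> P. inc p m q t}))\<^sup>2"
        unfolding \<sigma>_def using B0 pos un by (simp add: field_simps power2_eq_square)
      then show ?thesis by (rule real_le_lsqrt[OF of_nat_0_le_iff])
    qed
    have "c * sqrt \<sigma> = (\<Sum>t\<in>U. sqrt \<sigma>)" by (simp add: c_def)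
    also have "\<dots> \<le> (\<Sum>t\<in>U. real (card {q \<in> P. inc p m q t}))" by (rule sum_mono[OF row])
    also have "\<dots> = I"
    proof -
      have "{(q, t) \<in> P \<times> U. inc p m q t} = prod.swap ` Sigma U (\<lambda>t. {q \<in> P. inc p m q t})" by force
      then have "incidences p m P U = card (Sigma U (\<lambda>t. {q \<in> P. inc p m q t}))"
        by (simp add: incidences_def card_image)
      then show ?thesis using fU finite_P by (simp add: I_def)
    qed
    finally have "(c * sqrt \<sigma>)\<^sup>2 \<le> I\<^sup>2" using c0 \<sigma>0 by (intro power_mono) auto
    also note high
    also have "8 * B ^ 2 * real p ^ m * real (card P) * W * c * V
        = 8 * B ^ 2 * real (card P) * (real p ^ m * W) * c * V" by (simp only: mult_ac)
    also have "real p ^ m * W = R"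
    proof -
      have "x * (R / x) = R" if "0 < x" for x :: real using that by simp
      from this[OF pm0] show ?thesis unfolding 1 .
    qed
    finally have "c\<^sup>2 * \<sigma> \<le> 8 * B ^ 2 * real (card P) * R * c * V"
      using \<sigma>0 by (simp add: power_mult_distrib)
    then have "c * V * (c * r\<^sup>2) \<le> c * V * (8 * B ^ 4 * u ^ n * R * (real (card P) * M))"
      unfolding \<sigma>_def using B0 pos un
      by (simp add: divide_le_eq power2_eq_square power4_eq_xxxx mult_ac)
    then have "c * r\<^sup>2 \<le> 8 * B ^ 4 * u ^ n * R * (real (card P) * M)"
      using c0 V0 by simp
    also have "\<dots> \<le> 8 * B ^ 4 * u ^ n * R * (B ^ 3 * r * c)"
      using PM B0 un pos by (intro mult_left_mono) auto
    also have "\<dots> = (r * c) * (8 * B ^ 7 * u ^ n * R)" by (simp add: power_add[symmetric] mult_ac flip: power_add)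
    finally have "(r * c) * r \<le> (r * c) * (8 * B ^ 7 * u ^ n * R)" by (simp add: power2_eq_square mult_ac)
    then have "r \<le> 8 * B ^ 7 * u ^ n * R" using pos(3) c0 by simp
    then show ?thesis by (rule rB) simp
  next
    case 2
    have fans: "V * g \<le> I * (B * M * u ^ m)"
    proof -
      have "real (2 ^ e i) * g \<le> I * (B * M * u ^ m)"
        unfolding g_def I_def using e(1)[OF iJ] by (intro incidences_ge_fans[OF U(1) mn]) (simp add: m_def)
      then show ?thesis by (simp add: V_def)
    qed
    have chain: "real (card P) * M * R \<le> B ^ 12 * (real p ^ m * I)"
    proof -
      define Z where "Z = real p ^ \<mu> * real (incidences p \<mu> P U)"
      have PM0: "0 < real (card P) * M" using P0 pos by simp
      \<comment> \<open>\<open>cube_bush\<close> at level \<open>\<mu>\<close>, divided by \<open>|P| M\<close>.\<close>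
      have "(real (card P) * M)\<^sup>2 * R \<le> (B ^ 3 * g)\<^sup>2 * R"
        using PMg PM0 pos by (intro mult_right_mono power_mono) auto
      also have "\<dots> = B ^ 6 * (g\<^sup>2 * R)" by (simp add: power_mult_distrib flip: power_mult)
      also have "\<dots> \<le> B ^ 6 * (real (incidences p \<mu> P U) * real p ^ \<mu> * B * (real (card P) * (B ^ 3 * M)))"
        unfolding g_def using B0 by (intro mult_left_mono cube_bush U(1)) auto
      also have "\<dots> = (real (card P) * M) * (B ^ 10 * Z)"
        by (simp add: Z_def eval_nat_numeral mult_ac)
      finally have "(real (card P) * M) * (real (card P) * M * R) \<le> (real (card P) * M) * (B ^ 10 * Z)"
        by (simp add: power2_eq_square mult_ac)
      then have a: "real (card P) * M * R \<le> B ^ 10 * Z" using PM0 by (rule mult_left_le_imp_le)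
      \<comment> \<open>The grid level \<open>k D\<close> is within \<open>k\<close> of \<open>\<mu>\<close>; the steps from \<open>D\<close> to \<open>i\<close> lose at most a factor \<open>2\<close> each.\<close>
      have "real p ^ \<mu> \<le> real p ^ (k + k * D)"
      proof (rule power_increasing)
        have "\<mu> = k * D + \<mu> mod k" by (simp add: D_def)
        moreover have "\<mu> mod k < k" using step_pos by simp
        ultimately show "\<mu> \<le> k + k * D" by linarith
      qed (use p_pos in simp)
      also have "\<dots> \<le> B * real p ^ (k * D)" using step_le by (simp add: power_add mult_right_mono)
      finally have "Z \<le> B * real p ^ (k * D) * real (incidences p (k * D) P U)"
        unfolding Z_def using incidences_mono[OF kD finite_P fU] B0 by (intro mult_mono) auto
      also have "\<dots> = B * ?f D" by simp
      also have "\<dots> \<le> B * (2 ^ (D - i) * ?f i)" using i(2) B0 by (intro mult_left_mono) auto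
      also have "\<dots> \<le> B * (B * ?f i)"
      proof -
        have "(2::real) ^ (D - i) \<le> 2 ^ D" by (rule power_increasing) auto
        also have "\<dots> \<le> B" using halving_le by (simp add: D_def)
        finally show ?thesis using B0 by (intro mult_left_mono mult_right_mono) auto
      qed
      finally have "Z \<le> B * (B * (real p ^ m * I))" by (simp add: m_def I_def)
      then have "B ^ 10 * Z \<le> B ^ 10 * (B * (B * (real p ^ m * I)))" using B0 by (intro mult_left_mono) auto
      also have "\<dots> = B ^ 12 * (real p ^ m * I)" by (simp add: eval_nat_numeral mult_ac)
      finally show ?thesis using a by linarith
    qed
    \<comment> \<open>Multiply the two lower bounds for \<open>I\<close> and compare with \<open>high\<close>.\<close>
    have "V * (real (card P) * M) * (real (card P) * M * R) \<le> V * (B ^ 3 * g) * (B ^ 12 * (real p ^ m * I))"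
      by (rule mult_mono[OF mult_left_mono[OF PMg] chain])
        (use V0 P0 pos B0 in \<open>simp_all add: g_def\<close>)
    also have "\<dots> = B ^ 15 * (real p ^ m * I) * (V * g)" by (simp add: eval_nat_numeral mult_ac)
    also have "\<dots> \<le> B ^ 15 * (real p ^ m * I) * (I * (B * M * u ^ m))"
      using fans B0 pm0 I0 by (intro mult_left_mono) auto
    also have "\<dots> = B ^ 16 * real p ^ m * M * u ^ m * I\<^sup>2"
      by (simp add: eval_nat_numeral mult_ac)
    also have "\<dots> \<le> B ^ 16 * real p ^ m * M * u ^ m * (8 * B ^ 2 * real p ^ m * real (card P) * W * c * V)"
      using high B0 pm0 pos un by (intro mult_left_mono) auto
    also have "\<dots> = (V * (real (card P) * M)) * (8 * (B ^ 16 * B ^ 2) * (u ^ m * (real p ^ m * real p ^ m * W)) * c)"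
      by (simp only: mult_ac)
    also have "u ^ m * (real p ^ m * real p ^ m * W) = u ^ n * R\<^sup>2"
    proof -
      have c: "y * (x * x * (a / (x * x * y))) = a" if "0 < x" "0 < y" for x y a :: real
        using that by simp
      have pp: "real p ^ (2 * m) = real p ^ m * real p ^ m" by (simp add: power_add[symmetric] mult_2)
      show ?thesis unfolding 2 pp by (rule c[OF pm0 un(2)])
    qed
    also have "B ^ 16 * B ^ 2 = B ^ 18" by (simp flip: power_add)
    finally have "(V * (real (card P) * M) * R) * (real (card P) * M)
        \<le> (V * (real (card P) * M) * R) * (8 * B ^ 18 * u ^ n * R * c)"
      by (simp only: power2_eq_square mult_ac)
    then have "real (card P) * M \<le> 8 * B ^ 18 * u ^ n * R * c"
      by (rule mult_left_le_imp_le) (use V0 P0 pos in simp)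
    then have "B * (real (card P) * M) \<le> B * (8 * B ^ 18 * u ^ n * R * c)"
      using B0 by (intro mult_left_mono) auto
    moreover have "r * c \<le> B * (real (card P) * M)" using rg gP by (simp add: mult_ac)
    ultimately have "r * c \<le> B * (8 * B ^ 18 * u ^ n * R * c)" by linarith
    also have "\<dots> = (8 * B ^ 19 * u ^ n * R) * c" by (simp add: eval_nat_numeral mult_ac)
    finally have "r \<le> 8 * B ^ 19 * u ^ n * R" using c0 by simp
    then show ?thesis by (rule rB) simp
  qed
qed

end

section \<open>Localisation and the discrete estimate\<close>

text \<open>
  Coordinates inside the cell of level \<open>j\<close> that contains \<open>q\<close>, rescaled to unit size.  The cell itself is
  the copy of the plane in which the new point lives.
\<close>

definition local_point :: "nat \<Rightarrow> nat \<Rightarrow> 'c \<times> int \<times> int \<Rightarrow> ('c \<times> int \<times> int) \<times> int \<times> int" where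
  "local_point p j q = (cls p j q, fst (snd q) div int p ^ j, snd (snd q) div int p ^ j)"

text \<open>
  Substituting \<open>x = x\<^sub>0 + p ^ j x'\<close> and \<open>y = y\<^sub>0 + p ^ j y'\<close> into \<open>y = a x + b\<close>, with \<open>(x\<^sub>0, y\<^sub>0)\<close> the corner of the
  cell \<open>D\<close>, keeps the slope and divides the new intercept \<open>a x\<^sub>0 + b - y\<^sub>0\<close> by \<open>p ^ j\<close>.
\<close>

definition local_tube :: "nat \<Rightarrow> nat \<Rightarrow> 'c \<times> int \<times> int \<Rightarrow> 'c \<times> int \<times> int \<Rightarrow> ('c \<times> int \<times> int) \<times> int \<times> int" where
  "local_tube p j D t = (D, fst (snd t),
     (fst (snd t) * fst (snd D) + snd (snd t) - snd (snd D)) div int p ^ j)"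

lemma dvd_div_diff_iff:
  fixes x x' :: int
  assumes "p > 0" "int p ^ j dvd x - x'"
  shows "int p ^ m dvd x div int p ^ j - x' div int p ^ j \<longleftrightarrow> int p ^ (j + m) dvd x - x'"
proof -
  have "x mod int p ^ j = x' mod int p ^ j" using assms(2) by (simp add: mod_eq_dvd_iff)
  then have "x - x' = int p ^ j * (x div int p ^ j - x' div int p ^ j)"
    using mult_div_mod_eq[of "int p ^ j" x] mult_div_mod_eq[of "int p ^ j" x']
    unfolding right_diff_distrib by linarith
  then show ?thesis using assms(1) by (simp add: power_add)
qed

lemma cls_local_point_eq_iff:
  assumes "p > 0"
  shows "cls p m (local_point p j q) = cls p m (local_point p j q') \<longleftrightarrow> cls p (j + m) q = cls p (j + m) q'"
proof (cases "cls p j q = cls p j q'")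
  case True
  then have d: "int p ^ j dvd fst (snd q) - fst (snd q')" "int p ^ j dvd snd (snd q) - snd (snd q')" "fst q = fst q'"
    unfolding cls_eq_iff by simp_all
  have "cls p m (local_point p j q) = cls p m (local_point p j q') \<longleftrightarrow>
      int p ^ m dvd fst (snd q) div int p ^ j - fst (snd q') div int p ^ j \<and>
      int p ^ m dvd snd (snd q) div int p ^ j - snd (snd q') div int p ^ j"
    unfolding cls_eq_iff[of p m] by (simp add: local_point_def True)
  then show ?thesis
    unfolding cls_eq_iff[of p "j + m"] dvd_div_diff_iff[OF assms d(1)] dvd_div_diff_iff[OF assms d(2)]
    using d(3) by blast
next
  case False
  then have "cls p (j + m) q \<noteq> cls p (j + m) q'" using cls_mono[of p "j + m" q q' j] by auto
  moreover have "cls p m (local_point p j q) \<noteq> cls p m (local_point p j q')"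
    using False by (simp add: cls_def[of p m] local_point_def)
  ultimately show ?thesis by simp
qed

lemma inj_local_point: "inj (local_point p j)"
proof (rule injI)
  fix q q' :: "'a \<times> int \<times> int" assume h: "local_point p j q = local_point p j q'"
  have a: "fst q = fst q'" "fst (snd q) mod int p ^ j = fst (snd q') mod int p ^ j"
    "snd (snd q) mod int p ^ j = snd (snd q') mod int p ^ j"
    "fst (snd q) div int p ^ j = fst (snd q') div int p ^ j"
    "snd (snd q) div int p ^ j = snd (snd q') div int p ^ j"
    using h by (simp_all add: local_point_def cls_def)
  have "fst (snd q) = fst (snd q')" "snd (snd q) = snd (snd q')"
    using mult_div_mod_eq[of "int p ^ j"] a by metis+
  then show "q = q'" using a(1) by (simp add: prod_eq_iff)
qed

lemma inc_cls_left:
  assumes "inc p n q t" "j \<le> n"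
  shows "inc p j (cls p j q) t"
  using inc_mono[OF assms] inc_cls_cong[of p j "cls p j q" q t t] by (simp add: cls_idem)

lemma inc_local:
  assumes "p > 0" "inc p n q t" "j \<le> n"
  shows "inc p (n - j) (local_point p j q) (local_tube p j (cls p j q) t)"
proof -
  obtain c x y where q: "q = (c, x, y)" by (cases q)
  obtain d a b where t: "t = (d, a, b)" by (cases t)
  let ?N = "int p ^ j"
  have N: "?N > 0" using assms(1) by simp
  have "?N dvd a * (x mod ?N) + b - y mod ?N"
    using inc_cls_left[OF assms(2,3)] by (simp add: inc_def q t cls_def)
  then obtain w where w: "a * (x mod ?N) + b - y mod ?N = ?N * w" by (elim dvdE)
  then have wb: "(a * (x mod ?N) + b - y mod ?N) div ?N = w" using N by simp
  have "a * x + b - y = a * (?N * (x div ?N) + x mod ?N) + b - (?N * (y div ?N) + y mod ?N)"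
    by simp
  also have "\<dots> = ?N * (a * (x div ?N)) + (a * (x mod ?N) + b - y mod ?N) - ?N * (y div ?N)"
    by (simp only: distrib_left mult_ac)
  also have "\<dots> = ?N * (a * (x div ?N) + w - y div ?N)"
    unfolding w by (simp only: distrib_left right_diff_distrib)
  finally have e: "a * x + b - y = ?N * (a * (x div ?N) + w - y div ?N)" .
  have "int p ^ n = ?N * int p ^ (n - j)" using assms(3) by (simp flip: power_add)
  moreover have "int p ^ n dvd a * x + b - y" using assms(2) by (simp add: inc_def q t)
  ultimately have "?N * int p ^ (n - j) dvd ?N * (a * (x div ?N) + w - y div ?N)" by (simp only: e)
  then have "int p ^ (n - j) dvd a * (x div ?N) + w - y div ?N" using assms(1) by simp
  then show ?thesis by (simp add: inc_def local_point_def local_tube_def q t cls_def wb)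
qed

text \<open>
  The division by \<open>p ^ j\<close> is exact for tubes that meet the cell, so the intercept can be recovered.
\<close>

lemma local_tube_inj:
  assumes "inc p n q t" "inc p n q' t'" "j \<le> n"
    and "local_tube p j (cls p j q) t = local_tube p j (cls p j q') t'"
  shows "t = t'"
proof -
  have D: "cls p j q = cls p j q'" and a: "fst (snd t) = fst (snd t')"
    using assms(4) by (simp_all add: local_tube_def)
  let ?D = "cls p j q"
  let ?v = "\<lambda>t. fst (snd t) * fst (snd ?D) + snd (snd t) - snd (snd ?D)"
  have i: "inc p j ?D t" "inc p j ?D t'"
    using inc_cls_left[OF assms(1,3)] inc_cls_left[OF assms(2,3)] D by simp_all
  then have "int p ^ j dvd ?v t" "int p ^ j dvd ?v t'" by (simp_all add: inc_def)
  moreover have "?v t div int p ^ j = ?v t' div int p ^ j"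
    using assms(4) unfolding local_tube_def D[symmetric] prod.inject by (elim conjE)
  ultimately have "?v t = ?v t'" using dvd_mult_div_cancel by metis
  then have "snd (snd t) = snd (snd t')" using a by simp
  moreover have "fst t = fst t'" using i by (simp add: inc_def)
  ultimately show ?thesis using a by (simp add: prod_eq_iff)
qed

lemma crowd_local_point:
  assumes "p > 0"
  shows "crowd p m (local_point p j ` P) (local_point p j q) = crowd p (j + m) P q"
proof -
  have "{v \<in> local_point p j ` P. cls p m v = cls p m (local_point p j q)}
      = local_point p j ` {v \<in> P. cls p m (local_point p j v) = cls p m (local_point p j q)}"
    by blast
  also have "\<dots> = local_point p j ` {v \<in> P. cls p (j + m) v = cls p (j + m) q}"
    unfolding cls_local_point_eq_iff[OF assms] ..
  finally show ?thesis unfolding crowd_def by (simp add: card_image inj_on_subset[OF inj_local_point])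
qed

lemma crowd_subset:
  assumes "finite P" "Q \<subseteq> P"
  shows "crowd p m Q q \<le> crowd p m P q"
  unfolding crowd_def by (rule card_mono) (use assms in auto)

lemma crowd_coarsen:
  assumes "finite P" "k \<le> m"
  shows "crowd p m P q \<le> crowd p k P q"
  unfolding crowd_def
proof (rule card_mono)
  show "{v \<in> P. cls p m v = cls p m q} \<subseteq> {v \<in> P. cls p k v = cls p k q}"
    using cls_mono[OF _ assms(2)] by blast
qed (use assms(1) in simp)

text \<open>
  The hypotheses of the theorem modulo \<open>p ^ n\<close>: \<open>pu\<close> says \<open>s \<le> 1\<close>, \<open>not_too_many\<close> and \<open>not_too_few\<close> come from
  \<open>t < 2 - s\<close> and \<open>s < t\<close>.
\<close>

locale furstenberg_config = incidence_config p n P S G u "B * M"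
  for p n :: nat and P S :: "('c \<times> int \<times> int) set"
    and G :: "(('c \<times> int \<times> int) \<times> ('c \<times> int \<times> int)) set" and u B M :: real +
  fixes k L :: nat
  assumes pu: "1 \<le> real p * u"
    and B_ge: "8 \<le> B" and step_le: "real p ^ k \<le> B" and step_pos: "0 < k" and depth_le: "real (n + 1) \<le> B"
    and p2_le: "(real p)\<^sup>2 \<le> B"
    and dyadic_le: "real L ^ (n div k + 1) \<le> B" and halving_le: "2 ^ (n div k) \<le> B"
    and card_S: "card S < 2 ^ L" and card_P: "card P < 2 ^ L"
    and M_pos: "0 < M" and P_ne: "P \<noteq> {}"
    and rows: "q \<in> P \<Longrightarrow> M \<le> B * real (card {t. (q, t) \<in> G})"
    and spacing: "q \<in> P \<Longrightarrow> m \<le> n \<Longrightarrow> real (crowd p m P q)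
      \<le> B * max (real (card P) / (real p ^ (2 * m) * u ^ m)) (1 / u ^ (n - m))"
    and not_too_many: "real (card P) \<le> B * (real p ^ (2 * n) * u ^ n)"
    and not_too_few: "1 \<le> B * (real (card P) * u ^ n)"
begin

lemma B_pos: "0 < B" and B_ge_1: "1 \<le> B" using B_ge by simp_all

lemma card_P_pos: "0 < real (card P)" using P_ne finite_P by (simp add: card_gt_0_iff)

text \<open>
  The target for the richness of tubes is \<open>u ^ n R0\<close>, equivalently \<open>M R0\<close> is the target for the number of tubes.
\<close>

definition R0 :: real where "R0 = sqrt (real (card P) / u ^ n)"

lemma R0_sq: "R0\<^sup>2 = real (card P) / u ^ n"
  unfolding R0_def using u_pos by simp

lemma R0_pos: "0 < R0"
  unfolding R0_def using u_pos card_P_pos by simp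

definition overcrowded :: "nat \<Rightarrow> 'c \<times> int \<times> int \<Rightarrow> bool" where
  "overcrowded m q \<longleftrightarrow> R0 / real p ^ m < real (crowd p m P q) \<and>
     B * (real (card P) / (real p ^ (2 * m) * u ^ m)) < real (crowd p m P q)"

text \<open>
  The coarsest overcrowded level; the default \<open>n\<close> is harmless because \<open>not_too_many\<close> makes level \<open>n\<close> crowded
  enough for \<open>at_mu_P1\<close>.
\<close>

definition critical_level :: "'c \<times> int \<times> int \<Rightarrow> nat" where
  "critical_level q = (LEAST m. m = n \<or> overcrowded m q)"

lemma critical_level_le: "critical_level q \<le> n"
  unfolding critical_level_def by (rule Least_le) simp

lemma critical_level_bad: "critical_level q = n \<or> overcrowded (critical_level q) q"
  unfolding critical_level_def by (rule LeastI[of _ n]) simp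

lemma not_bad_below_critical_level: "m < critical_level q \<Longrightarrow> \<not> overcrowded m q"
  using not_less_Least[of m "\<lambda>m. m = n \<or> overcrowded m q"] by (simp add: critical_level_def)

lemma overcrowded_cls_cong: "cls p m q = cls p m q' \<Longrightarrow> overcrowded m q = overcrowded m q'"
  by (simp add: overcrowded_def crowd_def)

lemma critical_level_cls_cong:
  assumes "cls p (critical_level q) q' = cls p (critical_level q) q"
  shows "critical_level q' = critical_level q"
proof -
  have b: "overcrowded m q' = overcrowded m q" if "m \<le> critical_level q" for m
    using overcrowded_cls_cong[OF cls_mono[OF assms that]] .
  show ?thesis unfolding critical_level_def[of q']
  proof (rule Least_equality)
    show "critical_level q = n \<or> overcrowded (critical_level q) q'" using critical_level_bad[of q] b by auto
    fix m assume "m = n \<or> overcrowded m q'"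
    then show "critical_level q \<le> m" using not_bad_below_critical_level[of m q] b[of m] critical_level_le[of q] by (metis linorder_not_less nless_le)
  qed
qed

end

text \<open>
  All points of \<open>P'\<close> have the same critical level \<open>\<mu>\<close>.  As this level depends only on the class modulo
  \<open>p ^ \<mu>\<close>, passing from \<open>P\<close> to \<open>P'\<close> keeps or discards whole classes of level \<open>\<mu>\<close>.
\<close>

locale leveled_config = furstenberg_config +
  fixes \<mu> :: nat
begin

definition P' where "P' = {q \<in> P. critical_level q = \<mu>}"

lemma P1_sub: "P' \<subseteq> P" by (auto simp: P'_def)

lemma finite_P1: "finite P'" using finite_subset[OF P1_sub finite_P] .

lemma crowd_P1_le: "crowd p m P' q \<le> crowd p m P q"
  by (rule crowd_subset[OF finite_P P1_sub])

lemma crowd_P1_mu: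
  assumes "q \<in> P'"
  shows "crowd p \<mu> P' q = crowd p \<mu> P q"
proof -
  have q: "critical_level q = \<mu>" using assms by (simp add: P'_def)
  have "{v \<in> P'. cls p \<mu> v = cls p \<mu> q} = {v \<in> P. cls p \<mu> v = cls p \<mu> q}"
    using critical_level_cls_cong[of q, unfolded q] unfolding P'_def by blast
  then show ?thesis by (simp add: crowd_def)
qed

lemma mu_le: "P' \<noteq> {} \<Longrightarrow> \<mu> \<le> n" using critical_level_le by (auto simp: P'_def)

text \<open>
  Levels coarser than \<open>\<mu>\<close> are not overcrowded.  Level \<open>\<mu>\<close> itself is compared with level \<open>\<mu> - 1\<close>, at the cost of a factor
  \<open>p\<^sup>2\<close>; for \<open>\<mu> = 0\<close> the crowd is trivially at most \<open>|P|\<close>.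
\<close>

lemma coarse_P1:
  assumes "q \<in> P'" "m \<le> \<mu>"
  shows "real (crowd p m P' q)
    \<le> B ^ 2 * max (R0 / real p ^ m) (real (card P) / (real p ^ (2 * m) * u ^ m))"
proof -
  let ?f = "\<lambda>m. max (R0 / real p ^ m) (real (card P) / (real p ^ (2 * m) * u ^ m))"
  have f0: "0 \<le> ?f m" for m using R0_pos by (simp add: le_max_iff_disj)
  have BB: "B \<le> B ^ 2" using B_ge_1 by (simp add: power2_eq_square)
  have good: "real (crowd p m P q) \<le> B * ?f m" if "m < \<mu>" for m
  proof -
    have "\<not> overcrowded m q" using not_bad_below_critical_level[of m q] assms(1) that by (simp add: P'_def)
    then have "real (crowd p m P q) \<le> R0 / real p ^ m \<or>
        real (crowd p m P q) \<le> B * (real (card P) / (real p ^ (2 * m) * u ^ m))"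
      by (auto simp: overcrowded_def)
    moreover have "R0 / real p ^ m \<le> B * ?f m"
    proof -
      have "R0 / real p ^ m \<le> 1 * ?f m" by simp
      also have "\<dots> \<le> B * ?f m" using B_ge_1 f0 by (rule mult_right_mono)
      finally show ?thesis .
    qed
    moreover have "B * (real (card P) / (real p ^ (2 * m) * u ^ m)) \<le> B * ?f m"
      using B_pos by (intro mult_left_mono) auto
    ultimately show ?thesis by linarith
  qed
  have "real (crowd p m P q) \<le> B ^ 2 * ?f m"
  proof (cases "m < \<mu>")
    case True
    have "B * ?f m \<le> B ^ 2 * ?f m" using BB f0 by (rule mult_right_mono)
    then show ?thesis using good[OF True] by linarith
  next
    case False
    show ?thesis
    proof (cases m)
      case 0
      have "crowd p m P q \<le> card P" unfolding crowd_def using finite_P by (intro card_mono) auto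
      then have "real (crowd p m P q) \<le> 1 * ?f 0" using 0 by simp
      also have "\<dots> \<le> B ^ 2 * ?f 0" using B_ge_1 f0[of 0] by (intro mult_right_mono) (simp_all add: one_le_power)
      finally show ?thesis using 0 by simp
    next
      case (Suc l)
      have pp: "0 < real p" "1 \<le> real p" using p_pos by simp_all
      have fl: "?f l \<le> (real p)\<^sup>2 * ?f m"
      proof -
        have "R0 / real p ^ l = real p * (R0 / real p ^ m)" using pp by (simp add: Suc)
        also have "\<dots> \<le> (real p)\<^sup>2 * (R0 / real p ^ m)"
          using pp R0_pos by (intro mult_right_mono) (auto simp: power2_eq_square)
        also have "\<dots> \<le> (real p)\<^sup>2 * ?f m" by (intro mult_left_mono) auto
        finally have a: "R0 / real p ^ l \<le> (real p)\<^sup>2 * ?f m" .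
        have "real (card P) / (real p ^ (2 * l) * u ^ l)
            = (real p)\<^sup>2 * (real (card P) / (real p ^ (2 * m) * u ^ m) * u)"
          using pp u_pos by (simp add: Suc power2_eq_square)
        also have "\<dots> \<le> (real p)\<^sup>2 * (real (card P) / (real p ^ (2 * m) * u ^ m) * 1)"
          using u_pos u_le by (intro mult_left_mono) auto
        also have "\<dots> \<le> (real p)\<^sup>2 * ?f m" by (intro mult_left_mono) auto
        finally show ?thesis using a by simp
      qed
      have "real (crowd p m P q) \<le> real (crowd p l P q)"
        using crowd_coarsen[OF finite_P, of l m] Suc by simp
      also have "\<dots> \<le> B * ?f l" using good[of l] assms(2) Suc by simp
      also have "\<dots> \<le> B * ((real p)\<^sup>2 * ?f m)" using fl B_pos by (intro mult_left_mono) auto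
      also have "\<dots> \<le> B * (B * ?f m)" using p2_le B_pos f0 by (intro mult_left_mono mult_right_mono) auto
      finally show ?thesis by (simp add: power2_eq_square mult.assoc)
    qed
  qed
  then show ?thesis using crowd_P1_le[of m q] by linarith
qed

lemma at_mu_P1:
  assumes "q \<in> P'"
  shows "R0 / real p ^ \<mu> \<le> B * real (crowd p \<mu> P' q)"
proof -
  have lq: "critical_level q = \<mu>" "q \<in> P" using assms by (simp_all add: P'_def)
  have w1: "1 \<le> real (crowd p \<mu> P q)" using crowd_pos[OF finite_P lq(2), of p \<mu>] by linarith
  show ?thesis
  proof (cases "overcrowded \<mu> q")
    case True
    then have "R0 / real p ^ \<mu> \<le> 1 * real (crowd p \<mu> P q)" by (simp add: overcrowded_def)
    also have "\<dots> \<le> B * real (crowd p \<mu> P q)" using B_ge_1 by (intro mult_right_mono) auto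
    finally show ?thesis by (simp add: crowd_P1_mu[OF assms])
  next
    case False
    then have "\<mu> = n" using critical_level_bad[of q] lq by auto
    have "(R0 / real p ^ n)\<^sup>2 = real (card P) / (real p ^ (2 * n) * u ^ n)"
      by (simp add: power_divide R0_sq mult.commute flip: power_mult)
    also have "\<dots> \<le> B" using not_too_many p_pos u_pos by (simp add: divide_le_eq)
    also have "\<dots> \<le> B\<^sup>2" using B_ge_1 by (simp add: power2_eq_square)
    finally have "R0 / real p ^ n \<le> B" by (rule power2_le_imp_le) (use B_pos in simp)
    also have "\<dots> \<le> B * real (crowd p \<mu> P q)" using w1 B_pos by simp
    finally have "R0 / real p ^ \<mu> \<le> B * real (crowd p \<mu> P q)" by (simp only: \<open>\<mu> = n\<close>)
    then show ?thesis by (simp only: crowd_P1_mu[OF assms])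
  qed
qed

text \<open>
  At an overcrowded level the first bound of the spacing condition fails, so the second term of the maximum is
  the larger one there.  As \<open>p u \<ge> 1\<close>, it stays the larger one at all finer levels.
\<close>

lemma fine_P1:
  assumes "q \<in> P'" "\<mu> \<le> m" "m \<le> n"
  shows "real (crowd p m P' q) \<le> B ^ 2 / u ^ (n - m)"
proof -
  have lq: "critical_level q = \<mu>" "q \<in> P" using assms by (simp_all add: P'_def)
  have un: "0 < u ^ j" for j using u_pos by simp
  have pp: "0 < real p ^ j" for j using p_pos by simp
  have "real (card P) / (real p ^ (2 * m) * u ^ m) \<le> B / u ^ (n - m)"
  proof (cases "overcrowded \<mu> q")
    case True
    then have "B * (real (card P) / (real p ^ (2 * \<mu>) * u ^ \<mu>))
        < B * max (real (card P) / (real p ^ (2 * \<mu>) * u ^ \<mu>)) (1 / u ^ (n - \<mu>))"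
      using spacing[OF lq(2), of \<mu>] assms by (simp add: overcrowded_def)
    then have "real (card P) / (real p ^ (2 * \<mu>) * u ^ \<mu>)
        < max (real (card P) / (real p ^ (2 * \<mu>) * u ^ \<mu>)) (1 / u ^ (n - \<mu>))"
      using B_pos by (simp only: mult_less_cancel_left_pos)
    then have "real (card P) / (real p ^ (2 * \<mu>) * u ^ \<mu>) \<le> 1 / u ^ (n - \<mu>)" by (simp add: less_max_iff_disj)
    then have "real (card P) * u ^ (n - \<mu>) \<le> real p ^ (2 * \<mu>) * u ^ \<mu>"
      using un pp by (simp add: divide_le_eq le_divide_eq mult_ac)
    then have "real (card P) * u ^ (n - \<mu>) * u ^ \<mu> \<le> real p ^ (2 * \<mu>) * u ^ \<mu> * u ^ \<mu>"
      using less_imp_le[OF un] by (rule mult_right_mono)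
    also have "\<dots> = (real p * u) ^ (2 * \<mu>)" by (simp add: power_mult_distrib mult_2 power_add)
    also have "\<dots> \<le> (real p * u) ^ (2 * m)" using pu assms(2) by (intro power_increasing) auto
    also have "\<dots> = real p ^ (2 * m) * u ^ m * u ^ m" by (simp add: power_mult_distrib mult_2 power_add)
    finally have "real (card P) * (u ^ (n - m) * u ^ m) \<le> real p ^ (2 * m) * u ^ m * u ^ m"
      using assms by (simp add: mult.assoc flip: power_add)
    then have "real (card P) * u ^ (n - m) \<le> real p ^ (2 * m) * u ^ m"
      using un[of m] by (simp add: mult.assoc[symmetric])
    then have "real (card P) / (real p ^ (2 * m) * u ^ m) \<le> 1 / u ^ (n - m)"
      using un pp by (simp add: divide_le_eq le_divide_eq mult_ac)
    also have "\<dots> \<le> B / u ^ (n - m)" using B_ge_1 less_imp_le[OF un] by (rule divide_right_mono)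
    finally show ?thesis .
  next
    case False
    then have "\<mu> = n" using critical_level_bad[of q] lq by auto
    then have "m = n" using assms by simp
    then show ?thesis using not_too_many un pp by (simp add: divide_le_eq)
  qed
  moreover have "1 / u ^ (n - m) \<le> B / u ^ (n - m)" using B_ge_1 less_imp_le[OF un] by (rule divide_right_mono)
  ultimately have "B * max (real (card P) / (real p ^ (2 * m) * u ^ m)) (1 / u ^ (n - m)) \<le> B * (B / u ^ (n - m))"
    using B_pos by (intro mult_left_mono) auto
  then show ?thesis using spacing[OF lq(2) assms(3)] crowd_P1_le[of m q]
    by (simp add: power2_eq_square)
qed


definition G' where "G' = {(q, t) \<in> G. q \<in> P'}"

definition richness where "richness t = card {q. (q, t) \<in> G'}"

text \<open>
  Pairs of points on \<open>t\<close> at distance exactly \<open>p ^ (- j)\<close>; for \<open>j = n\<close> the two points may coincide.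
\<close>

definition pairs_at where "pairs_at j t = {(q, q'). (q, t) \<in> G' \<and> (q', t) \<in> G' \<and> cls p j q' = cls p j q
  \<and> (j = n \<or> \<not> int p ^ Suc j dvd fst (snd q) - fst (snd q'))}"

lemma G1_sub: "G' \<subseteq> P' \<times> S" using G_sub by (auto simp: G'_def)

lemma G1_le: "G' \<subseteq> G" by (auto simp: G'_def)

lemma G1_inc: "(q, t) \<in> G' \<Longrightarrow> inc p n q t" using G1_le G_inc by blast

lemma fan_G1:
  assumes "q \<in> P'" "m \<le> n"
  shows "real (card {t. (q, t) \<in> G' \<and> int p ^ m dvd fst (snd t) - \<alpha>}) \<le> B * M * u ^ m"
proof -
  have "card {t. (q, t) \<in> G' \<and> int p ^ m dvd fst (snd t) - \<alpha>}
      \<le> card {t. (q, t) \<in> G \<and> int p ^ m dvd fst (snd t) - \<alpha>}"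
    using G1_le by (intro card_mono finite_fan) blast
  then show ?thesis using fan[of q m \<alpha>] P1_sub assms by fastforce
qed

lemma config_P1: "incidence_config p n P' S G' u (B * M)"
  by unfold_locales (use prime_p finite_P1 finite_S G1_sub G1_inc u_pos u_le fan_G1 in blast)+

lemma finite_row_G1: "finite {q. (q, t) \<in> G' \<and> Q q}"
  by (rule finite_subset[OF _ finite_P1]) (use G1_sub in blast)

lemma finite_pairs_at: "finite (pairs_at j t)"
  by (rule finite_subset[of _ "P' \<times> P'"]) (use G1_sub finite_P1 in \<open>auto simp: pairs_at_def\<close>)

lemma L_le: "real L \<le> B"
proof (cases "L = 0")
  case True
  then show ?thesis using B_pos by simp
next
  case False
  then have "real L ^ 1 \<le> real L ^ (n div k + 1)" by (intro power_increasing) auto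
  then show ?thesis using dyadic_le by simp
qed

lemma richness_lt: "richness t < 2 ^ L"
proof -
  have "richness t \<le> card P" unfolding richness_def using G1_sub P1_sub finite_P by (intro card_mono) auto
  then show ?thesis using card_P by simp
qed

lemma sum_richness: "(\<Sum>t\<in>S. richness t) = card G'"
proof -
  have "G' = prod.swap ` Sigma S (\<lambda>t. {q. (q, t) \<in> G'})" using G1_sub by force
  then have "card G' = card (prod.swap ` Sigma S (\<lambda>t. {q. (q, t) \<in> G'}))" by (rule arg_cong)
  also have "\<dots> = card (Sigma S (\<lambda>t. {q. (q, t) \<in> G'}))"
    by (rule card_image) (rule inj_onI, auto)
  also have "\<dots> = (\<Sum>t\<in>S. richness t)"
    unfolding richness_def using finite_row_G1[where Q = "\<lambda>_. True"] by (intro card_SigmaI finite_S) simp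
  finally show ?thesis by simp
qed

lemma card_G1_ge: "real (card P') * M \<le> B * real (card G')"
proof -
  have "G' = Sigma P' (\<lambda>q. {t. (q, t) \<in> G})" using G_sub by (auto simp: G'_def P'_def)
  then have "real (card G') = (\<Sum>q\<in>P'. real (card {t. (q, t) \<in> G}))" using finite_P1 by simp
  then have "B * real (card G') = (\<Sum>q\<in>P'. B * real (card {t. (q, t) \<in> G}))"
    by (simp add: sum_distrib_left)
  also have "\<dots> \<ge> (\<Sum>q\<in>P'. M)" by (rule sum_mono) (use rows P1_sub in blast)
  finally show ?thesis by simp
qed

lemma dominant_distance:
  assumes "t \<in> S"
  shows "\<exists>j<n + 1. (richness t)\<^sup>2 \<le> (n + 1) * card (pairs_at j t)"
proof (rule ccontr)
  assume "\<not> ?thesis"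
  then have lt: "(n + 1) * card (pairs_at j t) < (richness t)\<^sup>2" if "j < n + 1" for j using that by auto
  let ?R = "{q. (q, t) \<in> G'}"
  have sub: "?R \<times> ?R \<subseteq> (\<Union>j<n + 1. pairs_at j t)"
  proof
    fix z assume "z \<in> ?R \<times> ?R"
    then obtain q q' where z: "z = (q, q')" and h: "(q, t) \<in> G'" "(q', t) \<in> G'" by blast
    have "cls p 0 q' = cls p 0 q"
      using cls_eq_on_tube[OF G1_inc[OF h(2)] G1_inc[OF h(1)], of 0] by simp
    then obtain j where "j \<le> n" "cls p j q' = cls p j q"
        "j = n \<or> \<not> int p ^ Suc j dvd fst (snd q) - fst (snd q')"
      using distance_on_tube[OF G1_inc[OF h(1)] G1_inc[OF h(2)], of 0] by blast
    then show "z \<in> (\<Union>j<n + 1. pairs_at j t)" using h unfolding z pairs_at_def by auto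
  qed
  have "(richness t)\<^sup>2 = card (?R \<times> ?R)" by (simp add: richness_def card_cartesian_product power2_eq_square)
  also have "\<dots> \<le> card (\<Union>j<n + 1. pairs_at j t)" by (rule card_mono[OF _ sub]) (simp add: finite_pairs_at)
  also have "\<dots> \<le> (\<Sum>j<n + 1. card (pairs_at j t))" by (rule card_UN_le) simp
  finally have "(n + 1) * (richness t)\<^sup>2 \<le> (\<Sum>j<n + 1. (n + 1) * card (pairs_at j t))"
    unfolding sum_distrib_left[symmetric] by (rule mult_le_mono2)
  also have "\<dots> < (\<Sum>j<n + 1. (richness t)\<^sup>2)" using lt by (intro sum_strict_mono) auto
  finally show False by simp
qed

text \<open>
  Pigeonhole on the dyadic size of the richness and on a distance realised by at least one in
  \<open>n + 1\<close> of the pairs of points on the tube.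
\<close>

lemma select_tubes:
  "\<exists>e j S'. j \<le> n \<and> S' \<subseteq> S \<and> (\<forall>t\<in>S'. 2 ^ e \<le> richness t \<and> richness t < 2 * 2 ^ e \<and>
      (richness t)\<^sup>2 \<le> (n + 1) * card (pairs_at j t)) \<and>
    real (card P') * M \<le> B ^ 3 * real (\<Sum>t\<in>S'. richness t)"
proof -
  let ?S = "{t \<in> S. 0 < richness t}"
  have fS: "finite ?S" using finite_S by simp
  obtain e where e: "sum richness ?S \<le> L * sum richness {t \<in> ?S. 2 ^ e \<le> richness t \<and> richness t < 2 * 2 ^ e}"
    using weighted_pigeonhole[OF fS, of L "\<lambda>e t. 2 ^ e \<le> richness t \<and> richness t < 2 * 2 ^ e" richness]
      dyadic_exponent richness_lt by auto
  let ?T = "{t \<in> ?S. 2 ^ e \<le> richness t \<and> richness t < 2 * 2 ^ e}"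
  have fT: "finite ?T" by (rule finite_subset[OF _ fS]) blast
  obtain j where jn: "j < n + 1" and j: "sum richness ?T \<le> (n + 1) * sum richness {t \<in> ?T. (richness t)\<^sup>2 \<le> (n + 1) * card (pairs_at j t)}"
    using weighted_pigeonhole[OF fT, of "n + 1" "\<lambda>j t. (richness t)\<^sup>2 \<le> (n + 1) * card (pairs_at j t)" richness]
      dominant_distance by auto
  let ?U = "{t \<in> ?T. (richness t)\<^sup>2 \<le> (n + 1) * card (pairs_at j t)}"
  have "card G' = sum richness ?S"
    unfolding sum_richness[symmetric] by (rule sum.mono_neutral_right) (use finite_S in auto)
  also have "\<dots> \<le> L * ((n + 1) * sum richness ?U)" using e mult_le_mono2[OF j, of L] by linarith
  finally have "real (card G') \<le> real (L * ((n + 1) * sum richness ?U))" by (simp only: of_nat_le_iff)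
  also have "\<dots> = real L * (real (n + 1) * real (sum richness ?U))" by (simp only: of_nat_mult)
  also have "\<dots> \<le> B * (B * real (sum richness ?U))"
    by (rule mult_mono[OF L_le mult_right_mono[OF depth_le]]) (use B_pos in \<open>simp_all add: sum_nonneg\<close>)
  finally have "B * real (card G') \<le> B * (B * (B * real (sum richness ?U)))" using B_pos by simp
  then have "real (card P') * M \<le> B ^ 3 * real (sum richness ?U)"
    using card_G1_ge by (simp add: power3_eq_cube mult.assoc)
  then show ?thesis using jn by (intro exI[of _ e] exI[of _ j] exI[of _ ?U]) auto
qed

text \<open>
  Average over the cells \<open>D\<close> of level \<open>j\<close>, weighted with the number of points on \<open>t\<close> in \<open>D\<close>.  In the chosen
  cell this number \<open>\<rho>\<close> satisfies both inequalities because there are at most \<open>\<rho>\<^sup>2\<close> pairs in \<open>D\<close>.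
\<close>

lemma dominant_cell:
  assumes "0 < richness t" "(richness t)\<^sup>2 \<le> (n + 1) * card (pairs_at j t)"
  shows "\<exists>D. richness t \<le> (n + 1) * card {q. (q, t) \<in> G' \<and> cls p j q = D} \<and>
    (richness t)\<^sup>2 \<le> (n + 1)\<^sup>2 * card {(q, q') \<in> pairs_at j t. cls p j q = D}"
proof -
  let ?R = "{q. (q, t) \<in> G'}"
  let ?\<rho> = "\<lambda>y. card {q \<in> ?R. cls p j q = y}"
  let ?F = "\<lambda>y. {(q, q') \<in> pairs_at j t. cls p j q = y}"
  have fR: "finite ?R" using finite_row_G1[where Q = "\<lambda>_. True"] by simp
  let ?Y = "cls p j ` ?R"
  have "pairs_at j t = (\<Union>y\<in>?Y. ?F y)" by (auto simp: pairs_at_def)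
  then have "card (pairs_at j t) \<le> (\<Sum>y\<in>?Y. card (?F y))"
    using card_UN_le[of ?Y ?F] fR by simp
  then have a: "(richness t)\<^sup>2 \<le> (\<Sum>y\<in>?Y. (n + 1) * card (?F y))"
    using assms(2) mult_le_mono2[of "card (pairs_at j t)" _ "n + 1"] le_trans
    unfolding sum_distrib_left[symmetric] by blast
  have b: "richness t = (\<Sum>y\<in>?Y. ?\<rho> y)" unfolding richness_def by (rule card_eq_sum_fibres[OF fR])
  \<comment> \<open>Otherwise summing over the cells would contradict the bound \<open>a\<close>.\<close>
  have "\<exists>y\<in>?Y. richness t * ?\<rho> y \<le> (n + 1) * card (?F y)"
  proof (rule ccontr)
    assume "\<not> ?thesis"
    then have lt: "(n + 1) * card (?F y) < richness t * ?\<rho> y" if "y \<in> ?Y" for y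
      using that by (meson not_le)
    have "?Y \<noteq> {}" using assms(1) fR by (auto simp: richness_def card_gt_0_iff)
    then have "(\<Sum>y\<in>?Y. (n + 1) * card (?F y)) < (\<Sum>y\<in>?Y. richness t * ?\<rho> y)"
      using fR lt by (intro sum_strict_mono) auto
    also have "\<dots> = (richness t)\<^sup>2" unfolding sum_distrib_left[symmetric] b[symmetric] by (simp add: power2_eq_square)
    finally show False using a by simp
  qed
  then obtain y where y: "y \<in> ?Y" "richness t * ?\<rho> y \<le> (n + 1) * card (?F y)" by blast
  have \<rho>0: "0 < ?\<rho> y" using y(1) fR by (auto simp: card_gt_0_iff)
  have "?F y \<subseteq> {q \<in> ?R. cls p j q = y} \<times> {q \<in> ?R. cls p j q = y}" by (auto simp: pairs_at_def)
  then have "card (?F y) \<le> card ({q \<in> ?R. cls p j q = y} \<times> {q \<in> ?R. cls p j q = y})"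
    using fR by (intro card_mono) auto
  also have "\<dots> = ?\<rho> y * ?\<rho> y" by (simp only: card_cartesian_product)
  finally have z: "card (?F y) \<le> ?\<rho> y * ?\<rho> y" .
  have "richness t * ?\<rho> y \<le> ((n + 1) * ?\<rho> y) * ?\<rho> y"
    unfolding mult.assoc by (rule le_trans[OF y(2) mult_le_mono2[OF z]])
  then have c: "richness t \<le> (n + 1) * ?\<rho> y" using \<rho>0 by (simp only: mult_le_cancel2)
  have "(richness t)\<^sup>2 \<le> richness t * ((n + 1) * ?\<rho> y)" unfolding power2_eq_square using c by (rule mult_le_mono2)
  also have "\<dots> = (n + 1) * (richness t * ?\<rho> y)" by (simp only: mult_ac)
  also have "\<dots> \<le> (n + 1) * ((n + 1) * card (?F y))" using y(2) by (rule mult_le_mono2)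
  finally have d: "(richness t)\<^sup>2 \<le> (n + 1)\<^sup>2 * card (?F y)" by (simp only: power2_eq_square mult.assoc)
  have "{q \<in> ?R. cls p j q = y} = {q. (q, t) \<in> G' \<and> cls p j q = y}" by auto
  then show ?thesis using c d by (intro exI[of _ y]) (simp only:)
qed

text \<open>
  At levels finer than \<open>\<mu>\<close> the bush argument alone suffices: the crowd at distance \<open>p ^ (- j)\<close> and the
  number of tubes that two points at this distance share cancel.
\<close>

lemma richness_fine:
  assumes S2: "S' \<subseteq> S" "\<And>t. t \<in> S' \<Longrightarrow> 2 ^ e \<le> richness t"
      "\<And>t. t \<in> S' \<Longrightarrow> (richness t)\<^sup>2 \<le> (n + 1) * card (pairs_at j t)"
    and many: "real (card P') * M \<le> B ^ 3 * real (\<Sum>t\<in>S'. richness t)"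
    and j: "\<mu> \<le> j" "j \<le> n" and ne: "P' \<noteq> {}"
  shows "(2::real) ^ e \<le> B ^ 7"
proof -
  interpret c1: incidence_config p n P' S G' u "B * M" by (rule config_P1)
  let ?N = "\<lambda>q. {(q', t). cls p j q' = cls p j q \<and> (q, t) \<in> G' \<and> (q', t) \<in> G'
      \<and> (j = n \<or> \<not> int p ^ Suc j dvd fst (snd q) - fst (snd q'))}"
  have PM: "0 < real (card P') * M" using ne finite_P1 M_pos by (simp add: card_gt_0_iff)
  have fS: "finite S'" using finite_subset[OF S2(1) finite_S] .
  have fN: "finite (?N q)" for q
    by (rule finite_subset[of _ "P' \<times> S"]) (use G1_sub finite_P1 finite_S in auto)
  have "(\<lambda>(t, q, q'). (q, q', t)) ` Sigma S' (pairs_at j) \<subseteq> Sigma P' ?N"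
    using G1_sub by (auto simp: pairs_at_def)
  then have "card ((\<lambda>(t, q, q'). (q, q', t)) ` Sigma S' (pairs_at j)) \<le> card (Sigma P' ?N)"
    using finite_P1 fN by (intro card_mono) auto
  moreover have "inj_on (\<lambda>(t, q, q'). (q, q', t)) (Sigma S' (pairs_at j))" by (rule inj_onI) auto
  ultimately have "card (Sigma S' (pairs_at j)) \<le> card (Sigma P' ?N)" by (simp only: card_image)
  then have sum_le: "(\<Sum>t\<in>S'. card (pairs_at j t)) \<le> (\<Sum>q\<in>P'. card (?N q))"
    using fS finite_P1 finite_pairs_at fN by simp
  have row: "real (card (?N q)) \<le> B ^ 3 * M" if q: "q \<in> P'" for q
  proof -
    have "real (card (?N q)) \<le> B ^ 2 / u ^ (n - j) * (B * M * u ^ (n - j))"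
      by (rule c1.card_bush_at[OF q j(2) fine_P1[OF q j]])
    also have "\<dots> = B ^ 3 * M" using u_pos by (simp add: power2_eq_square power3_eq_cube)
    finally show ?thesis .
  qed
  have "2 ^ e * (real (card P') * M) \<le> 2 ^ e * (B ^ 3 * real (\<Sum>t\<in>S'. richness t))"
    using many by (rule mult_left_mono) simp
  also have "\<dots> = B ^ 3 * (\<Sum>t\<in>S'. 2 ^ e * real (richness t))" by (simp add: sum_distrib_left mult_ac)
  also have "\<dots> \<le> B ^ 3 * (\<Sum>t\<in>S'. real ((n + 1) * card (pairs_at j t)))"
  proof (rule mult_left_mono[OF sum_mono])
    fix t assume t: "t \<in> S'"
    have "2 ^ e * richness t \<le> richness t * richness t" using S2(2)[OF t] by simp
    also have "\<dots> \<le> (n + 1) * card (pairs_at j t)" using S2(3)[OF t] by (simp only: power2_eq_square)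
    finally have "real (2 ^ e * richness t) \<le> real ((n + 1) * card (pairs_at j t))" by (simp only: of_nat_le_iff)
    then show "2 ^ e * real (richness t) \<le> real ((n + 1) * card (pairs_at j t))" by simp
  qed (use B_pos in simp)
  also have "\<dots> = B ^ 3 * (real (n + 1) * real (\<Sum>t\<in>S'. card (pairs_at j t)))"
    by (simp only: of_nat_sum of_nat_mult sum_distrib_left)
  also have "\<dots> \<le> B ^ 3 * (B * (real (card P') * (B ^ 3 * M)))"
  proof (intro mult_left_mono mult_mono)
    have "real (\<Sum>t\<in>S'. card (pairs_at j t)) \<le> real (\<Sum>q\<in>P'. card (?N q))"
      using sum_le by (simp only: of_nat_le_iff)
    also have "\<dots> \<le> (\<Sum>q\<in>P'. B ^ 3 * M)" unfolding of_nat_sum by (rule sum_mono[OF row])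
    finally show "real (\<Sum>t\<in>S'. card (pairs_at j t)) \<le> real (card P') * (B ^ 3 * M)" by simp
  qed (use B_pos depth_le in \<open>simp_all add: sum_nonneg\<close>)
  also have "\<dots> = B ^ 7 * (real (card P') * M)" by (simp add: eval_nat_numeral mult_ac)
  finally show ?thesis using PM by (rule mult_right_le_imp_le)
qed


text \<open>
  After rescaling a cell of level \<open>j\<close>, the quantities \<open>n\<close>, \<open>\<mu>\<close>, \<open>R0\<close> become \<open>n - j\<close>, \<open>\<mu> - j\<close>, \<open>R0 / p ^ j\<close>, and
  both bounds on the crowds keep their form.  Pairs at distance exactly \<open>p ^ (- j)\<close> become pairs at
  distance \<open>1\<close>.  The fourth power of \<open>B\<close> absorbs the pigeonholing.
\<close>

lemma localised_config:
  assumes S2: "S' \<subseteq> S" "\<And>t. t \<in> S' \<Longrightarrow> 2 ^ e \<le> richness t" "\<And>t. t \<in> S' \<Longrightarrow> richness t < 2 * 2 ^ e"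
    and D: "\<And>t. t \<in> S' \<Longrightarrow> richness t \<le> (n + 1) * card {q. (q, t) \<in> G' \<and> cls p j q = D t}"
      "\<And>t. t \<in> S' \<Longrightarrow> (richness t)\<^sup>2 \<le> (n + 1)\<^sup>2 * card {(q, q') \<in> pairs_at j t. cls p j q = D t}"
    and many: "real (card P') * M \<le> B ^ 3 * real (\<Sum>t\<in>S'. richness t)"
    and j: "j < \<mu>" and ne: "P' \<noteq> {}"
  shows "spread_config p (n - j) (local_point p j ` P') ((\<lambda>t. local_tube p j (D t) t) ` S')
    ((\<lambda>(q, t). (local_point p j q, local_tube p j (D t) t)) ` {(q, t) \<in> G'. t \<in> S' \<and> cls p j q = D t})
    u (B ^ 4) M (\<mu> - j) k L (R0 / real p ^ j) (2 ^ e / real (n + 1))"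
    (is "spread_config p ?n ?P ?S ?G u ?B M ?\<mu> k L ?R ?r")
proof -
  let ?l = "local_point p j" and ?f = "\<lambda>t. local_tube p j (D t) t"
  let ?H = "{(q, t) \<in> G'. t \<in> S' \<and> cls p j q = D t}"
  let ?row = "\<lambda>t. {q. (q, t) \<in> G' \<and> cls p j q = D t}"
  have \<mu>n: "\<mu> \<le> n" using mu_le ne by simp
  have jn: "j \<le> n" using j \<mu>n by simp
  have fS2: "finite S'" using finite_subset[OF S2(1) finite_S] .
  have n1: "0 < real (n + 1)" by simp
  have pp: "0 < real p ^ i" for i using p_pos by simp
  have un: "0 < u ^ i" for i using u_pos by simp
  have lp: "?l q = ?l q' \<longleftrightarrow> q = q'" for q q' using inj_local_point[of p j] by (auto dest: injD)
  have row_ne: "\<exists>q. (q, t) \<in> G' \<and> cls p j q = D t" if t: "t \<in> S'" for t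
  proof (rule ccontr)
    assume "\<not> ?thesis"
    then have e: "?row t = {}" by blast
    have "richness t \<le> 0" using D(1)[OF t] unfolding e by simp
    then show False using S2(2)[OF t] by simp
  qed
  have f_inj: "t = t'" if tt: "t \<in> S'" "t' \<in> S'" "?f t = ?f t'" for t t'
  proof -
    obtain q q' where "(q, t) \<in> G'" "cls p j q = D t" "(q', t') \<in> G'" "cls p j q' = D t'"
      using row_ne[OF tt(1)] row_ne[OF tt(2)] by blast
    then show ?thesis using local_tube_inj[OF G1_inc G1_inc jn] tt(3) by metis
  qed
  have memG: "\<exists>q t. (q, t) \<in> G' \<and> t \<in> S' \<and> cls p j q = D t \<and> a = ?l q \<and> b = ?f t"
    if ab: "(a, b) \<in> ?G" for a b
  proof -
    obtain z where z: "(a, b) = (\<lambda>(q, t). (?l q, ?f t)) z" "z \<in> ?H" using ab by (rule imageE)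
    obtain q t where qt: "z = (q, t)" by (rule prod.exhaust)
    show ?thesis using z unfolding qt by (intro exI[of _ q] exI[of _ t]) simp
  qed
  have Gmem: "(?l q, ?f t) \<in> ?G" if "(q, t) \<in> G'" "t \<in> S'" "cls p j q = D t" for q t
    by (rule rev_image_eqI[of "(q, t)"]) (use that in simp_all)
  have inG: "(?l q, ?f t) \<in> ?G \<longleftrightarrow> (q, t) \<in> G' \<and> cls p j q = D t" if "t \<in> S'" for q t
  proof
    assume "(?l q, ?f t) \<in> ?G"
    then obtain q' t' where h: "(q', t') \<in> G'" "t' \<in> S'" "cls p j q' = D t'" "?l q = ?l q'" "?f t = ?f t'"
      using memG by blast
    have "q = q'" "t = t'" using h lp f_inj[OF that h(2,5)] by blast+
    then show "(q, t) \<in> G' \<and> cls p j q = D t" using h by simp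
  next
    assume "(q, t) \<in> G' \<and> cls p j q = D t"
    then show "(?l q, ?f t) \<in> ?G" using that Gmem by blast
  qed
  have row_eq: "{q'. (q', ?f t) \<in> ?G} = ?l ` ?row t" if "t \<in> S'" for t
  proof
    show "{q'. (q', ?f t) \<in> ?G} \<subseteq> ?l ` ?row t"
    proof
      fix q' assume "q' \<in> {q'. (q', ?f t) \<in> ?G}"
      then have h: "(q', ?f t) \<in> ?G" by simp
      then obtain q where "q' = ?l q" using memG by blast
      then show "q' \<in> ?l ` ?row t" using h inG[OF that] by blast
    qed
    show "?l ` ?row t \<subseteq> {q'. (q', ?f t) \<in> ?G}" using inG[OF that] by blast
  qed
  have row_card: "card {q'. (q', ?f t) \<in> ?G} = card (?row t)" if "t \<in> S'" for t
    unfolding row_eq[OF that] by (intro card_image inj_on_subset[OF inj_local_point]) simp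
  have Gsub: "?G \<subseteq> ?P \<times> ?S"
  proof
    fix z assume z: "z \<in> ?G"
    obtain a b where ab: "z = (a, b)" by (rule prod.exhaust)
    show "z \<in> ?P \<times> ?S" using memG[of a b] z G1_sub unfolding ab by blast
  qed
  have B4: "B ^ i \<le> ?B" if "i \<le> 4" for i using that B_ge_1 by (intro power_increasing) auto
  have BB: "B \<le> ?B" using B4[of 1] by simp
  have crowd_eq: "crowd p m ?P (?l q) = crowd p (j + m) P' q" for m q
    by (rule crowd_local_point[OF p_pos])
  show ?thesis
  proof (intro spread_config.intro incidence_config.intro spread_config_axioms.intro)
    show "prime p" "finite ?P" "finite ?S" "?G \<subseteq> ?P \<times> ?S" "0 < u" "u \<le> 1"
      using prime_p finite_P1 fS2 Gsub u_pos u_le by simp_all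
    show "inc p ?n q t" if h: "(q, t) \<in> ?G" for q t
    proof -
      obtain q' t' where q: "(q', t') \<in> G'" "cls p j q' = D t'" "q = ?l q'" "t = ?f t'" using memG[OF h] by blast
      then show ?thesis using inc_local[OF p_pos G1_inc[OF q(1)] jn] by simp
    qed
    show "real (card {t. (q, t) \<in> ?G \<and> int p ^ m dvd fst (snd t) - \<alpha>}) \<le> B ^ 4 * M * u ^ m"
      if h: "q \<in> ?P" "m \<le> ?n" for q m \<alpha>
    proof -
      obtain q' where q: "q' \<in> P'" "q = ?l q'" using h(1) by blast
      let ?F = "{t. (q', t) \<in> G' \<and> int p ^ m dvd fst (snd t) - \<alpha>}"
      have fF: "finite ?F" by (rule finite_subset[OF _ finite_S]) (use G1_sub in blast)
      have sl: "fst (snd (?f t)) = fst (snd t)" for t by (simp add: local_tube_def)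
      have "{t. (q, t) \<in> ?G \<and> int p ^ m dvd fst (snd t) - \<alpha>} \<subseteq> ?f ` ?F"
      proof
        fix t assume t: "t \<in> {t. (q, t) \<in> ?G \<and> int p ^ m dvd fst (snd t) - \<alpha>}"
        then obtain q'' t' where t': "(q'', t') \<in> G'" "?l q'' = ?l q'" "t = ?f t'" using memG[of q t] q(2) by blast
        have "q'' = q'" using t'(2) lp by blast
        moreover have "int p ^ m dvd fst (snd t) - \<alpha>" using t by blast
        then have "int p ^ m dvd fst (snd t') - \<alpha>" unfolding t'(3) sl .
        ultimately have "t' \<in> ?F" using t'(1) by blast
        then show "t \<in> ?f ` ?F" unfolding t'(3) by (rule imageI)
      qed
      then have "card {t. (q, t) \<in> ?G \<and> int p ^ m dvd fst (snd t) - \<alpha>} \<le> card (?f ` ?F)"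
        using fF by (intro card_mono) auto
      also have "\<dots> \<le> card ?F" using fF by (rule card_image_le)
      also have "real \<dots> \<le> B * M * u ^ m" using fan_G1[OF q(1)] h(2) by simp
      also have "\<dots> \<le> B ^ 4 * M * u ^ m" using BB M_pos un by (intro mult_right_mono) (auto simp: less_imp_le)
      finally show ?thesis by simp
    qed
    show "?\<mu> \<le> ?n" using \<mu>n by simp
    show "8 \<le> ?B" "real p ^ k \<le> ?B" "0 < k" using B_ge step_le step_pos BB by simp_all
    show "real (?n + 1) \<le> ?B" using depth_le BB by simp
    have "?\<mu> div k \<le> n div k" using \<mu>n by (intro div_le_mono) simp
    then show "2 ^ (?\<mu> div k) \<le> ?B"
      using halving_le BB power_increasing[of "?\<mu> div k" "n div k" "2::real"] by linarith
    show "real L ^ (?\<mu> div k + 1) \<le> ?B"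
    proof (cases "L = 0")
      case True
      then show ?thesis using B_pos by simp
    next
      case False
      then have "real L ^ (?\<mu> div k + 1) \<le> real L ^ (n div k + 1)"
        using \<open>?\<mu> div k \<le> n div k\<close> by (intro power_increasing) auto
      then show ?thesis using dyadic_le BB by linarith
    qed
    have "card ?S \<le> card S" using card_image_le[OF fS2, of ?f] card_mono[OF finite_S S2(1)] by linarith
    then show "card ?S < 2 ^ L" using card_S by linarith
    show "0 < M" "0 < ?R" "0 < ?r" "?P \<noteq> {}" using M_pos R0_pos pp ne by simp_all
    show "real (crowd p m ?P q) \<le> ?B * max (?R / real p ^ m) (u ^ ?n * ?R\<^sup>2 / (real p ^ (2 * m) * u ^ m))"
      if h: "q \<in> ?P" "m \<le> ?\<mu>" for q m
    proof -
      obtain q' where q: "q' \<in> P'" "q = ?l q'" using h(1) by blast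
      have e1: "?R / real p ^ m = R0 / real p ^ (j + m)" by (simp add: power_add)
      have "u ^ ?n * ?R\<^sup>2 = u ^ ?n * (real (card P) / (u ^ ?n * u ^ j)) / real p ^ (2 * j)"
        using jn by (simp add: power_divide R0_sq flip: power_add power_mult) (simp add: mult.commute)
      also have "\<dots> = real (card P) / (u ^ j * real p ^ (2 * j))" using u_pos by simp
      finally have "u ^ ?n * ?R\<^sup>2 / (real p ^ (2 * m) * u ^ m)
          = real (card P) / ((real p ^ (2 * j) * real p ^ (2 * m)) * (u ^ j * u ^ m))" by (simp add: mult_ac)
      also have "\<dots> = real (card P) / (real p ^ (2 * (j + m)) * u ^ (j + m))"
        by (simp add: distrib_left flip: power_add)
      finally have e2: "u ^ ?n * ?R\<^sup>2 / (real p ^ (2 * m) * u ^ m)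
          = real (card P) / (real p ^ (2 * (j + m)) * u ^ (j + m))" .
      have m: "max (R0 / real p ^ (j + m)) (real (card P) / (real p ^ (2 * (j + m)) * u ^ (j + m))) \<ge> 0"
        using R0_pos by (simp add: le_max_iff_disj)
      have "real (crowd p m ?P q) \<le> B ^ 2 * max (R0 / real p ^ (j + m)) (real (card P) / (real p ^ (2 * (j + m)) * u ^ (j + m)))"
        unfolding q(2) crowd_eq using h(2) j by (intro coarse_P1[OF q(1)]) simp
      also have "\<dots> \<le> ?B * max (R0 / real p ^ (j + m)) (real (card P) / (real p ^ (2 * (j + m)) * u ^ (j + m)))"
        using B4[of 2] m by (intro mult_right_mono) auto
      finally show ?thesis unfolding e1 e2 .
    qed
    show "?R / real p ^ ?\<mu> \<le> ?B * real (crowd p ?\<mu> ?P q)" if h: "q \<in> ?P" for q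
    proof -
      obtain q' where q: "q' \<in> P'" "q = ?l q'" using h by blast
      have "?R / real p ^ ?\<mu> = R0 / real p ^ \<mu>" using j by (simp flip: power_add)
      also have "\<dots> \<le> B * real (crowd p \<mu> P' q')" by (rule at_mu_P1[OF q(1)])
      also have "\<dots> \<le> ?B * real (crowd p \<mu> P' q')" using BB by (intro mult_right_mono) auto
      finally show ?thesis unfolding q(2) crowd_eq using j by simp
    qed
    show "real (crowd p m ?P q) \<le> ?B / u ^ (?n - m)" if h: "q \<in> ?P" "?\<mu> \<le> m" "m \<le> ?n" for q m
    proof -
      obtain q' where q: "q' \<in> P'" "q = ?l q'" using h by blast
      have "real (crowd p (j + m) P' q') \<le> B ^ 2 / u ^ (n - (j + m))"
        by (rule fine_P1[OF q(1)]) (use h j jn in auto)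
      also have "\<dots> \<le> ?B / u ^ (n - (j + m))" using B4[of 2] un by (intro divide_right_mono) (auto simp: less_imp_le)
      finally show ?thesis unfolding q(2) crowd_eq by simp
    qed
    show "?r \<le> real (card {q. (q, t) \<in> ?G})" if h: "t \<in> ?S" for t
    proof -
      obtain t' where t: "t' \<in> S'" "t = ?f t'" using h by blast
      have "2 ^ e \<le> (n + 1) * card (?row t')" using S2(2)[OF t(1)] D(1)[OF t(1)] by linarith
      then have "real (2 ^ e) \<le> real ((n + 1) * card (?row t'))" by (simp only: of_nat_le_iff)
      then have "2 ^ e \<le> real (n + 1) * real (card (?row t'))" by (simp only: of_nat_mult) simp
      then have "?r \<le> real (card (?row t'))" using n1 by (simp add: divide_le_eq mult.commute)
      then show ?thesis unfolding t(2) row_card[OF t(1)] .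
    qed
    show "real (card {q. (q, t) \<in> ?G}) \<le> ?B * ?r" if h: "t \<in> ?S" for t
    proof -
      obtain t' where t: "t' \<in> S'" "t = ?f t'" using h by blast
      have "card (?row t') \<le> richness t'" unfolding richness_def
        using finite_row_G1[where Q = "\<lambda>_. True"] by (intro card_mono) auto
      then have "real (card (?row t')) \<le> real (2 * 2 ^ e)" using S2(3)[OF t(1)] by (simp only: of_nat_le_iff)
      also have "\<dots> = (2 * real (n + 1)) * ?r"
      proof -
        have c: "(2 * N) * (E / N) = 2 * E" if "0 < N" for N E :: real using that by simp
        show ?thesis unfolding c[OF n1] by simp
      qed
      also have "\<dots> \<le> ?B * ?r"
      proof (rule mult_right_mono)
        have "2 * real (n + 1) \<le> B * B" using depth_le B_ge by (intro mult_mono) auto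
        then show "2 * real (n + 1) \<le> ?B" using B4[of 2] by (simp add: power2_eq_square)
      qed simp
      finally show ?thesis unfolding t(2) row_card[OF t(1)] .
    qed
    show "?r\<^sup>2 / ?B \<le> real (card {(q, q'). (q, t) \<in> ?G \<and> (q', t) \<in> ?G \<and> \<not> int p dvd fst (snd q) - fst (snd q')})"
      if h: "t \<in> ?S" for t
    proof -
      obtain t' where t: "t' \<in> S'" "t = ?f t'" using h by blast
      let ?X = "{(q, q') \<in> pairs_at j t'. cls p j q = D t'}"
      let ?Y = "{(q, q'). (q, t) \<in> ?G \<and> (q', t) \<in> ?G \<and> \<not> int p dvd fst (snd q) - fst (snd q')}"
      have "map_prod ?l ?l ` ?X \<subseteq> ?Y"
      proof
        fix z assume "z \<in> map_prod ?l ?l ` ?X"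
        then obtain q q' where z: "z = (?l q, ?l q')" "(q, q') \<in> pairs_at j t'" "cls p j q = D t'" by auto
        have g: "(q, t') \<in> G'" "(q', t') \<in> G'" "cls p j q' = cls p j q"
          "\<not> int p ^ Suc j dvd fst (snd q) - fst (snd q')"
          using z(2) j \<mu>n by (auto simp: pairs_at_def)
        have "int p ^ j dvd fst (snd q) - fst (snd q')" using g(3)[symmetric] unfolding cls_eq_iff by blast
        then have "\<not> int p dvd fst (snd (?l q)) - fst (snd (?l q'))"
          using dvd_div_diff_iff[OF p_pos, of j "fst (snd q)" "fst (snd q')" 1] g(4) by (simp add: local_point_def)
        then show "z \<in> ?Y" using inG[OF t(1), of q] inG[OF t(1), of q'] g z(3) by (simp add: z(1) t(2))
      qed
      moreover have "finite ?Y"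
        by (rule finite_subset[of _ "?P \<times> ?P"]) (use Gsub finite_P1 in auto)
      ultimately have "card (map_prod ?l ?l ` ?X) \<le> card ?Y" by (rule card_mono[rotated])
      moreover have "card (map_prod ?l ?l ` ?X) = card ?X"
        by (rule card_image) (intro inj_on_subset[OF map_prod_inj_on[OF inj_local_point inj_local_point]], simp)
      ultimately have XY: "real (card ?X) \<le> real (card ?Y)" by simp
      have "(2 ^ e)\<^sup>2 \<le> (richness t')\<^sup>2" using S2(2)[OF t(1)] by (rule power_mono) simp
      also have "\<dots> \<le> (n + 1)\<^sup>2 * card ?X" by (rule D(2)[OF t(1)])
      finally have "real ((2 ^ e)\<^sup>2) \<le> real ((n + 1)\<^sup>2 * card ?X)" by (simp only: of_nat_le_iff)
      then have "(2 ^ e)\<^sup>2 \<le> (real (n + 1))\<^sup>2 * real (card ?X)" by simp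
      then have "?r\<^sup>2 \<le> real (card ?X)"
        unfolding power_divide using n1 by (simp add: divide_le_eq mult.commute)
      moreover have "?r\<^sup>2 / ?B \<le> ?r\<^sup>2 / 1"
        using B4[of 0] by (intro divide_left_mono) auto
      ultimately show ?thesis using XY by linarith
    qed
    show "real (card ?P) * M \<le> ?B * real (card ?G)"
    proof -
      have Heq: "?H = prod.swap ` Sigma S' ?row" by force
      have "inj_on (\<lambda>(q, t). (?l q, ?f t)) ?H"
      proof (rule inj_onI)
        fix z z' assume z: "z \<in> ?H" "z' \<in> ?H" "(\<lambda>(q, t). (?l q, ?f t)) z = (\<lambda>(q, t). (?l q, ?f t)) z'"
        obtain q t q' t' where zz: "z = (q, t)" "z' = (q', t')" using prod.exhaust by metis
        have h: "t \<in> S'" "t' \<in> S'" "?l q = ?l q'" "?f t = ?f t'"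
          using z unfolding zz by (simp_all only: mem_Collect_eq prod.case prod.inject)
        then show "z = z'" unfolding zz using lp[of q q'] f_inj[OF h(1,2,4)] by blast
      qed
      then have "card ?G = card ?H" by (rule card_image)
      also have "\<dots> = card (Sigma S' ?row)" unfolding Heq by (rule card_image) (rule inj_onI, auto)
      also have "\<dots> = (\<Sum>t\<in>S'. card (?row t))" using fS2 finite_row_G1 by (intro card_SigmaI) auto
      finally have cG: "card ?G = (\<Sum>t\<in>S'. card (?row t))" .
      have "(\<Sum>t\<in>S'. richness t) \<le> (\<Sum>t\<in>S'. (n + 1) * card (?row t))" by (rule sum_mono[OF D(1)])
      also have "\<dots> = (n + 1) * card ?G" unfolding cG sum_distrib_left ..
      finally have "real (\<Sum>t\<in>S'. richness t) \<le> real ((n + 1) * card ?G)" by (simp only: of_nat_le_iff)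
      also have "\<dots> = real (n + 1) * real (card ?G)" by (simp only: of_nat_mult)
      also have "\<dots> \<le> B * real (card ?G)" using depth_le by (rule mult_right_mono) simp
      finally have "B ^ 3 * real (\<Sum>t\<in>S'. richness t) \<le> B ^ 3 * (B * real (card ?G))"
        using B_pos by (intro mult_left_mono) auto
      also have "\<dots> = ?B * real (card ?G)" by (simp add: eval_nat_numeral)
      finally have "real (card P') * M \<le> ?B * real (card ?G)" using many by linarith
      moreover have "card ?P = card P'" by (intro card_image inj_on_subset[OF inj_local_point]) simp
      ultimately show ?thesis by simp
    qed
  qed
qed

text \<open>
  For \<open>j \<ge> \<mu>\<close> the bush argument gives bounded richness, and \<open>u ^ n R0\<close> is at least \<open>1 / B\<close>.  For \<open>j < \<mu>\<close> the
  localised configuration gives the target of the cell, \<open>u ^ (n - j) R0 / p ^ j\<close>, which is at most \<open>u ^ n R0\<close>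
  because \<open>p u \<ge> 1\<close>.
\<close>

lemma richness_level:
  assumes S2: "S' \<subseteq> S" "\<And>t. t \<in> S' \<Longrightarrow> 2 ^ e \<le> richness t" "\<And>t. t \<in> S' \<Longrightarrow> richness t < 2 * 2 ^ e"
      "\<And>t. t \<in> S' \<Longrightarrow> (richness t)\<^sup>2 \<le> (n + 1) * card (pairs_at j t)"
    and many: "real (card P') * M \<le> B ^ 3 * real (\<Sum>t\<in>S'. richness t)"
    and ne: "P' \<noteq> {}" and jn: "j \<le> n"
  shows "(2::real) ^ e \<le> B ^ 81 * (u ^ n * R0)"
proof (cases "\<mu> \<le> j")
  case True
  have a: "(2::real) ^ e \<le> B ^ 7" by (rule richness_fine[OF S2(1,2,4) many True jn ne])
  have uR: "0 < u ^ n * R0" using u_pos R0_pos by simp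
  have "(u ^ n * R0)\<^sup>2 = (u ^ n)\<^sup>2 * (real (card P) / u ^ n)" by (simp only: power_mult_distrib R0_sq)
  also have "\<dots> = real (card P) * u ^ n" using u_pos by (simp add: power2_eq_square)
  finally have "1\<^sup>2 \<le> B * (u ^ n * R0)\<^sup>2" using not_too_few by simp
  also have "\<dots> \<le> B\<^sup>2 * (u ^ n * R0)\<^sup>2"
    using B_ge_1 by (intro mult_right_mono) (auto simp: power2_eq_square)
  also have "\<dots> = (B * (u ^ n * R0))\<^sup>2" by (simp add: power_mult_distrib)
  finally have "1 \<le> B * (u ^ n * R0)" by (rule power2_le_imp_le) (use B_pos uR in simp)
  then have "B ^ 7 * 1 \<le> B ^ 7 * (B * (u ^ n * R0))" using B_pos by (intro mult_left_mono) auto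
  also have "\<dots> = B ^ 8 * (u ^ n * R0)" by (simp add: eval_nat_numeral)
  also have "\<dots> \<le> B ^ 81 * (u ^ n * R0)"
    using uR B_ge_1 by (intro mult_right_mono power_increasing) auto
  finally show ?thesis using a by simp
next
  case False
  have "\<exists>D. \<forall>t\<in>S'. richness t \<le> (n + 1) * card {q. (q, t) \<in> G' \<and> cls p j q = D t} \<and>
      (richness t)\<^sup>2 \<le> (n + 1)\<^sup>2 * card {(q, q') \<in> pairs_at j t. cls p j q = D t}"
  proof (rule bchoice, rule ballI, rule dominant_cell)
    fix t assume t: "t \<in> S'"
    have "0 < (2::nat) ^ e" by simp
    then show "0 < richness t" using S2(2)[OF t] by linarith
    show "(richness t)\<^sup>2 \<le> (n + 1) * card (pairs_at j t)" by (rule S2(4)[OF t])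
  qed
  then obtain D where D: "\<And>t. t \<in> S' \<Longrightarrow> richness t \<le> (n + 1) * card {q. (q, t) \<in> G' \<and> cls p j q = D t}"
      "\<And>t. t \<in> S' \<Longrightarrow> (richness t)\<^sup>2 \<le> (n + 1)\<^sup>2 * card {(q, q') \<in> pairs_at j t. cls p j q = D t}"
    by blast
  have j\<mu>: "j < \<mu>" using False by simp
  interpret loc: spread_config p "n - j" "local_point p j ` P'" "(\<lambda>t. local_tube p j (D t) t) ` S'"
    "(\<lambda>(q, t). (local_point p j q, local_tube p j (D t) t)) ` {(q, t) \<in> G'. t \<in> S' \<and> cls p j q = D t}"
    u "B ^ 4" M "\<mu> - j" k L "R0 / real p ^ j" "2 ^ e / real (n + 1)"
    by (rule localised_config[OF S2(1-3) D many j\<mu> ne])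
  have "2 ^ e / real (n + 1) \<le> (B ^ 4) ^ 20 * u ^ (n - j) * (R0 / real p ^ j)" by (rule loc.richness_le)
  also have "\<dots> = B ^ 80 * R0 * (u ^ (n - j) / real p ^ j)" by (simp flip: power_mult)
  also have "\<dots> \<le> B ^ 80 * R0 * u ^ n"
  proof (rule mult_left_mono)
    have "u ^ (n - j) * 1 \<le> u ^ (n - j) * (real p * u) ^ j"
      using u_pos pu by (intro mult_left_mono one_le_power) auto
    also have "\<dots> = u ^ n * real p ^ j" using jn by (simp add: power_mult_distrib flip: power_add)
    finally show "u ^ (n - j) / real p ^ j \<le> u ^ n" using p_pos by (simp add: divide_le_eq)
  qed (use B_pos R0_pos in simp)
  finally have "2 ^ e \<le> B ^ 80 * R0 * u ^ n * real (n + 1)" by (simp add: divide_le_eq)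
  also have "\<dots> \<le> B ^ 80 * R0 * u ^ n * B"
    using depth_le B_pos R0_pos u_pos by (intro mult_left_mono) auto
  also have "\<dots> = B ^ 81 * (u ^ n * R0)" by (simp add: eval_nat_numeral mult_ac)
  finally show ?thesis .
qed

end

context furstenberg_config
begin

text \<open>
  This is the bound \<open>M R0\<close> on the number of tubes, squared, with loss \<open>B ^ 86\<close>.
\<close>

theorem tubes_bound: "M\<^sup>2 * real (card P) \<le> B ^ 172 * u ^ n * (real (card S))\<^sup>2"
proof -
  obtain \<mu> where \<mu>: "card P \<le> (n + 1) * card {q \<in> P. critical_level q = \<mu>}"
    using weighted_pigeonhole[OF finite_P, of "n + 1" "\<lambda>m q. critical_level q = m" "\<lambda>_. 1"] critical_level_le
    by (auto simp: less_Suc_eq_le)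
  interpret l: leveled_config p n P S G u B M k L \<mu> ..
  have P1: "card P \<le> (n + 1) * card l.P'" using \<mu> by (simp add: l.P'_def)
  have ne: "l.P' \<noteq> {}" using P1 card_P_pos by auto
  obtain e j S' where jn: "j \<le> n" and S2: "S' \<subseteq> S" "\<And>t. t \<in> S' \<Longrightarrow> 2 ^ e \<le> l.richness t" "\<And>t. t \<in> S' \<Longrightarrow> l.richness t < 2 * 2 ^ e"
      "\<And>t. t \<in> S' \<Longrightarrow> (l.richness t)\<^sup>2 \<le> (n + 1) * card (l.pairs_at j t)"
    and many: "real (card l.P') * M \<le> B ^ 3 * real (\<Sum>t\<in>S'. l.richness t)"
    using l.select_tubes by blast
  have r: "(2::real) ^ e \<le> B ^ 81 * (u ^ n * R0)"
    by (rule l.richness_level[OF S2 many ne jn])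
  have uR: "0 < u ^ n * R0" using u_pos R0_pos by simp
  have "real (card P) * M \<le> real ((n + 1) * card l.P') * M"
    using P1 M_pos by (intro mult_right_mono of_nat_mono) auto
  also have "\<dots> = real (n + 1) * (real (card l.P') * M)" by (simp only: of_nat_mult mult.assoc)
  also have "\<dots> \<le> B * (B ^ 3 * real (\<Sum>t\<in>S'. l.richness t))"
    by (rule mult_mono[OF depth_le many]) (use M_pos B_pos in simp_all)
  also have "\<dots> \<le> B * (B ^ 3 * (real (card S) * (2 * (B ^ 81 * (u ^ n * R0)))))"
  proof (intro mult_left_mono)
    have "real (\<Sum>t\<in>S'. l.richness t) = (\<Sum>t\<in>S'. real (l.richness t))" by simp
    also have "\<dots> \<le> (\<Sum>t\<in>S'. 2 * (B ^ 81 * (u ^ n * R0)))"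
    proof (rule sum_mono)
      fix t assume "t \<in> S'"
      then have "real (l.richness t) \<le> real (2 * 2 ^ e)" using S2(3) by (simp only: of_nat_le_iff less_imp_le)
      also have "\<dots> = 2 * 2 ^ e" by simp
      finally show "real (l.richness t) \<le> 2 * (B ^ 81 * (u ^ n * R0))" using r by linarith
    qed
    also have "\<dots> = real (card S') * (2 * (B ^ 81 * (u ^ n * R0)))" by simp
    also have "\<dots> \<le> real (card S) * (2 * (B ^ 81 * (u ^ n * R0)))"
      using card_mono[OF finite_S S2(1)] uR B_pos by (intro mult_right_mono) auto
    finally show "real (\<Sum>t\<in>S'. l.richness t) \<le> real (card S) * (2 * (B ^ 81 * (u ^ n * R0)))" .
  qed (use B_pos in auto)
  also have "\<dots> = 2 * (B ^ 85 * (u ^ n * R0) * real (card S))" by (simp add: eval_nat_numeral mult_ac)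
  also have "\<dots> \<le> B * (B ^ 85 * (u ^ n * R0) * real (card S))"
    using B_ge uR B_pos by (intro mult_right_mono) auto
  also have "\<dots> = B ^ 86 * (u ^ n * R0) * real (card S)" by (simp add: eval_nat_numeral mult_ac)
  finally have "(real (card P) * M)\<^sup>2 \<le> (B ^ 86 * (u ^ n * R0) * real (card S))\<^sup>2"
    using M_pos by (intro power_mono) auto
  also have "\<dots> = B ^ 172 * ((u ^ n)\<^sup>2 * R0\<^sup>2) * (real (card S))\<^sup>2"
    by (simp add: power_mult_distrib flip: power_mult)
  also have "(u ^ n)\<^sup>2 * R0\<^sup>2 = u ^ n * real (card P)"
    unfolding R0_sq using u_pos by (simp add: power2_eq_square)
  finally have "real (card P) * (M\<^sup>2 * real (card P)) \<le> real (card P) * (B ^ 172 * u ^ n * (real (card S))\<^sup>2)"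
    by (simp add: power_mult_distrib power2_eq_square mult_ac)
  then show ?thesis using card_P_pos by simp
qed

end

section \<open>From cubes of p-adic integers to residues\<close>

text \<open>
  All points of a cube of side \<open>p ^ (- n)\<close> have the same residues modulo \<open>p ^ n\<close>; a single copy of the plane
  is used here.
\<close>

definition coords :: "nat \<Rightarrow> padic_plane_set \<Rightarrow> unit \<times> int \<times> int" where
  "coords n q = (let z = SOME z. z \<in> q in ((), fst z n, snd z n))"

locale padic_scale =
  fixes p n :: nat and \<delta> :: real
  assumes prime_p: "prime p" and \<delta>_eq: "\<delta> = real p powi (- int n)"
begin

lemma p_gt_1: "p > 1" using prime_p by (rule prime_gt_1_nat)

lemma cube_self: "x \<in> Zp_plane p \<Longrightarrow> x \<in> cube p x (real p powi (- int m))"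
  by (simp add: cube_eq[OF p_gt_1])

lemma coords_cube:
  assumes "x \<in> Zp_plane p"
  shows "coords n (cube p x \<delta>) = ((), fst x n, snd x n)"
proof -
  have "x \<in> cube p x \<delta>" unfolding \<delta>_eq using cube_self[OF assms] .
  then have "(SOME z. z \<in> cube p x \<delta>) \<in> cube p x \<delta>" by (rule someI)
  then show ?thesis unfolding \<delta>_eq cube_eq[OF p_gt_1 assms] by (simp add: coords_def Let_def)
qed

lemma cubesE:
  assumes "q \<in> cubes p \<delta>"
  obtains x where "x \<in> Zp_plane p" "q = cube p x \<delta>"
  using assms by (auto simp: cubes_def)

lemma coords_of_mem:
  assumes "q \<in> cubes p \<delta>" "z \<in> q"
  shows "coords n q = ((), fst z n, snd z n)"
proof -
  obtain x where x: "x \<in> Zp_plane p" "q = cube p x \<delta>" using assms(1) by (rule cubesE)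
  then show ?thesis using assms(2) coords_cube[OF x(1)] by (simp add: \<delta>_eq cube_eq[OF p_gt_1])
qed

lemma mem_iff_coords:
  assumes "q \<in> cubes p \<delta>"
  shows "z \<in> q \<longleftrightarrow> z \<in> Zp_plane p \<and> coords n q = ((), fst z n, snd z n)"
proof -
  obtain x where x: "x \<in> Zp_plane p" "q = cube p x \<delta>" using assms(1) by (rule cubesE)
  then show ?thesis using coords_cube[OF x(1)] by (auto simp: \<delta>_eq cube_eq[OF p_gt_1])
qed

lemma inj_coords: "inj_on (coords n) (cubes p \<delta>)"
  by (rule inj_onI) (auto simp: mem_iff_coords)

lemma cubes_nonempty: "q \<in> cubes p \<delta> \<Longrightarrow> \<exists>z. z \<in> q \<and> z \<in> Zp_plane p"
  using cube_self by (metis \<delta>_eq cubesE)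

lemma coords_image: "coords n ` cubes p \<delta> \<subseteq> {()} \<times> {0..<int p ^ n} \<times> {0..<int p ^ n}"
proof
  fix z assume "z \<in> coords n ` cubes p \<delta>"
  then obtain q where q: "q \<in> cubes p \<delta>" "z = coords n q" by blast
  obtain x where x: "x \<in> Zp_plane p" "q = cube p x \<delta>" using q(1) by (rule cubesE)
  have c: "fst x \<in> carrier (Zp p)" "snd x \<in> carrier (Zp p)" using x(1) by (auto simp: Zp_plane_def)
  show "z \<in> {()} \<times> {0..<int p ^ n} \<times> {0..<int p ^ n}"
    unfolding q(2) x(2) coords_cube[OF x(1)]
    using Zp_carrierD(1,2)[OF c(1), of n] Zp_carrierD(1,2)[OF c(2), of n] by simp
qed

lemma finite_cubes: "finite (cubes p \<delta>)"
  by (rule inj_on_finite[OF inj_coords coords_image]) simp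

lemma card_cubes_le: "card (cubes p \<delta>) \<le> p ^ (2 * n)"
proof -
  have "card (cubes p \<delta>) \<le> card ({()} \<times> {0..<int p ^ n} \<times> {0..<int p ^ n})"
    by (rule card_inj_on_le[OF inj_coords coords_image]) simp
  also have "\<dots> = p ^ (2 * n)" by (simp add: card_cartesian_product nat_power_eq mult_2 power_add)
  finally show ?thesis .
qed

lemma inc_of_subset_tube:
  assumes "q \<in> cubes p \<delta>" "q' \<in> cubes p \<delta>" "q \<subseteq> tube p q'"
  shows "inc p n (coords n q) (coords n q')"
proof -
  obtain z where z: "z \<in> q" "z \<in> Zp_plane p" using cubes_nonempty[OF assms(1)] by blast
  then obtain w where w: "w \<in> q'" "z \<in> line p w" using assms(3) by (auto simp: tube_def)
  then have "snd z = fst w \<otimes>\<^bsub>Zp p\<^esub> fst z \<oplus>\<^bsub>Zp p\<^esub> snd w" by (auto simp: line_def)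
  from fun_cong[OF this, of n]
  have e: "snd z n = ((fst w n * fst z n) mod int p ^ n + snd w n) mod int p ^ n" by (simp add: Zp_def)
  have "snd (z) n mod int p ^ n = (fst w n * fst z n + snd w n) mod int p ^ n"
    unfolding e by (simp add: mod_simps)
  then have "int p ^ n dvd fst w n * fst z n + snd w n - snd z n"
    by (metis mod_eq_dvd_iff)
  then show ?thesis
    by (simp add: inc_def coords_of_mem[OF assms(1) z(1)] coords_of_mem[OF assms(2) w(1)])
qed

lemma subset_cube_of_cls:
  assumes "q \<in> cubes p \<delta>" "q\<^sub>0 \<in> cubes p \<delta>" "x\<^sub>0 \<in> q\<^sub>0" "m \<le> n"
    and "cls p m (coords n q) = cls p m (coords n q\<^sub>0)"
  shows "q \<subseteq> cube p x\<^sub>0 (real p powi (- int m))"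
proof
  fix z assume z: "z \<in> q"
  have zp: "z \<in> Zp_plane p" "x\<^sub>0 \<in> Zp_plane p" using z assms mem_iff_coords by blast+
  have red: "fst y m = fst y n mod int p ^ m \<and> snd y m = snd y n mod int p ^ m" if "y \<in> Zp_plane p" for y
    using that Zp_mod_le[OF _ assms(4)] by (auto simp: Zp_plane_def)
  show "z \<in> cube p x\<^sub>0 (real p powi (- int m))"
    unfolding cube_eq[OF p_gt_1 zp(2)]
    using assms(5) red[OF zp(1)] red[OF zp(2)] zp(1)
    by (simp add: coords_of_mem[OF assms(1) z] coords_of_mem[OF assms(2,3)] cls_def)
qed

text \<open>
  Cubes of equal size are equal or disjoint.
\<close>

lemma cubes_meeting_Union:
  assumes "Q \<subseteq> cubes p \<delta>"
  shows "cubes_meeting p \<delta> (\<Union>Q) = Q"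
proof
  show "cubes_meeting p \<delta> (\<Union>Q) \<subseteq> Q"
  proof
    fix q assume "q \<in> cubes_meeting p \<delta> (\<Union>Q)"
    then obtain z q' where z: "q \<in> cubes p \<delta>" "z \<in> q" "z \<in> q'" "q' \<in> Q" by (auto simp: cubes_meeting_def)
    have qc': "q' \<in> cubes p \<delta>" using z(4) assms by blast
    have e: "coords n q = coords n q'" using coords_of_mem[OF z(1,2)] coords_of_mem[OF qc' z(3)] by simp
    have "q = q'" by (rule inj_onD[OF inj_coords e z(1) qc'])
    then show "q \<in> Q" using z(4) by simp
  qed
  show "Q \<subseteq> cubes_meeting p \<delta> (\<Union>Q)"
    using assms cubes_nonempty by (fastforce simp: cubes_meeting_def)
qed

lemma covering_number_ge:
  assumes "Q \<subseteq> cubes p \<delta>" "q\<^sub>0 \<in> cubes p \<delta>" "x\<^sub>0 \<in> q\<^sub>0" "m \<le> n"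
  shows "card {q \<in> Q. cls p m (coords n q) = cls p m (coords n q\<^sub>0)}
    \<le> covering_number p \<delta> (\<Union>Q \<inter> cube p x\<^sub>0 (real p powi (- int m)))"
  unfolding covering_number_def
proof (rule card_mono)
  show "finite (cubes_meeting p \<delta> (\<Union>Q \<inter> cube p x\<^sub>0 (real p powi (- int m))))"
    using finite_cubes by (simp add: cubes_meeting_def)
  show "{q \<in> Q. cls p m (coords n q) = cls p m (coords n q\<^sub>0)}
      \<subseteq> cubes_meeting p \<delta> (\<Union>Q \<inter> cube p x\<^sub>0 (real p powi (- int m)))"
  proof
    fix q assume q: "q \<in> {q \<in> Q. cls p m (coords n q) = cls p m (coords n q\<^sub>0)}"
    then have qc: "q \<in> cubes p \<delta>" using assms by blast
    then obtain z where "z \<in> q" using cubes_nonempty by blast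
    moreover have "q \<subseteq> cube p x\<^sub>0 (real p powi (- int m))"
      using subset_cube_of_cls[OF qc assms(2-4)] q by blast
    ultimately show "q \<in> cubes_meeting p \<delta> (\<Union>Q \<inter> cube p x\<^sub>0 (real p powi (- int m)))"
      using q qc by (auto simp: cubes_meeting_def)
  qed
qed

text \<open>
  The tubes with parameters in a cube of side \<open>p ^ (- m)\<close> are counted by the covering number that the
  \<open>(\<delta>, s)\<close>-condition bounds.
\<close>

lemma tube_family_fan:
  assumes "delta_set_tubes p \<delta> s C \<T>" "q\<^sub>0 \<in> cubes p \<delta>" "m \<le> n"
  shows "real (card {q \<in> cubes p \<delta>. tube p q \<in> \<T> \<and> cls p m (coords n q) = cls p m (coords n q\<^sub>0)})
    \<le> C * (real p powi (- int m)) powr s * real (card \<T>)"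
proof -
  obtain Q where Q: "Q \<subseteq> cubes p \<delta>" "\<T> = tube p ` Q" "delta_set p \<delta> s C (\<Union>Q)"
    using assms(1) by (auto simp: delta_set_tubes_def)
  have sc: "\<delta> \<in> scales p" by (auto simp: scales_def \<delta>_eq)
  have it: "inj_on (tube p) (cubes p \<delta>)" by (rule inj_on_tube[OF p_gt_1 sc])
  have "{q \<in> cubes p \<delta>. tube p q \<in> \<T> \<and> cls p m (coords n q) = cls p m (coords n q\<^sub>0)}
      = {q \<in> Q. cls p m (coords n q) = cls p m (coords n q\<^sub>0)}"
    using Q(1) inj_on_image_mem_iff[OF it _ Q(1)] unfolding Q(2) by blast
  moreover obtain x\<^sub>0 where x0: "x\<^sub>0 \<in> q\<^sub>0" "x\<^sub>0 \<in> Zp_plane p" using cubes_nonempty[OF assms(2)] by blast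
  ultimately have "real (card {q \<in> cubes p \<delta>. tube p q \<in> \<T> \<and> cls p m (coords n q) = cls p m (coords n q\<^sub>0)})
      \<le> real (covering_number p \<delta> (\<Union>Q \<inter> cube p x\<^sub>0 (real p powi (- int m))))"
    using covering_number_ge[OF Q(1) assms(2) x0(1) assms(3)] by simp
  also have "\<dots> \<le> C * (real p powi (- int m)) powr s * real (covering_number p \<delta> (\<Union>Q))"
  proof -
    have "real p powi (- int m) \<in> scales p" by (auto simp: scales_def)
    moreover have "\<delta> \<le> real p powi (- int m)" "real p powi (- int m) \<le> 1"
      using p_gt_1 assms(3) unfolding \<delta>_eq
      by (simp_all add: power_int_minus le_imp_inverse_le power_increasing inverse_le_1_iff)
    ultimately show ?thesis using Q(3) x0(2) by (simp add: delta_set_def)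
  qed
  also have "covering_number p \<delta> (\<Union>Q) = card \<T>"
    unfolding covering_number_def cubes_meeting_Union[OF Q(1)] Q(2)
    by (rule card_image[symmetric]) (rule inj_on_subset[OF it Q(1)])
  finally show ?thesis .
qed

lemma discretised_config:
  fixes \<P> \<T> :: "padic_plane_set set" and \<T>of M
  defines "P \<equiv> coords n ` \<P>" and "S \<equiv> coords n ` {q' \<in> cubes p \<delta>. tube p q' \<in> \<T>}"
    and "G \<equiv> {(v, w). \<exists>q\<in>\<P>. \<exists>q'\<in>cubes p \<delta>. tube p q' \<in> \<T>of q \<and> v = coords n q \<and> w = coords n q'}"
  assumes conf: "configuration p \<delta> \<P> \<T> \<T>of"
  shows "finite P" "finite S" "card P = card \<P>" "card S = card \<T>" "G \<subseteq> P \<times> S"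
    "(v, w) \<in> G \<Longrightarrow> inc p n v w"
    "q \<in> \<P> \<Longrightarrow> card {w. (coords n q, w) \<in> G} = card (\<T>of q)"
proof -
  have sub: "\<P> \<subseteq> cubes p \<delta>" "\<T> \<subseteq> tubes p \<delta>" and Tof: "\<And>q T. q \<in> \<P> \<Longrightarrow> T \<in> \<T>of q \<Longrightarrow> T \<in> \<T> \<and> q \<subseteq> T"
    using conf by (auto simp: configuration_def)
  have sc: "\<delta> \<in> scales p" by (auto simp: scales_def \<delta>_eq)
  have it: "inj_on (tube p) (cubes p \<delta>)" by (rule inj_on_tube[OF p_gt_1 sc])
  show "finite P" unfolding P_def using finite_subset[OF sub(1) finite_cubes] by simp
  show "finite S" unfolding S_def using finite_cubes by simp
  show "card P = card \<P>" unfolding P_def by (rule card_image) (rule inj_on_subset[OF inj_coords sub(1)])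
  have pre: "card (coords n ` {q' \<in> cubes p \<delta>. tube p q' \<in> \<U>}) = card \<U>" if "\<U> \<subseteq> tubes p \<delta>" for \<U>
  proof -
    have "tube p ` {q' \<in> cubes p \<delta>. tube p q' \<in> \<U>} = \<U>" using that by (auto simp: tubes_def)
    moreover have "card (tube p ` {q' \<in> cubes p \<delta>. tube p q' \<in> \<U>}) = card {q' \<in> cubes p \<delta>. tube p q' \<in> \<U>}"
      by (rule card_image) (rule inj_on_subset[OF it], blast)
    moreover have "card (coords n ` {q' \<in> cubes p \<delta>. tube p q' \<in> \<U>}) = card {q' \<in> cubes p \<delta>. tube p q' \<in> \<U>}"
      by (rule card_image) (rule inj_on_subset[OF inj_coords], blast)
    ultimately show ?thesis by simp
  qed
  show "card S = card \<T>" unfolding S_def by (rule pre[OF sub(2)])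
  show "G \<subseteq> P \<times> S" unfolding G_def P_def S_def using Tof by blast
  show "(v, w) \<in> G \<Longrightarrow> inc p n v w"
    unfolding G_def using inc_of_subset_tube sub(1) Tof by blast
  show "card {w. (coords n q, w) \<in> G} = card (\<T>of q)" if q: "q \<in> \<P>"
  proof -
    have "{w. (coords n q, w) \<in> G} = coords n ` {q' \<in> cubes p \<delta>. tube p q' \<in> \<T>of q}"
    proof
      show "{w. (coords n q, w) \<in> G} \<subseteq> coords n ` {q' \<in> cubes p \<delta>. tube p q' \<in> \<T>of q}"
      proof
      fix w assume "w \<in> {w. (coords n q, w) \<in> G}"
      then obtain q1 q' where h: "q1 \<in> \<P>" "q' \<in> cubes p \<delta>" "tube p q' \<in> \<T>of q1" "coords n q = coords n q1" "w = coords n q'"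
        by (auto simp: G_def)
      have "q = q1" by (rule inj_onD[OF inj_coords h(4)]) (use h(1) q sub(1) in blast)+
      then show "w \<in> coords n ` {q' \<in> cubes p \<delta>. tube p q' \<in> \<T>of q}" using h by blast
      qed
      show "coords n ` {q' \<in> cubes p \<delta>. tube p q' \<in> \<T>of q} \<subseteq> {w. (coords n q, w) \<in> G}"
        unfolding G_def using q by blast
    qed
    moreover have "\<T>of q \<subseteq> tubes p \<delta>" using Tof[OF q] sub(2) by blast
    ultimately show ?thesis using pre by simp
  qed
qed

text \<open>
  Tubes through \<open>q\<close> whose slopes agree modulo \<open>p ^ m\<close> have equal parameters modulo \<open>p ^ m\<close>, so they are counted
  by \<open>tube_family_fan\<close>.
\<close>

lemma discretised_fan:
  fixes \<P> :: "padic_plane_set set" and \<T>of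
  defines "G \<equiv> {(v, w). \<exists>q\<in>\<P>. \<exists>q'\<in>cubes p \<delta>. tube p q' \<in> \<T>of q \<and> v = coords n q \<and> w = coords n q'}"
  assumes sub: "\<P> \<subseteq> cubes p \<delta>" and on: "\<And>q T. q \<in> \<P> \<Longrightarrow> T \<in> \<T>of q \<Longrightarrow> q \<subseteq> T"
    and q: "q \<in> \<P>" and ds: "delta_set_tubes p \<delta> s C (\<T>of q)" and m: "m \<le> n" and C: "0 \<le> C"
  shows "real (card {w. (coords n q, w) \<in> G \<and> int p ^ m dvd fst (snd w) - \<alpha>})
    \<le> C * (real p powi (- int m)) powr s * real (card (\<T>of q))"
proof (cases "{w. (coords n q, w) \<in> G \<and> int p ^ m dvd fst (snd w) - \<alpha>} = {}")
  case True
  show ?thesis unfolding True using C by simp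
next
  case False
  have G_D: "\<exists>q'\<in>cubes p \<delta>. tube p q' \<in> \<T>of q \<and> w = coords n q'" if w: "(coords n q, w) \<in> G" for w
  proof -
    obtain q1 q' where h: "q1 \<in> \<P>" "q' \<in> cubes p \<delta>" "tube p q' \<in> \<T>of q1" "coords n q = coords n q1" "w = coords n q'"
      using w by (auto simp: G_def)
    have "q = q1" by (rule inj_onD[OF inj_coords h(4)]) (use h(1) q sub in blast)+
    then show ?thesis using h by blast
  qed
  have qc: "q \<in> cubes p \<delta>" using q sub by blast
  obtain w\<^sub>0 where w0: "(coords n q, w\<^sub>0) \<in> G" "int p ^ m dvd fst (snd w\<^sub>0) - \<alpha>" using False by blast
  obtain q\<^sub>0 where q0: "q\<^sub>0 \<in> cubes p \<delta>" "tube p q\<^sub>0 \<in> \<T>of q" "w\<^sub>0 = coords n q\<^sub>0" using G_D[OF w0(1)] by blast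
  let ?Q = "{q' \<in> cubes p \<delta>. tube p q' \<in> \<T>of q \<and> cls p m (coords n q') = cls p m (coords n q\<^sub>0)}"
  have "{w. (coords n q, w) \<in> G \<and> int p ^ m dvd fst (snd w) - \<alpha>} \<subseteq> coords n ` ?Q"
  proof
    fix w assume w: "w \<in> {w. (coords n q, w) \<in> G \<and> int p ^ m dvd fst (snd w) - \<alpha>}"
    then obtain q' where q': "q' \<in> cubes p \<delta>" "tube p q' \<in> \<T>of q" "w = coords n q'" using G_D by blast
    have i: "inc p m (coords n q) w" "inc p m (coords n q) w\<^sub>0"
      using inc_mono[OF inc_of_subset_tube[OF qc q'(1) on[OF q q'(2)]] m]
        inc_mono[OF inc_of_subset_tube[OF qc q0(1) on[OF q q0(2)]] m] q'(3) q0(3) by simp_all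
    have "int p ^ m dvd fst (snd w) - \<alpha>" using w by blast
    from dvd_diff[OF this w0(2)] have a: "int p ^ m dvd fst (snd w) - fst (snd w\<^sub>0)" by simp
    obtain x y where xy: "snd (coords n q) = (x, y)" by (rule prod.exhaust)
    have b1: "int p ^ m dvd fst (snd w) * x + snd (snd w) - y" and b2: "int p ^ m dvd fst (snd w\<^sub>0) * x + snd (snd w\<^sub>0) - y"
      using i by (simp_all add: inc_def xy)
    have "int p ^ m dvd ((fst (snd w) * x + snd (snd w) - y) - (fst (snd w\<^sub>0) * x + snd (snd w\<^sub>0) - y))
        - (fst (snd w) - fst (snd w\<^sub>0)) * x"
      by (rule dvd_diff[OF dvd_diff[OF b1 b2] dvd_mult2[OF a]])
    also have "\<dots> = snd (snd w) - snd (snd w\<^sub>0)" by (simp add: algebra_simps)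
    finally have "cls p m w = cls p m w\<^sub>0" using a i by (simp add: cls_eq_iff inc_def)
    then show "w \<in> coords n ` ?Q" using q' q0(3) by blast
  qed
  then have "card {w. (coords n q, w) \<in> G \<and> int p ^ m dvd fst (snd w) - \<alpha>} \<le> card ?Q"
    using finite_cubes by (intro surj_card_le) auto
  then show ?thesis using tube_family_fan[OF ds q0(1) m] by linarith
qed

lemma discretised_crowd:
  assumes "\<P> \<subseteq> cubes p \<delta>" "q \<in> \<P>" "m \<le> n"
  shows "\<exists>Q\<in>cubes_meeting p (real p powi (- int m)) (\<Union>\<P>).
    crowd p m (coords n ` \<P>) (coords n q) \<le> card {q' \<in> \<P>. q' \<subseteq> Q}"
proof -
  have qc: "q \<in> cubes p \<delta>" using assms by blast
  obtain x where x: "x \<in> q" "x \<in> Zp_plane p" using cubes_nonempty[OF qc] by blast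
  let ?Q = "cube p x (real p powi (- int m))"
  have fP: "finite \<P>" using finite_subset[OF assms(1) finite_cubes] .
  have "{v \<in> coords n ` \<P>. cls p m v = cls p m (coords n q)} \<subseteq> coords n ` {q' \<in> \<P>. q' \<subseteq> ?Q}"
    using subset_cube_of_cls[OF _ qc x(1) assms(3)] assms(1) by blast
  then have "crowd p m (coords n ` \<P>) (coords n q) \<le> card {q' \<in> \<P>. q' \<subseteq> ?Q}"
    unfolding crowd_def using fP by (intro surj_card_le) auto
  moreover have "?Q \<in> cubes_meeting p (real p powi (- int m)) (\<Union>\<P>)"
  proof -
    have "?Q \<in> cubes p (real p powi (- int m))" unfolding cubes_def using x(2) by blast
    then show ?thesis using cube_self[OF x(2), of m] x(1) assms(2) unfolding cubes_meeting_def by blast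
  qed
  ultimately show ?thesis by blast
qed

end


section \<open>Choice of the loss and the theorem\<close>

lemma eventually_linear_le_power:
  assumes "(1::real) < q"
  shows "\<forall>\<^sub>F n in sequentially. C * real n \<le> q ^ n"
proof -
  have "(\<lambda>n. real n * (1 / q) ^ n) \<longlonglongrightarrow> 0" using assms by (intro powser_times_n_limit_0) simp
  then have "(\<lambda>n. C * (real n * (1 / q) ^ n)) \<longlonglongrightarrow> C * 0" by (intro tendsto_intros)
  then have "\<forall>\<^sub>F n in sequentially. C * (real n * (1 / q) ^ n) < 1" by (rule order_tendstoD) simp
  then show ?thesis
  proof eventually_elim
    case (elim n)
    have "0 < q ^ n" using assms by simp
    then show ?case using elim by (simp add: power_divide divide_less_eq)
  qed
qed

lemma eventually_const_le_power:
  assumes "(1::real) < q"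
  shows "\<forall>\<^sub>F n in sequentially. C \<le> q ^ n"
  using eventually_linear_le_power[OF assms, of "\<bar>C\<bar>"] eventually_ge_at_top[of 1]
proof eventually_elim
  case (elim n)
  have "C \<le> \<bar>C\<bar> * 1" by simp
  also have "\<dots> \<le> \<bar>C\<bar> * real n" using elim(2) by (intro mult_left_mono) auto
  finally show ?case using elim(1) by linarith
qed

text \<open>
  The step \<open>k\<close> is chosen as large as \<open>p ^ k \<le> B\<close> permits, so \<open>n div k\<close> stays below a constant \<open>J\<close>.  Then
  \<open>L ^ (n div k + 1)\<close> is at most a polynomial in \<open>n\<close>, while \<open>B\<close> grows exponentially.
\<close>

lemma eventually_admissible_loss:
  fixes p :: nat
  assumes p: "2 \<le> p" and "0 < \<alpha>" "\<beta> < \<alpha>" "0 < K"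
  shows "\<forall>\<^sub>F n in sequentially. \<exists>k L. 0 < k \<and> p ^ (2 * n) < 2 ^ L \<and>
    (let B = real p powr (real n * \<alpha>) in
      8 \<le> B \<and> real (n + 1) \<le> B \<and> (real p)\<^sup>2 \<le> B \<and> K \<le> B \<and> K * real p powr (real n * \<beta>) \<le> B \<and>
      real p ^ k \<le> B \<and> real L ^ (n div k + 1) \<le> B \<and> 2 ^ (n div k) \<le> B)"
proof -
  define q where "q = real p powr \<alpha>"
  have p1: "1 < real p" using p by simp
  have q1: "1 < q" unfolding q_def using p1 assms(2) by simp
  have q'1: "1 < real p powr (\<alpha> - \<beta>)" using p1 assms(3) by simp
  define J where "J = nat \<lceil>2 / \<alpha>\<rceil>"
  have J: "2 / \<alpha> \<le> real J" unfolding J_def by linarith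
  define q2 where "q2 = q powr (1 / real (J + 1))"
  have q2: "1 < q2" "q2 ^ (J + 1) = q"
  proof -
    show "1 < q2" unfolding q2_def using q1 by (intro gr_one_powr) auto
    have "q2 ^ (J + 1) = q2 powr real (J + 1)" using \<open>1 < q2\<close> by (intro powr_realpow[symmetric]) simp
    also have "\<dots> = q" unfolding q2_def using q1 by (simp add: powr_powr)
    finally show "q2 ^ (J + 1) = q" .
  qed
  have Bq: "real p powr (real n * \<alpha>) = q ^ n" for n
    unfolding q_def using p1 by (simp add: powr_powr powr_realpow[symmetric] mult.commute)
  show ?thesis
    using eventually_const_le_power[OF q1, of "max (max 8 ((real p)\<^sup>2)) (max K (2 ^ J))"]
      eventually_linear_le_power[OF q1, of 2] eventually_const_le_power[OF q'1, of K]
      eventually_linear_le_power[OF q2(1), of "2 * real p + 1"]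
      eventually_ge_at_top[of 1] eventually_ge_at_top[of "nat \<lceil>2 / \<alpha>\<rceil>"]
  proof eventually_elim
    case (elim n)
    define B where "B = real p powr (real n * \<alpha>)"
    have B: "B = q ^ n" unfolding B_def by (rule Bq)
    define k where "k = nat \<lfloor>real n * \<alpha>\<rfloor>"
    \<comment> \<open>This gives \<open>p ^ (2 n) < 2 ^ L\<close> because \<open>p < 2 ^ p\<close>.\<close>
    define L where "L = 2 * n * p + 1"
    have "2 / \<alpha> \<le> real n" using elim(6) by linarith
    then have n\<alpha>: "2 \<le> real n * \<alpha>" using assms(2) by (simp add: divide_le_eq)
    have k: "real k \<le> real n * \<alpha>" "real n * \<alpha> / 2 \<le> real k" "0 < k"
      unfolding k_def using n\<alpha> by linarith+
    have "real (n div k * k) \<le> real n" by (simp only: of_nat_le_iff div_times_less_eq_dividend)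
    then have "real (n div k) \<le> real n / real k" using k(3) by (simp add: le_divide_eq)
    also have "\<dots> \<le> real n / (real n * \<alpha> / 2)"
      using k n\<alpha> by (intro divide_left_mono) auto
    also have "\<dots> = 2 / \<alpha>" using elim(5) assms(2) by simp
    finally have "real (n div k) \<le> real J" using J by linarith
    then have nk: "n div k \<le> J" by simp
    have c1: "8 \<le> B" "(real p)\<^sup>2 \<le> B" "K \<le> B" "2 ^ J \<le> B" using elim(1) by (simp_all add: B)
    have c2: "real (n + 1) \<le> B" using elim(2,5) by (simp add: B)
    have c3: "K * real p powr (real n * \<beta>) \<le> B"
    proof -
      have "K * real p powr (real n * \<beta>) \<le> (real p powr (\<alpha> - \<beta>)) ^ n * real p powr (real n * \<beta>)"
        using elim(3) by (rule mult_right_mono) simp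
      also have "(real p powr (\<alpha> - \<beta>)) ^ n = real p powr (real n * (\<alpha> - \<beta>))"
        using p1 by (simp add: powr_powr powr_realpow[symmetric] mult.commute)
      also have "\<dots> * real p powr (real n * \<beta>) = B"
        unfolding B_def by (simp add: powr_add[symmetric] algebra_simps)
      finally show ?thesis .
    qed
    have c4: "real p ^ k \<le> B"
    proof -
      have "real p ^ k = real p powr real k" using p1 by (simp add: powr_realpow)
      also have "\<dots> \<le> B" unfolding B_def using p1 k(1) by (intro powr_mono) auto
      finally show ?thesis .
    qed
    have c5: "real L ^ (n div k + 1) \<le> B"
    proof -
      have "real L \<le> (2 * real p + 1) * real n" using elim(5) by (simp add: L_def algebra_simps)
      then have "real L \<le> q2 ^ n" using elim(4) by linarith
      have "real L ^ (n div k + 1) \<le> real L ^ (J + 1)"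
        using nk by (intro power_increasing) (auto simp: L_def)
      also have "\<dots> \<le> (q2 ^ n) ^ (J + 1)" using \<open>real L \<le> q2 ^ n\<close> by (rule power_mono) simp
      also have "\<dots> = (q2 ^ (J + 1)) ^ n" by (simp only: power_mult[symmetric] mult.commute)
      finally show ?thesis unfolding q2(2) B .
    qed
    have c6: "2 ^ (n div k) \<le> B"
      by (rule order_trans[OF power_increasing[OF nk] c1(4)]) simp
    have c7: "p ^ (2 * n) < 2 ^ L"
    proof -
      have "p ^ (2 * n) \<le> (2 ^ p) ^ (2 * n)" using less_exp[of p] by (intro power_mono) auto
      also have "\<dots> = 2 ^ (2 * n * p)" by (simp only: power_mult[symmetric] mult_ac)
      also have "\<dots> < 2 ^ L" by (simp add: L_def)
      finally show ?thesis .
    qed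
    show ?case unfolding Let_def using k(3) c1 c2 c3 c4 c5 c6 c7 unfolding B_def
      by (intro exI[of _ k] exI[of _ L]) simp
  qed
qed

lemma scale_eq_powr:
  assumes "0 < p"
  shows "real p powi (- int n) = real p powr (- real n)"
  using assms by (simp add: power_int_minus powr_minus powr_realpow)

lemma powr_nonpos_le_1:
  fixes r x :: real
  assumes "1 < r" "x \<le> 0"
  shows "r powr x \<le> 1"
  using powr_mono[of x 0 r] assms by simp

text \<open>
  For \<open>\<epsilon> \<ge> 1\<close> the claim is trivial, since a single cube already has about \<open>M\<close> tubes
  and the power of \<open>\<delta>\<close> is at most \<open>1\<close>.  For \<open>\<epsilon> < 1\<close> the loss is
  \<open>B = \<delta> ^ (- \<epsilon> / 87)\<close>: \<open>tubes_bound\<close> costs \<open>B ^ 172\<close> in the square and \<open>|P| \<ge> \<delta> ^ (- t) / B\<close> one more factor, and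
  \<open>173 / 87 < 2\<close>.  Since \<open>\<eta> \<le> \<epsilon> / 1225\<close>, also \<open>K \<delta> ^ (- \<eta>) \<le> B\<close> for small \<open>\<delta>\<close>.
\<close>

theorem theorem4p1:
  fixes p :: nat and s t \<epsilon> \<eta> K :: real
  assumes "prime p"
    and "0 < s" and "s < 1" and "s < t" and "t < 2 - s"
    and "\<epsilon> > 0" and "\<eta> = \<epsilon>\<^sup>2 / 1225"
    and "K > 0"
  shows "\<exists>c > 0. \<exists>\<delta>\<^sub>0 > 0. \<forall>\<delta> \<in> scales p. \<delta> < 1 \<and> \<delta> \<le> \<delta>\<^sub>0 \<longrightarrow>
    (\<forall>(M :: nat) \<P> \<T> \<T>of.
       nice_configuration K p \<delta> s (\<delta> powr (- \<eta>)) M \<P> \<T> \<T>of \<longrightarrow>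
       real M \<ge> \<delta> powr (- s + \<eta>) \<longrightarrow>
       comparable K (real (card \<P>)) (\<delta> powr (- t)) \<longrightarrow>
       (\<forall>\<rho> \<in> scales p. \<delta> \<le> \<rho> \<and> \<rho> \<le> 1 \<longrightarrow>
          (\<forall>Q \<in> cubes_meeting p \<rho> (\<Union>\<P>).
             real (card {q \<in> \<P>. q \<subseteq> Q}) \<le> K * (\<delta> powr (- \<eta>) *
               max (\<rho> powr (2 - s) * real (card \<P>)) ((\<rho> / \<delta>) powr s)))) \<longrightarrow>
       real (card \<T>) \<ge> c * (\<delta> powr (- ((s + t) / 2) + \<epsilon>) * real M))"
proof (cases "\<epsilon> < 1")
  case False
  have p1: "p > 1" using assms(1) by (rule prime_gt_1_nat)
  show ?thesis
  proof (rule exI[of _ "1 / K"], intro conjI exI[of _ 1] ballI impI allI)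
    fix \<delta> M \<P> \<T> \<T>of
    assume \<delta>: "\<delta> \<in> scales p" "\<delta> < 1 \<and> \<delta> \<le> 1"
      and nice: "nice_configuration K p \<delta> s (\<delta> powr (- \<eta>)) M \<P> \<T> \<T>of"
      and cP: "comparable K (real (card \<P>)) (\<delta> powr (- t))"
    obtain n where n: "\<delta> = real p powi (- int n)" using \<delta>(1) by (auto simp: scales_def)
    interpret padic_scale p n \<delta> by unfold_locales (fact assms(1), fact n)
    have \<delta>0: "0 < \<delta>" using p1 by (simp add: n power_int_minus)
    have "\<P> \<noteq> {}" using cP \<delta>0 by (auto simp: comparable_def)
    then obtain q where q: "q \<in> \<P>" by blast
    have sub: "\<T>of q \<subseteq> \<T>" "\<T> \<subseteq> tubes p \<delta>"
      using nice q by (auto simp: nice_configuration_def configuration_def)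
    have "finite \<T>" using finite_subset[OF sub(2)] finite_cubes by (simp add: tubes_def)
    then have "real (card (\<T>of q)) \<le> real (card \<T>)" using sub(1) by (simp add: card_mono)
    moreover have "real M \<le> K * real (card (\<T>of q))"
      using nice q by (simp add: nice_configuration_def comparable_def)
    ultimately have "real M \<le> K * real (card \<T>)" using assms(8) by (meson mult_left_mono less_imp_le order_trans)
    moreover have "\<delta> powr (- ((s + t) / 2) + \<epsilon>) \<le> 1"
      using \<delta>0 \<delta>(2) False assms(5) by (intro powr_le1) auto
    then have "\<delta> powr (- ((s + t) / 2) + \<epsilon>) * real M \<le> 1 * real M" by (rule mult_right_mono) simp
    ultimately show "1 / K * (\<delta> powr (- ((s + t) / 2) + \<epsilon>) * real M) \<le> real (card \<T>)"
      using assms(8) by (simp add: divide_le_eq mult.commute)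
  qed (use assms(8) in simp_all)
next
  case True
  have p1: "p > 1" using assms(1) by (rule prime_gt_1_nat)
  then have p2: "p \<ge> 2" by simp
  have r1: "1 < real p" using p1 by simp
  define \<alpha> where "\<alpha> = \<epsilon> / 87"
  have \<alpha>0: "0 < \<alpha>" using assms(6) by (simp add: \<alpha>_def)
  have \<eta>\<alpha>: "\<eta> < \<alpha>"
  proof -
    have "\<epsilon>\<^sup>2 \<le> \<epsilon>" using True assms(6) by (simp add: power2_eq_square)
    then have "\<eta> \<le> \<epsilon> / 1225" unfolding assms(7) by simp
    also have "\<dots> < \<alpha>" unfolding \<alpha>_def using assms(6) by simp
    finally show ?thesis .
  qed
  obtain N where N: "\<And>n. N \<le> n \<Longrightarrow> \<exists>k L. 0 < k \<and> p ^ (2 * n) < 2 ^ L \<and>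
    (let B = real p powr (real n * \<alpha>) in
      8 \<le> B \<and> real (n + 1) \<le> B \<and> (real p)\<^sup>2 \<le> B \<and> K \<le> B \<and> K * real p powr (real n * \<eta>) \<le> B \<and>
      real p ^ k \<le> B \<and> real L ^ (n div k + 1) \<le> B \<and> 2 ^ (n div k) \<le> B)"
    using eventually_admissible_loss[OF p2 \<alpha>0 \<eta>\<alpha> assms(8)] unfolding eventually_sequentially by blast
  show ?thesis
  proof (rule exI[of _ 1], intro conjI exI[of _ "real p powi (- int N)"] ballI impI allI)
    fix \<delta> M \<P> \<T> \<T>of
    assume \<delta>: "\<delta> \<in> scales p" "\<delta> < 1 \<and> \<delta> \<le> real p powi (- int N)"
      and nice: "nice_configuration K p \<delta> s (\<delta> powr (- \<eta>)) M \<P> \<T> \<T>of"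
      and M_ge: "real M \<ge> \<delta> powr (- s + \<eta>)"
      and cP: "comparable K (real (card \<P>)) (\<delta> powr (- t))"
      and spacing: "\<forall>\<rho> \<in> scales p. \<delta> \<le> \<rho> \<and> \<rho> \<le> 1 \<longrightarrow>
          (\<forall>Q \<in> cubes_meeting p \<rho> (\<Union>\<P>).
             real (card {q \<in> \<P>. q \<subseteq> Q}) \<le> K * (\<delta> powr (- \<eta>) *
               max (\<rho> powr (2 - s) * real (card \<P>)) ((\<rho> / \<delta>) powr s)))"
    obtain n where n: "\<delta> = real p powi (- int n)" using \<delta>(1) by (auto simp: scales_def)
    interpret padic_scale p n \<delta> by unfold_locales (fact assms(1), fact n)
    have p0: "0 < p" using p1 by simp
    have \<delta>p: "\<delta> = real p powr (- real n)" unfolding n by (rule scale_eq_powr[OF p0])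
    have \<delta>x: "\<delta> powr x = real p powr (- real n * x)" for x unfolding \<delta>p by (simp add: powr_powr)
    have "real p powr (- real n) \<le> real p powr (- real N)"
      using \<delta>(2) unfolding \<delta>p scale_eq_powr[OF p0] by simp
    then have "N \<le> n" using r1 by simp
    then obtain k L where kL: "0 < k" "p ^ (2 * n) < 2 ^ L" and B':
      "let B = real p powr (real n * \<alpha>) in
        8 \<le> B \<and> real (n + 1) \<le> B \<and> (real p)\<^sup>2 \<le> B \<and> K \<le> B \<and> K * real p powr (real n * \<eta>) \<le> B \<and>
        real p ^ k \<le> B \<and> real L ^ (n div k + 1) \<le> B \<and> 2 ^ (n div k) \<le> B"
      using N by blast
    define B where "B = real p powr (real n * \<alpha>)"
    have B: "8 \<le> B" "real (n + 1) \<le> B" "(real p)\<^sup>2 \<le> B" "K \<le> B" "K * real p powr (real n * \<eta>) \<le> B"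
      "real p ^ k \<le> B" "real L ^ (n div k + 1) \<le> B" "2 ^ (n div k) \<le> B"
      using B' unfolding Let_def B_def[symmetric] by blast+
    have KB: "K * \<delta> powr (- \<eta>) \<le> B" using B(5) by (simp add: \<delta>x)
    define u where "u = real p powr (- s)"
    have u0: "0 < u" using r1 by (simp add: u_def)
    have um: "u ^ m = real p powr (- real m * s)" for m
      unfolding u_def using r1 by (simp add: powr_powr powr_realpow[symmetric] mult.commute)
    have pm: "real p ^ m = real p powr real m" for m using r1 by (simp add: powr_realpow)
    have rho_s: "(real p powi (- int m)) powr s = u ^ m" for m
      unfolding scale_eq_powr[OF p0] um by (simp add: powr_powr)
    define P where "P = coords n ` \<P>"
    define S where "S = coords n ` {q' \<in> cubes p \<delta>. tube p q' \<in> \<T>}"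
    define G where "G = {(v, w). \<exists>q\<in>\<P>. \<exists>q'\<in>cubes p \<delta>. tube p q' \<in> \<T>of q \<and> v = coords n q \<and> w = coords n q'}"
    have conf: "configuration p \<delta> \<P> \<T> \<T>of" using nice by (simp add: nice_configuration_def)
    have Tof: "delta_set_tubes p \<delta> s (\<delta> powr (- \<eta>)) (\<T>of q)" "real (card (\<T>of q)) \<le> K * real M"
        "real M \<le> K * real (card (\<T>of q))" if "q \<in> \<P>" for q
      using nice that by (auto simp: nice_configuration_def comparable_def)
    have sub: "\<P> \<subseteq> cubes p \<delta>" and on: "\<And>q T. q \<in> \<P> \<Longrightarrow> T \<in> \<T>of q \<Longrightarrow> q \<subseteq> T"
      using conf by (auto simp: configuration_def)
    note disc = discretised_config[OF conf, folded P_def S_def G_def]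
    have cards: "card P < 2 ^ L" "card S < 2 ^ L"
    proof -
      have "card P \<le> p ^ (2 * n)"
        unfolding disc(3) using card_mono[OF finite_cubes sub] card_cubes_le by linarith
      then show "card P < 2 ^ L" using kL(2) by simp
      have "card S \<le> card (cubes p \<delta>)"
        unfolding S_def using finite_cubes by (intro surj_card_le) auto
      then show "card S < 2 ^ L" using kL(2) card_cubes_le by linarith
    qed
    have M0: "0 < real M"
    proof -
      have "0 < \<delta> powr (- s + \<eta>)" using r1 by (simp add: \<delta>x)
      then show ?thesis using M_ge by linarith
    qed
    have B0: "0 < B" using B(1) by simp
    have Pup: "real (card P) \<le> K * real p powr (real n * t)" and Plow: "real p powr (real n * t) \<le> K * real (card P)"
      using cP unfolding comparable_def disc(3) by (simp_all add: \<delta>x)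
    interpret furstenberg_config p n P S G u B "real M" k L
    proof (intro furstenberg_config.intro incidence_config.intro furstenberg_config_axioms.intro)
      show "prime p" "finite P" "finite S" "G \<subseteq> P \<times> S" "0 < u" "8 \<le> B" "real p ^ k \<le> B" "0 < k"
        "real (n + 1) \<le> B" "(real p)\<^sup>2 \<le> B" "real L ^ (n div k + 1) \<le> B" "2 ^ (n div k) \<le> B"
        "card S < 2 ^ L" "card P < 2 ^ L" "0 < real M"
        using assms(1) disc(1,2,5) u0 B kL cards M0 by simp_all
      show "inc p n q t" if "(q, t) \<in> G" for q t using disc(6) that .
      show "u \<le> 1" unfolding u_def using r1 assms(2) by (intro powr_nonpos_le_1) auto
      show "1 \<le> real p * u"
      proof -
        have "real p * u = real p powr (1 - s)" unfolding u_def using r1 by (simp add: powr_diff powr_minus divide_inverse)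
        then show ?thesis using r1 assms(3) by (simp add: ge_one_powr_ge_zero)
      qed
      show "P \<noteq> {}"
      proof
        assume "P = {}"
        then have "real p powr (real n * t) \<le> 0" using Plow by simp
        then show False using r1 by simp
      qed
      show "real (card {t. (v, t) \<in> G \<and> int p ^ m dvd fst (snd t) - a}) \<le> B * real M * u ^ m"
        if v: "v \<in> P" "m \<le> n" for v m a
      proof -
        obtain q where q: "q \<in> \<P>" "v = coords n q" using v(1) by (auto simp: P_def)
        have "real (card {t. (v, t) \<in> G \<and> int p ^ m dvd fst (snd t) - a})
            \<le> \<delta> powr (- \<eta>) * (real p powi (- int m)) powr s * real (card (\<T>of q))"
          unfolding q(2) G_def by (rule discretised_fan[where \<P> = \<P> and \<T>of = \<T>of and q = q],
              fact sub, erule (1) on, fact q(1), rule Tof(1)[OF q(1)], fact v(2), simp)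
        also have "\<dots> \<le> \<delta> powr (- \<eta>) * u ^ m * (K * real M)"
          unfolding rho_s using Tof(2)[OF q(1)] u0 by (intro mult_left_mono) auto
        also have "\<dots> = (K * \<delta> powr (- \<eta>)) * (real M * u ^ m)" by simp
        also have "\<dots> \<le> B * (real M * u ^ m)" using KB u0 by (intro mult_right_mono) auto
        finally show ?thesis by simp
      qed
      show "real M \<le> B * real (card {t. (v, t) \<in> G})" if v: "v \<in> P" for v
      proof -
        obtain q where q: "q \<in> \<P>" "v = coords n q" using v by (auto simp: P_def)
        have "real M \<le> K * real (card (\<T>of q))" by (rule Tof(3)[OF q(1)])
        also have "\<dots> \<le> B * real (card (\<T>of q))" using B(4) by (intro mult_right_mono) auto
        finally show ?thesis unfolding q(2) disc(7)[OF q(1)] .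
      qed
      show "real (crowd p m P v) \<le> B * max (real (card P) / (real p ^ (2 * m) * u ^ m)) (1 / u ^ (n - m))"
        if v: "v \<in> P" "m \<le> n" for v m
      proof -
        obtain q where q: "q \<in> \<P>" "v = coords n q" using v(1) by (auto simp: P_def)
        let ?\<rho> = "real p powi (- int m)"
        obtain Q where Q: "Q \<in> cubes_meeting p ?\<rho> (\<Union>\<P>)" "crowd p m P v \<le> card {q' \<in> \<P>. q' \<subseteq> Q}"
          using discretised_crowd[OF sub q(1) v(2)] unfolding P_def q(2) by blast
        have "?\<rho> \<in> scales p" by (auto simp: scales_def)
        moreover have "\<delta> \<le> ?\<rho>" "?\<rho> \<le> 1"
          unfolding \<delta>p scale_eq_powr[OF p0] using r1 v(2) by (simp_all add: powr_nonpos_le_1)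
        ultimately have "real (card {q' \<in> \<P>. q' \<subseteq> Q}) \<le> K * (\<delta> powr (- \<eta>) *
               max (?\<rho> powr (2 - s) * real (card \<P>)) ((?\<rho> / \<delta>) powr s))"
          using spacing Q(1) by blast
        also have "?\<rho> powr (2 - s) * real (card \<P>) = real (card P) / (real p ^ (2 * m) * u ^ m)"
        proof -
          have "real p ^ (2 * m) * u ^ m = real p powr (real m * (2 - s))"
            unfolding um pm by (simp add: powr_add[symmetric] algebra_simps)
          moreover have "?\<rho> powr (2 - s) = 1 / real p powr (real m * (2 - s))"
          proof -
            have "?\<rho> powr (2 - s) = real p powr (- (real m * (2 - s)))"
              unfolding scale_eq_powr[OF p0] powr_powr by simp
            then show ?thesis by (simp only: powr_minus_divide)
          qed
          ultimately show ?thesis by (simp add: disc(3))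
        qed
        also have "(?\<rho> / \<delta>) powr s = 1 / u ^ (n - m)"
        proof -
          have "?\<rho> / \<delta> = real p powr (real (n - m))"
            unfolding scale_eq_powr[OF p0] \<delta>p using v(2) by (simp add: powr_diff[symmetric] of_nat_diff)
          then have "(?\<rho> / \<delta>) powr s = real p powr (real (n - m) * s)" by (simp only: powr_powr)
          moreover have "u ^ (n - m) = 1 / real p powr (real (n - m) * s)"
            unfolding um mult_minus_left by (rule powr_minus_divide)
          ultimately show ?thesis by simp
        qed
        finally have "real (card {q' \<in> \<P>. q' \<subseteq> Q})
            \<le> (K * \<delta> powr (- \<eta>)) * max (real (card P) / (real p ^ (2 * m) * u ^ m)) (1 / u ^ (n - m))"
          by (simp only: mult.assoc)
        also have "\<dots> \<le> B * max (real (card P) / (real p ^ (2 * m) * u ^ m)) (1 / u ^ (n - m))"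
          using KB u0 by (intro mult_right_mono) (auto simp: le_max_iff_disj)
        finally show ?thesis using Q(2) by linarith
      qed
      show "real (card P) \<le> B * (real p ^ (2 * n) * u ^ n)"
      proof -
        have "K * real p powr (real n * t) \<le> B * real p powr (real n * (2 - s))"
          using B(4) B0 assms(5) r1 by (intro mult_mono powr_mono mult_left_mono) auto
        also have "real p powr (real n * (2 - s)) = real p ^ (2 * n) * u ^ n"
          unfolding um pm by (simp add: powr_add[symmetric] algebra_simps)
        finally show ?thesis using Pup by linarith
      qed
      show "1 \<le> B * (real (card P) * u ^ n)"
      proof -
        have "1 \<le> real p powr (real n * (t - s))" using r1 assms(4) by (intro ge_one_powr_ge_zero) auto
        also have "\<dots> = real p powr (real n * t) * u ^ n"
          unfolding um by (simp add: powr_add[symmetric] algebra_simps)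
        also have "\<dots> \<le> K * real (card P) * u ^ n" using Plow u0 by (intro mult_right_mono) auto
        also have "\<dots> \<le> B * real (card P) * u ^ n" using B(4) u0 by (intro mult_right_mono) auto
        finally show ?thesis by (simp add: mult.assoc)
      qed
    qed
    define X where "X = \<delta> powr (- ((s + t) / 2) + \<epsilon>)"
    have "(X * real M)\<^sup>2 \<le> (real (card S))\<^sup>2"
    proof -
      have X2: "X\<^sup>2 = real p powr (real n * t) * real p powr (real n * s - 2 * real n * \<epsilon>)"
        unfolding X_def \<delta>x by (simp add: power2_eq_square powr_add[symmetric] algebra_simps)
      have "(X * real M)\<^sup>2 = X\<^sup>2 * (real M)\<^sup>2" by (rule power_mult_distrib)
      also have "\<dots> \<le> (B * real (card P)) * real p powr (real n * s - 2 * real n * \<epsilon>) * (real M)\<^sup>2"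
        unfolding X2 using order_trans[OF Plow mult_right_mono[OF B(4)]] by (intro mult_right_mono) auto
      also have "\<dots> = B * real p powr (real n * s - 2 * real n * \<epsilon>) * ((real M)\<^sup>2 * real (card P))" by simp
      also have "\<dots> \<le> B * real p powr (real n * s - 2 * real n * \<epsilon>) * (B ^ 172 * u ^ n * (real (card S))\<^sup>2)"
        using tubes_bound B0 by (intro mult_left_mono) auto
      also have "\<dots> = (B ^ 173 * u ^ n * real p powr (real n * s - 2 * real n * \<epsilon>)) * (real (card S))\<^sup>2"
        by (simp add: eval_nat_numeral mult_ac)
      also have "\<dots> \<le> 1 * (real (card S))\<^sup>2"
      proof (rule mult_right_mono)
        have "B ^ 173 = real p powr (173 * (real n * \<alpha>))"
          unfolding B_def using r1 by (simp add: powr_powr powr_realpow[symmetric] mult.commute)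
        then have "B ^ 173 * u ^ n * real p powr (real n * s - 2 * real n * \<epsilon>)
            = real p powr (173 * (real n * \<alpha>) - 2 * real n * \<epsilon>)"
          unfolding um by (simp add: powr_add[symmetric] algebra_simps)
        also have "\<dots> \<le> 1"
        proof -
          have "173 * (real n * \<alpha>) - 2 * real n * \<epsilon> \<le> 0"
            unfolding \<alpha>_def using assms(6) by (simp add: field_simps)
          then show ?thesis using r1 by (intro powr_nonpos_le_1)
        qed
        finally show "B ^ 173 * u ^ n * real p powr (real n * s - 2 * real n * \<epsilon>) \<le> 1" .
      qed simp
      finally show ?thesis by simp
    qed
    then have "X * real M \<le> real (card S)" by (rule power2_le_imp_le) simp
    then show "1 * (\<delta> powr (- ((s + t) / 2) + \<epsilon>) * real M) \<le> real (card \<T>)"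
      by (simp add: X_def disc(4))
  qed (use p1 in \<open>simp_all add: power_int_minus\<close>)
qed

end
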